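(* Let $(W,S)$ be a Coxeter system and let $\mathscr I\subseteq W$ be a nonempty $W$-graph ideal with respect to $J\subseteq\mathrm{Pos}(\mathscr I)$, with $W$-graph basis $C=\{c_w\mid w\in\mathscr I\}$ of $\mathscr S(\mathscr I,J)$ and corresponding $W$-graph $\Gamma=\Gamma(C)$. Let $\mathcal C_1$ be the cell of $\Gamma$ containing $c_1$ (the unique maximal cell of $\Gamma$ under $\le_\Gamma$). Then the set $\mathscr I_1=\{w\in\mathscr I\mid c_w\in\mathcal C_1\}$ is a $W$-graph ideal with respect to $J$, and the $W$-graph corresponding to $(\mathscr I_1,J)$ is exactly that of the maximal cell $\mathcal C_1$ of $\Gamma$ (the full subgraph of $\Gamma$ on $\mathcal C_1$, with inherited $\mu$ and $\tau$, via $c_w$ for $w\in\mathscr I_1$).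
   Context: **Hecke algebra.** $(W,S)$ is a Coxeter system with length function $l$, Bruhat order $\le$, and left weak order $\le_L$ ($u\le_L w$ iff $l(w)=l(wu^{-1})+l(u)$, i.e. $u$ is a suffix of $w$). $\mathcal A=\mathbb Z[q,q^{-1}]$, $\mathcal A^+=\mathbb Z[q]$. $\mathcal H$ is the associative $\mathcal A$-algebra generated by $T_s$ ($s\in S$) with $T_s^2=1+(q-q^{-1})T_s$ and the braid relations. The involution $a\mapsto\overline a$ of $\mathcal A$ with $\overline q=q^{-1}$ extends to a ring involution of $\mathcal H$ with $\overline{T_s}=T_s^{-1}$. **$W$-graphs and cells.** A $W$-graph is a triple $\Gamma=(V,\mu,\tau)$, with $V$ a set, $\mu\colon V\times V\to\mathbb Z$, and $\tau$ a map from $V$ to the power set of $S$, such that the free $\mathcal A$-module on $V$ is an $\mathcal H$-module via $T_sv=-q^{-1}v$ if $s\in\tau(v)$ and $T_sv=qv+\sum_{u\in V,\,s\in\tau(u)}\mu(u,v)u$ if $s\notin\tau(v)$. The preorder $\le_\Gamma$ on $V$ is the reflexive transitive closure of the relation $u\leftarrow_\Gamma v$ defined by $\tau(u)\nsubseteq\tau(v)$ and $\mu(u,v)\neq0$. The cells of $\Gamma$ are the classes of the associated equivalence relation, partially ordered by $\mathcal C\le_\Gamma\mathcal C'$ iff $u\le_\Gamma v$ for some (equivalently all) $u\in\mathcal C$, $v\in\mathcal C'$. Each cell, with restricted $\mu$ and $\tau$, is a $W$-graph. **$W$-graph ideals.** For $J\subseteq S$, $D_J=\{w\in W\mid l(ws)>l(w)\text{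 for all }s\in J\}$; $\mathrm{Pos}(X)=\{s\in S\mid l(xs)>l(x)\text{ for all }x\in X\}$. An ideal of $(W,\le_L)$ is a subset $\mathscr I\subseteq W$ containing every suffix of each of its elements. Let $\mathscr I$ be a nonempty ideal and $J\subseteq\mathrm{Pos}(\mathscr I)$. For $w\in\mathscr I$ put $\mathrm{SA}(w)=\{s\in S\mid sw>w,\ sw\in\mathscr I\}$, $\mathrm{SD}(w)=\{s\in S\mid sw<w\}$, $\mathrm{WA}(w)=\{s\in S\mid sw>w,\ sw\in D_J\setminus\mathscr I\}$, $\mathrm{WD}(w)=\{s\in S\mid sw>w,\ sw\notin D_J\}$, and $\mathrm D(w)=\mathrm{SD}(w)\cup\mathrm{WD}(w)$. $\mathscr I$ is a $W$-graph ideal with respect to $J$ if: (i) there is an $\mathcal A$-free $\mathcal H$-module $\mathscr S(\mathscr I,J)$ with $\mathcal A$-basis $(b_w\mid w\in\mathscr I)$ such that $T_sb_w=b_{sw}$ if $s\in\mathrm{SA}(w)$; $T_sb_w=b_{sw}+(q-q^{-1})b_w$ if $s\in\mathrm{SD}(w)$; $T_sb_w=-q^{-1}b_w$ if $s\in\mathrm{WD}(w)$; $T_sb_w=qb_w-\sum_{y\in\mathscr I,\,y<sw}r^s_{y,w}b_y$ for some $r^s_{y,w}\in q\mathcal A^+$ if $s\in\mathrm{WA}(w)$; (ii) this module admits an $\mathcal A$-semilinear involution $\alpha\mapsto\overline\alpha$ with $\overline{b_1}=b_1$ and $\overline{h\alpha}=\overline h\,\overline\alpha$ for all $h\in\mathcal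 H$ and all $\alpha$ in the module. **Associated $W$-graph (known).** If $\mathscr I$ is a $W$-graph ideal with respect to $J$, then $\mathscr S(\mathscr I,J)$ has a unique $\mathcal A$-basis $C=(c_w\mid w\in\mathscr I)$ (the $W$-graph basis) with $\overline{c_w}=c_w$ and $b_w=c_w+q\sum_{y\in\mathscr I,\,y<w}q_{y,w}c_y$, $q_{y,w}\in\mathcal A^+$. Let $\mu_{y,w}$ be the constant term of $q_{y,w}$. Put $\mu(c_y,c_w)=\mu_{y,w}$ if $y<w$, $\mu_{w,y}$ if $w<y$, and $0$ otherwise, and $\tau(c_w)=\mathrm D(w)$. Then $\Gamma(C)=(C,\mu,\tau)$ is a $W$-graph, called the $W$-graph corresponding to $(\mathscr I,J)$; it depends only on $(\mathscr I,J)$. *)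

theory Defs
  imports "HOL-Algebra.QuotRing" "HOL-Algebra.Module" "HOL-Algebra.Multiplicative_Group"
    "HOL-Algebra.Generated_Groups" "HOL-Library.Poly_Mapping"
begin

section \<open>Laurent polynomials\<close>

text \<open>Finitely supported functions \<^typ>\<open>int \<Rightarrow>\<^sub>0 int\<close> with the convolution product are the
  group ring of the integers over the integers, that is \<open>\<A> = \<int>[q, q\<^sup>-\<^sup>1]\<close>;
  \<open>lookup a k\<close> is the coefficient of \<open>q\<^sup>k\<close>.\<close>

type_synonym laurent = "int \<Rightarrow>\<^sub>0 int"

definition lq :: laurent where
  "lq = Poly_Mapping.single 1 1"

definition lq_inv :: laurent where
  "lq_inv = Poly_Mapping.single (- 1) 1"

definition laurent_bar :: "laurent \<Rightarrow> laurent" where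
  "laurent_bar a = Poly_Mapping.map_key uminus a"

definition laurent_pos :: "laurent set" where
  "laurent_pos = {a. \<forall>k \<in> Poly_Mapping.keys a. 0 \<le> k}"

definition constant_term :: "laurent \<Rightarrow> int" where
  "constant_term a = Poly_Mapping.lookup a 0"


section \<open>Coxeter systems\<close>

definition word_prod :: "'w monoid \<Rightarrow> 'w list \<Rightarrow> 'w" where
  "word_prod W ws = foldr (mult W) ws (one W)"

fun alt_word :: "nat \<Rightarrow> 'a \<Rightarrow> 'a \<Rightarrow> 'a list" where
  "alt_word 0 s t = []"
| "alt_word (Suc n) s t = s # alt_word n t s"

text \<open>\<open>coxeter_order W s t\<close> is the order \<open>m(s,t)\<close> of \<open>st\<close>, with value 0 if the order is infinite.\<close>

definition coxeter_order :: "'w monoid \<Rightarrow> 'w \<Rightarrow> 'w \<Rightarrow> nat" where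
  "coxeter_order W s t = group.ord W (s \<otimes>\<^bsub>W\<^esub> t)"

text \<open>The congruence on words over \<open>S\<close> generated by the relators \<open>(st)\<^sup>m\<^sup>(\<^sup>s\<^sup>,\<^sup>t\<^sup>)\<close>. Since
  \<open>m(s,s) = 1\<close>, the relator for \<open>s = t\<close> is \<open>ss\<close>; hence generators are self-inverse modulo the
  congruence and no formal inverses are needed. An infinite order gives the empty relator.\<close>

inductive coxeter_equiv :: "'w monoid \<Rightarrow> 'w set \<Rightarrow> 'w list \<Rightarrow> 'w list \<Rightarrow> bool" for W S where
  relator: "\<lbrakk>us \<in> lists S; vs \<in> lists S; s \<in> S; t \<in> S\<rbrakk> \<Longrightarrow>
    coxeter_equiv W S (us @ alt_word (2 * coxeter_order W s t) s t @ vs) (us @ vs)"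
| refl: "us \<in> lists S \<Longrightarrow> coxeter_equiv W S us us"
| sym: "coxeter_equiv W S us vs \<Longrightarrow> coxeter_equiv W S vs us"
| trans: "\<lbrakk>coxeter_equiv W S us vs; coxeter_equiv W S vs ws\<rbrakk> \<Longrightarrow> coxeter_equiv W S us ws"

locale coxeter_system = group W for W :: "'w monoid" (structure) +
  fixes S :: "'w set"
  assumes gens_closed: "S \<subseteq> carrier W"
    and gens_involution: "s \<in> S \<Longrightarrow> s \<noteq> \<one> \<and> s \<otimes> s = \<one>"
    and gens_generate: "generate W S = carrier W"
    and presentation: "\<lbrakk>ws \<in> lists S; word_prod W ws = \<one>\<rbrakk> \<Longrightarrow> coxeter_equiv W S ws []"

definition len :: "'w monoid \<Rightarrow> 'w set \<Rightarrow> 'w \<Rightarrow> nat" where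
  "len W S w = (LEAST n. \<exists>ws \<in> lists S. length ws = n \<and> word_prod W ws = w)"

definition reflections :: "'w monoid \<Rightarrow> 'w set \<Rightarrow> 'w set" where
  "reflections W S = {w \<otimes>\<^bsub>W\<^esub> s \<otimes>\<^bsub>W\<^esub> inv\<^bsub>W\<^esub> w | w s. w \<in> carrier W \<and> s \<in> S}"

definition bruhat_step :: "'w monoid \<Rightarrow> 'w set \<Rightarrow> 'w \<Rightarrow> 'w \<Rightarrow> bool" where
  "bruhat_step W S u w \<longleftrightarrow> u \<in> carrier W \<and>
     (\<exists>t \<in> reflections W S. w = u \<otimes>\<^bsub>W\<^esub> t) \<and> len W S u < len W S w"

definition bruhat_le :: "'w monoid \<Rightarrow> 'w set \<Rightarrow> 'w \<Rightarrow> 'w \<Rightarrow> bool" where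
  "bruhat_le W S = (bruhat_step W S)\<^sup>*\<^sup>*"

definition bruhat_less :: "'w monoid \<Rightarrow> 'w set \<Rightarrow> 'w \<Rightarrow> 'w \<Rightarrow> bool" where
  "bruhat_less W S u w \<longleftrightarrow> bruhat_le W S u w \<and> u \<noteq> w"

definition left_weak_le :: "'w monoid \<Rightarrow> 'w set \<Rightarrow> 'w \<Rightarrow> 'w \<Rightarrow> bool" where
  "left_weak_le W S u w \<longleftrightarrow> len W S w = len W S (w \<otimes>\<^bsub>W\<^esub> inv\<^bsub>W\<^esub> u) + len W S u"


section \<open>The Hecke algebra\<close>

datatype 'w free_word = Word (letters: "'w list")

instantiation free_word :: (type) monoid_add
begin

definition zero_free_word :: "'a free_word" where
  "0 = Word []"

definition plus_free_word :: "'a free_word \<Rightarrow> 'a free_word \<Rightarrow> 'a free_word" where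
  "u + v = Word (letters u @ letters v)"

instance
  by standard (simp_all add: zero_free_word_def plus_free_word_def)

end

type_synonym 'w free_elt = "'w free_word \<Rightarrow>\<^sub>0 laurent"

text \<open>The monoid ring of the free monoid: the free associative \<open>\<A>\<close>-algebra on \<open>S\<close>.\<close>

definition free_algebra :: "'w set \<Rightarrow> 'w free_elt ring" where
  "free_algebra S =
    \<lparr>carrier = {f. \<forall>u \<in> Poly_Mapping.keys f. letters u \<in> lists S},
     monoid.mult = (*), one = 1, ring.zero = 0, add = (+)\<rparr>"

definition free_monom :: "'w list \<Rightarrow> 'w free_elt" where
  "free_monom ws = Poly_Mapping.single (Word ws) 1"

definition free_const :: "laurent \<Rightarrow> 'w free_elt" where
  "free_const a = Poly_Mapping.single (Word []) a"

definition hecke_relators :: "'w monoid \<Rightarrow> 'w set \<Rightarrow> 'w free_elt set" where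
  "hecke_relators W S =
    {free_monom [s, s] - (1 + free_const (lq - lq_inv) * free_monom [s]) | s. s \<in> S} \<union>
    {free_monom (alt_word (coxeter_order W s t) s t) - free_monom (alt_word (coxeter_order W s t) t s)
      | s t. s \<in> S \<and> t \<in> S \<and> s \<noteq> t \<and> coxeter_order W s t \<noteq> 0}"

type_synonym 'w hecke_elt = "'w free_elt set"

definition hecke_ideal :: "'w monoid \<Rightarrow> 'w set \<Rightarrow> 'w free_elt set" where
  "hecke_ideal W S = Idl\<^bsub>free_algebra S\<^esub> (hecke_relators W S)"

definition hecke :: "'w monoid \<Rightarrow> 'w set \<Rightarrow> 'w hecke_elt ring" where
  "hecke W S = free_algebra S Quot hecke_ideal W S"

definition hecke_T :: "'w monoid \<Rightarrow> 'w set \<Rightarrow> 'w \<Rightarrow> 'w hecke_elt" where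
  "hecke_T W S s = hecke_ideal W S +>\<^bsub>free_algebra S\<^esub> free_monom [s]"

text \<open>The structure map \<open>\<A> \<rightarrow> \<H>\<close>.\<close>

definition hecke_const :: "'w monoid \<Rightarrow> 'w set \<Rightarrow> laurent \<Rightarrow> 'w hecke_elt" where
  "hecke_const W S a = hecke_ideal W S +>\<^bsub>free_algebra S\<^esub> free_const a"

definition hecke_bar :: "'w monoid \<Rightarrow> 'w set \<Rightarrow> 'w hecke_elt \<Rightarrow> 'w hecke_elt" where
  "hecke_bar W S = (THE f. f \<in> extensional (carrier (hecke W S)) \<and>
     f \<in> ring_hom (hecke W S) (hecke W S) \<and>
     (\<forall>h \<in> carrier (hecke W S). f (f h) = h) \<and>
     (\<forall>a. f (hecke_const W S a) = hecke_const W S (laurent_bar a)) \<and>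
     (\<forall>s \<in> S. f (hecke_T W S s) = inv\<^bsub>hecke W S\<^esub> (hecke_T W S s)))"


section \<open>Modules over the Hecke algebra\<close>

text \<open>The locale \<^locale>\<open>module\<close> requires a commutative ring of scalars.\<close>

locale left_module = R?: ring R + M?: abelian_group M
  for R :: "'r ring" (structure) and M :: "('r, 'm) module" (structure) +
  assumes smult_closed:
      "\<lbrakk>a \<in> carrier R; x \<in> carrier M\<rbrakk> \<Longrightarrow> a \<odot>\<^bsub>M\<^esub> x \<in> carrier M"
    and smult_l_distr:
      "\<lbrakk>a \<in> carrier R; b \<in> carrier R; x \<in> carrier M\<rbrakk> \<Longrightarrow>
        (a \<oplus>\<^bsub>R\<^esub> b) \<odot>\<^bsub>M\<^esub> x = a \<odot>\<^bsub>M\<^esub> x \<oplus>\<^bsub>M\<^esub> b \<odot>\<^bsub>M\<^esub> x"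
    and smult_r_distr:
      "\<lbrakk>a \<in> carrier R; x \<in> carrier M; y \<in> carrier M\<rbrakk> \<Longrightarrow>
        a \<odot>\<^bsub>M\<^esub> (x \<oplus>\<^bsub>M\<^esub> y) = a \<odot>\<^bsub>M\<^esub> x \<oplus>\<^bsub>M\<^esub> a \<odot>\<^bsub>M\<^esub> y"
    and smult_assoc:
      "\<lbrakk>a \<in> carrier R; b \<in> carrier R; x \<in> carrier M\<rbrakk> \<Longrightarrow>
        (a \<otimes>\<^bsub>R\<^esub> b) \<odot>\<^bsub>M\<^esub> x = a \<odot>\<^bsub>M\<^esub> (b \<odot>\<^bsub>M\<^esub> x)"
    and smult_one:
      "x \<in> carrier M \<Longrightarrow> \<one>\<^bsub>R\<^esub> \<odot>\<^bsub>M\<^esub> x = x"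

text \<open>An \<open>\<H>\<close>-module is an \<open>\<A>\<close>-module through the structure map.\<close>

definition scal :: "'w monoid \<Rightarrow> 'w set \<Rightarrow> ('w hecke_elt, 'm) module \<Rightarrow> laurent \<Rightarrow> 'm \<Rightarrow> 'm" where
  "scal W S M a x = hecke_const W S a \<odot>\<^bsub>M\<^esub> x"

definition T_act :: "'w monoid \<Rightarrow> 'w set \<Rightarrow> ('w hecke_elt, 'm) module \<Rightarrow> 'w \<Rightarrow> 'm \<Rightarrow> 'm" where
  "T_act W S M s x = hecke_T W S s \<odot>\<^bsub>M\<^esub> x"

definition is_basis ::
  "'w monoid \<Rightarrow> 'w set \<Rightarrow> ('w hecke_elt, 'm) module \<Rightarrow> 'x set \<Rightarrow> ('x \<Rightarrow> 'm) \<Rightarrow> bool" where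
  "is_basis W S M X b \<longleftrightarrow> (\<forall>w \<in> X. b w \<in> carrier M) \<and>
     (\<forall>x \<in> carrier M. \<exists>!f :: 'x \<Rightarrow>\<^sub>0 laurent. Poly_Mapping.keys f \<subseteq> X \<and>
        x = finsum M (\<lambda>w. scal W S M (Poly_Mapping.lookup f w) (b w)) (Poly_Mapping.keys f))"


section \<open>W-graph ideals\<close>

definition D_set :: "'w monoid \<Rightarrow> 'w set \<Rightarrow> 'w set \<Rightarrow> 'w set" where
  "D_set W S J = {w \<in> carrier W. \<forall>s \<in> J. len W S (w \<otimes>\<^bsub>W\<^esub> s) > len W S w}"

definition Pos :: "'w monoid \<Rightarrow> 'w set \<Rightarrow> 'w set \<Rightarrow> 'w set" where
  "Pos W S X = {s \<in> S. \<forall>x \<in> X. len W S (x \<otimes>\<^bsub>W\<^esub> s) > len W S x}"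

definition weak_ideal :: "'w monoid \<Rightarrow> 'w set \<Rightarrow> 'w set \<Rightarrow> bool" where
  "weak_ideal W S I \<longleftrightarrow> I \<subseteq> carrier W \<and>
     (\<forall>w \<in> I. \<forall>u \<in> carrier W. left_weak_le W S u w \<longrightarrow> u \<in> I)"

definition SA :: "'w monoid \<Rightarrow> 'w set \<Rightarrow> 'w set \<Rightarrow> 'w \<Rightarrow> 'w set" where
  "SA W S I w = {s \<in> S. bruhat_less W S w (s \<otimes>\<^bsub>W\<^esub> w) \<and> s \<otimes>\<^bsub>W\<^esub> w \<in> I}"

definition SD :: "'w monoid \<Rightarrow> 'w set \<Rightarrow> 'w \<Rightarrow> 'w set" where
  "SD W S w = {s \<in> S. bruhat_less W S (s \<otimes>\<^bsub>W\<^esub> w) w}"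

definition WA :: "'w monoid \<Rightarrow> 'w set \<Rightarrow> 'w set \<Rightarrow> 'w set \<Rightarrow> 'w \<Rightarrow> 'w set" where
  "WA W S J I w =
     {s \<in> S. bruhat_less W S w (s \<otimes>\<^bsub>W\<^esub> w) \<and> s \<otimes>\<^bsub>W\<^esub> w \<in> D_set W S J - I}"

definition WD :: "'w monoid \<Rightarrow> 'w set \<Rightarrow> 'w set \<Rightarrow> 'w \<Rightarrow> 'w set" where
  "WD W S J w = {s \<in> S. bruhat_less W S w (s \<otimes>\<^bsub>W\<^esub> w) \<and> s \<otimes>\<^bsub>W\<^esub> w \<notin> D_set W S J}"

definition descents :: "'w monoid \<Rightarrow> 'w set \<Rightarrow> 'w set \<Rightarrow> 'w \<Rightarrow> 'w set" where
  "descents W S J w = SD W S w \<union> WD W S J w"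

definition hecke_action ::
  "'w monoid \<Rightarrow> 'w set \<Rightarrow> 'w set \<Rightarrow> 'w set \<Rightarrow> ('w hecke_elt, 'm) module \<Rightarrow> ('w \<Rightarrow> 'm) \<Rightarrow> bool" where
  "hecke_action W S J I M b \<longleftrightarrow> (\<forall>w \<in> I.
     (\<forall>s \<in> SA W S I w. T_act W S M s (b w) = b (s \<otimes>\<^bsub>W\<^esub> w)) \<and>
     (\<forall>s \<in> SD W S w.
        T_act W S M s (b w) = b (s \<otimes>\<^bsub>W\<^esub> w) \<oplus>\<^bsub>M\<^esub> scal W S M (lq - lq_inv) (b w)) \<and>
     (\<forall>s \<in> WD W S J w. T_act W S M s (b w) = scal W S M (- lq_inv) (b w)) \<and>
     (\<forall>s \<in> WA W S J I w. \<exists>r :: 'w \<Rightarrow> laurent.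
        (\<forall>y. r y \<in> (*) lq ` laurent_pos) \<and>
        T_act W S M s (b w) = scal W S M lq (b w) \<ominus>\<^bsub>M\<^esub>
          finsum M (\<lambda>y. scal W S M (r y) (b y)) {y \<in> I. bruhat_less W S y (s \<otimes>\<^bsub>W\<^esub> w)}))"

definition module_involution ::
  "'w monoid \<Rightarrow> 'w set \<Rightarrow> ('w hecke_elt, 'm) module \<Rightarrow> ('m \<Rightarrow> 'm) \<Rightarrow> bool" where
  "module_involution W S M bar \<longleftrightarrow>
     (\<forall>x \<in> carrier M. bar x \<in> carrier M \<and> bar (bar x) = x) \<and>
     (\<forall>x \<in> carrier M. \<forall>y \<in> carrier M. bar (x \<oplus>\<^bsub>M\<^esub> y) = bar x \<oplus>\<^bsub>M\<^esub> bar y) \<and>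
     (\<forall>a. \<forall>x \<in> carrier M. bar (scal W S M a x) = scal W S M (laurent_bar a) (bar x)) \<and>
     (\<forall>h \<in> carrier (hecke W S). \<forall>x \<in> carrier M. bar (h \<odot>\<^bsub>M\<^esub> x) = hecke_bar W S h \<odot>\<^bsub>M\<^esub> bar x)"

text \<open>\<open>ideal_module W S J I M b bar\<close>: the module \<open>M\<close> with basis \<open>b\<close> and involution \<open>bar\<close> is a
  module \<open>\<S>(I, J)\<close> as required of a W-graph ideal \<open>I\<close> with respect to \<open>J\<close>.\<close>

definition ideal_module ::
  "'w monoid \<Rightarrow> 'w set \<Rightarrow> 'w set \<Rightarrow> 'w set \<Rightarrow> ('w hecke_elt, 'm) module \<Rightarrow> ('w \<Rightarrow> 'm) \<Rightarrow>
    ('m \<Rightarrow> 'm) \<Rightarrow> bool" where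
  "ideal_module W S J I M b bar \<longleftrightarrow>
     left_module (hecke W S) M \<and> is_basis W S M I b \<and> hecke_action W S J I M b \<and>
     module_involution W S M bar \<and> bar (b (one W)) = b (one W)"

text \<open>An existential quantifier cannot range over types. Fixing the type of the module elements
  to \<^typ>\<open>'w \<Rightarrow>\<^sub>0 laurent\<close> loses no generality, since a free \<open>\<A>\<close>-module with a basis indexed by
  \<open>I\<close> is isomorphic to the module of all \<open>f\<close> with \<open>keys f \<subseteq> I\<close>.\<close>

definition W_graph_ideal :: "'w monoid \<Rightarrow> 'w set \<Rightarrow> 'w set \<Rightarrow> 'w set \<Rightarrow> bool" where
  "W_graph_ideal W S J I \<longleftrightarrow> I \<noteq> {} \<and> weak_ideal W S I \<and> J \<subseteq> Pos W S I \<and>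
     (\<exists>(M :: ('w hecke_elt, 'w \<Rightarrow>\<^sub>0 laurent) module) b bar. ideal_module W S J I M b bar)"


section \<open>W-graphs\<close>

record ('v, 's) wgraph =
  verts :: "'v set"
  mu :: "'v \<Rightarrow> 'v \<Rightarrow> int"
  tau :: "'v \<Rightarrow> 's set"

text \<open>The module \<open>M\<close> with basis \<open>e\<close> is the free \<open>\<A>\<close>-module on the vertex set. The sum over \<open>u\<close>
  makes sense in it only if it is finite, which is required explicitly because
  \<^const>\<open>finsum\<close> over an infinite set is zero by convention.\<close>

definition W_graph :: "'w monoid \<Rightarrow> 'w set \<Rightarrow> ('v, 'w) wgraph \<Rightarrow> bool" where
  "W_graph W S \<Gamma> \<longleftrightarrow> (\<forall>v \<in> verts \<Gamma>. tau \<Gamma> v \<subseteq> S) \<and>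
     (\<exists>(M :: ('w hecke_elt, 'v \<Rightarrow>\<^sub>0 laurent) module) e.
        left_module (hecke W S) M \<and> is_basis W S M (verts \<Gamma>) e \<and>
        (\<forall>v \<in> verts \<Gamma>. \<forall>s \<in> S.
           (s \<in> tau \<Gamma> v \<longrightarrow> T_act W S M s (e v) = scal W S M (- lq_inv) (e v)) \<and>
           (s \<notin> tau \<Gamma> v \<longrightarrow>
              finite {u \<in> verts \<Gamma>. s \<in> tau \<Gamma> u \<and> mu \<Gamma> u v \<noteq> 0} \<and>
              T_act W S M s (e v) = scal W S M lq (e v) \<oplus>\<^bsub>M\<^esub>
                finsum M (\<lambda>u. scal W S M (of_int (mu \<Gamma> u v)) (e u))
                  {u \<in> verts \<Gamma>. s \<in> tau \<Gamma> u \<and> mu \<Gamma> u v \<noteq> 0})))"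

definition arrow :: "('v, 's) wgraph \<Rightarrow> 'v \<Rightarrow> 'v \<Rightarrow> bool" where
  "arrow \<Gamma> u v \<longleftrightarrow> u \<in> verts \<Gamma> \<and> v \<in> verts \<Gamma> \<and> \<not> tau \<Gamma> u \<subseteq> tau \<Gamma> v \<and> mu \<Gamma> u v \<noteq> 0"

definition wg_le :: "('v, 's) wgraph \<Rightarrow> 'v \<Rightarrow> 'v \<Rightarrow> bool" where
  "wg_le \<Gamma> = (arrow \<Gamma>)\<^sup>*\<^sup>*"

definition cell_of :: "('v, 's) wgraph \<Rightarrow> 'v \<Rightarrow> 'v set" where
  "cell_of \<Gamma> v = {u \<in> verts \<Gamma>. wg_le \<Gamma> u v \<and> wg_le \<Gamma> v u}"

definition cells :: "('v, 's) wgraph \<Rightarrow> 'v set set" where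
  "cells \<Gamma> = cell_of \<Gamma> ` verts \<Gamma>"

definition cell_le :: "('v, 's) wgraph \<Rightarrow> 'v set \<Rightarrow> 'v set \<Rightarrow> bool" where
  "cell_le \<Gamma> C C' \<longleftrightarrow> (\<exists>u \<in> C. \<exists>v \<in> C'. wg_le \<Gamma> u v)"

definition maximal_cells :: "('v, 's) wgraph \<Rightarrow> 'v set set" where
  "maximal_cells \<Gamma> = {C \<in> cells \<Gamma>. \<forall>C' \<in> cells \<Gamma>. cell_le \<Gamma> C C' \<longrightarrow> C' = C}"

text \<open>In all graphs below \<open>mu\<close> and \<open>tau\<close> are 0 and empty outside the vertex set, so that equality
  of records is equality of the triples \<open>(V, \<mu>, \<tau>)\<close>.\<close>

definition full_subgraph :: "('v, 's) wgraph \<Rightarrow> 'v set \<Rightarrow> ('v, 's) wgraph" where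
  "full_subgraph \<Gamma> X =
    \<lparr>verts = X,
     mu = (\<lambda>u v. if u \<in> X \<and> v \<in> X then mu \<Gamma> u v else 0),
     tau = (\<lambda>v. if v \<in> X then tau \<Gamma> v else {})\<rparr>"

text \<open>\<open>p y w\<close> is the coefficient \<open>q\<^bsub>y,w\<^esub>\<close>; it is relevant only for \<open>y, w \<in> I\<close> with \<open>y < w\<close>.\<close>

definition W_graph_basis ::
  "'w monoid \<Rightarrow> 'w set \<Rightarrow> 'w set \<Rightarrow> ('w hecke_elt, 'm) module \<Rightarrow> ('w \<Rightarrow> 'm) \<Rightarrow> ('m \<Rightarrow> 'm) \<Rightarrow>
    ('w \<Rightarrow> 'm) \<Rightarrow> ('w \<Rightarrow> 'w \<Rightarrow> laurent) \<Rightarrow> bool" where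
  "W_graph_basis W S I M b bar c p \<longleftrightarrow> is_basis W S M I c \<and>
     (\<forall>w \<in> I. bar (c w) = c w) \<and>
     (\<forall>w \<in> I. \<forall>y \<in> I. bruhat_less W S y w \<longrightarrow> p y w \<in> laurent_pos) \<and>
     (\<forall>w \<in> I. b w = c w \<oplus>\<^bsub>M\<^esub> scal W S M lq
        (finsum M (\<lambda>y. scal W S M (p y w) (c y)) {y \<in> I. bruhat_less W S y w}))"

text \<open>The graph \<open>\<Gamma>(C)\<close>, with the vertex \<open>c\<^bsub>w\<^esub>\<close> represented by its index \<open>w\<close>, so that graphs coming
  from different modules can be compared.\<close>

definition basis_graph ::
  "'w monoid \<Rightarrow> 'w set \<Rightarrow> 'w set \<Rightarrow> 'w set \<Rightarrow> ('w \<Rightarrow> 'w \<Rightarrow> laurent) \<Rightarrow> ('w, 'w) wgraph" where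
  "basis_graph W S J I p =
    \<lparr>verts = I,
     mu = (\<lambda>y w.
       if y \<in> I \<and> w \<in> I \<and> bruhat_less W S y w then constant_term (p y w)
       else if y \<in> I \<and> w \<in> I \<and> bruhat_less W S w y then constant_term (p w y)
       else 0),
     tau = (\<lambda>w. if w \<in> I then descents W S J w else {})\<rparr>"

definition corresponding_W_graph ::
  "'w monoid \<Rightarrow> 'w set \<Rightarrow> 'w set \<Rightarrow> 'w set \<Rightarrow> ('w, 'w) wgraph \<Rightarrow> bool" where
  "corresponding_W_graph W S J I \<Gamma> \<longleftrightarrow>
     (\<exists>(M :: ('w hecke_elt, 'w \<Rightarrow>\<^sub>0 laurent) module) b bar c p.
        ideal_module W S J I M b bar \<and> W_graph_basis W S I M b bar c p \<and>
        \<Gamma> = basis_graph W S J I p \<and> W_graph W S \<Gamma>)"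

end

theory Submission
  imports Defs "HOL-Library.Sublist"
begin

text \<open>In coordinates with respect to the basis \<open>(c\<^sub>w)\<close>, the generators act by the W-graph formula: by
  induction on the length of \<open>w\<close>, the difference of the two sides is bar invariant and has all its
  coefficients in \<open>q \<A>\<^sup>+\<close>, so it vanishes. Since \<open>\<mu>(c\<^sub>s\<^sub>w, c\<^sub>w) = 1\<close> whenever \<open>w < sw\<close> in \<open>I\<close>, suffixes
  are larger in the cell preorder. Hence \<open>c\<^sub>1\<close> is a greatest element, \<open>I\<^sub>1\<close> is an ideal, and
  \<open>I - I\<^sub>1\<close> is closed under the preorder, so that the \<open>c\<^sub>w\<close> with \<open>w \<in> I - I\<^sub>1\<close> span a submodule. The
  quotient by it is the required module for \<open>I\<^sub>1\<close>: the images of the \<open>b\<^sub>w\<close> with \<open>w \<in> I\<^sub>1\<close> form a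
  basis because they are unitriangular in the images of the \<open>c\<^sub>w\<close>, which keep their coefficients
  \<open>q\<^bsub>y,w\<^esub>\<close>. Uniqueness holds because \<open>b\<^sub>s\<^sub>w = T\<^sub>s b\<^sub>w\<close> and the W-graph formula
  determine the \<open>q\<^bsub>y,w\<^esub>\<close> recursively. All sums over lower Bruhat intervals are finite by the strong exchange
  condition.\<close>

section \<open>Coxeter groups and the strong exchange condition\<close>

text \<open>The obstacle is the rule for weak ascents of I_1. An s with sw outside I_1 may have been
  a strong ascent of w in I, with sw in I - I_1, or a weak ascent from the start. In the first case
  T_s b_w = b_sw, whose image loses its leading term c_sw and keeps only multiples of q. In the
  second case the given sum also runs over y in I - I_1, whose images are not among the new basis
  vectors and must be rewritten. Both lead to coefficients in q A^+ because the change of basis on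
  I_1 is invertible over A^+, so this positivity is tracked together with triangularity. All work is
  done on finitely supported coordinate vectors, since the given module and the quotient have
  different element types. Two facts are hidden in definitions: \<open>hecke_bar\<close> is a
  definite description, so its value at T_s requires constructing the involution; and
  \<open>finsum\<close> is zero over an infinite set, so lower Bruhat intervals must be shown finite
  before any sum can be evaluated.\<close>

lemma alt_word_in_lists [simp]: "s \<in> S \<Longrightarrow> t \<in> S \<Longrightarrow> alt_word n s t \<in> lists S"
  by (induction n arbitrary: s t) auto

lemma length_alt_word [simp]: "length (alt_word n s t) = n"
  by (induction n arbitrary: s t) auto

context coxeter_system
begin

section \<open>Words, length and its parity\<close>

lemma gen_carrier [simp]: "s \<in> S \<Longrightarrow> s \<in> carrier W"
  using gens_closed by auto

lemma gen_sq [simp]: "s \<in> S \<Longrightarrow> s \<otimes> s = \<one>"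
  using gens_involution by auto

lemma gen_inv [simp]: "s \<in> S \<Longrightarrow> inv s = s"
  by (rule inv_equality) auto

lemma gen_cancel [simp]: "s \<in> S \<Longrightarrow> w \<in> carrier W \<Longrightarrow> s \<otimes> (s \<otimes> w) = w"
  by (simp add: m_assoc[symmetric])

lemma inv_cancel_left [simp]:
  "x \<in> carrier W \<Longrightarrow> y \<in> carrier W \<Longrightarrow> inv x \<otimes> (x \<otimes> y) = y"
  "x \<in> carrier W \<Longrightarrow> y \<in> carrier W \<Longrightarrow> x \<otimes> (inv x \<otimes> y) = y"
  by (simp_all add: m_assoc[symmetric])

lemma word_prod_Nil [simp]: "word_prod W [] = \<one>"
  and word_prod_Cons [simp]: "word_prod W (s # ws) = s \<otimes> word_prod W ws"
  by (simp_all add: word_prod_def)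

lemma word_prod_closed [simp]: "ws \<in> lists S \<Longrightarrow> word_prod W ws \<in> carrier W"
  by (induction ws) auto

lemma word_prod_append [simp]:
  "us \<in> lists S \<Longrightarrow> vs \<in> lists S \<Longrightarrow> word_prod W (us @ vs) = word_prod W us \<otimes> word_prod W vs"
  by (induction us) (auto simp: m_assoc)

lemma rev_in_lists [simp]: "rev ws \<in> lists S \<longleftrightarrow> ws \<in> lists S"
  by (auto simp: in_lists_conv_set)

lemma word_prod_rev: "ws \<in> lists S \<Longrightarrow> word_prod W (rev ws) = inv (word_prod W ws)"
  by (induction ws) (auto simp: inv_mult_group)

lemma word_exists:
  assumes "w \<in> carrier W"
  shows "\<exists>ws \<in> lists S. word_prod W ws = w"
proof -
  have "w \<in> generate W S" using assms gens_generate by simp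
  then show ?thesis
  proof induction
    case one show ?case by (intro bexI[of _ "[]"]) auto
  next
    case (incl h) then show ?case by (intro bexI[of _ "[h]"]) auto
  next
    case (inv h) then show ?case by (intro bexI[of _ "[h]"]) auto
  next
    case (eng h1 h2)
    then obtain us vs where "us \<in> lists S" "word_prod W us = h1" "vs \<in> lists S" "word_prod W vs = h2"
      by blast
    then show ?case by (intro bexI[of _ "us @ vs"]) auto
  qed
qed

abbreviation ll where "ll w \<equiv> len W S w"

lemma len_le: "ws \<in> lists S \<Longrightarrow> word_prod W ws = w \<Longrightarrow> ll w \<le> length ws"
  unfolding len_def by (rule Least_le) blast

lemma reduced_word:
  assumes "w \<in> carrier W"
  obtains ws where "ws \<in> lists S" "word_prod W ws = w" "length ws = ll w"
proof -
  have "\<exists>n. \<exists>ws \<in> lists S. length ws = n \<and> word_prod W ws = w"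
    using word_exists[OF assms] by blast
  from LeastI_ex[OF this] show thesis using that unfolding len_def by blast
qed

lemma len_one [simp]: "ll \<one> = 0"
  using len_le[of "[]" \<one>] by simp

lemma len_mult_le:
  assumes "u \<in> carrier W" "v \<in> carrier W" shows "ll (u \<otimes> v) \<le> ll u + ll v"
proof -
  obtain us where us: "us \<in> lists S" "word_prod W us = u" "length us = ll u" by (rule reduced_word[OF assms(1)])
  obtain vs where vs: "vs \<in> lists S" "word_prod W vs = v" "length vs = ll v" by (rule reduced_word[OF assms(2)])
  show ?thesis using len_le[of "us @ vs" "u \<otimes> v"] us vs by auto
qed

lemma alt_word_double_Suc: "alt_word (2 * Suc k) s t = s # t # alt_word (2 * k) s t"
  by simp

lemma word_prod_alt:
  assumes "s \<in> S" "t \<in> S" shows "word_prod W (alt_word (2 * k) s t) = (s \<otimes> t) [^] k"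
proof (induction k)
  case (Suc k)
  then show ?case using assms
    unfolding alt_word_double_Suc word_prod_Cons
    by (subst nat_pow_Suc2) (auto simp: m_assoc)
qed simp

lemma word_prod_relator:
  assumes "s \<in> S" "t \<in> S"
  shows "word_prod W (alt_word (2 * coxeter_order W s t) s t) = \<one>"
  using assms by (simp only: word_prod_alt coxeter_order_def) (simp add: pow_ord_eq_1)

text \<open>Every relator has even length, so each step of the congruence preserves parity: this is
  the sign character.\<close>

lemma coxeter_equiv_even: "coxeter_equiv W S us vs \<Longrightarrow> even (length us) = even (length vs)"
  by (induction rule: coxeter_equiv.induct) auto

text \<open>Both words represent the same element, so one followed by the reverse of the other
  represents the identity.\<close>

lemma word_parity:
  assumes "us \<in> lists S" "vs \<in> lists S" "word_prod W us = word_prod W vs"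
  shows "even (length us) = even (length vs)"
proof -
  have "word_prod W (us @ rev vs) = \<one>"
    using assms by (simp add: word_prod_rev)
  then have "coxeter_equiv W S (us @ rev vs) []"
    using presentation assms by auto
  from coxeter_equiv_even[OF this] show ?thesis by auto
qed

lemma len_gen_mult_parity:
  assumes "s \<in> S" "w \<in> carrier W" shows "even (ll (s \<otimes> w)) \<longleftrightarrow> odd (ll w)"
proof -
  obtain us where us: "us \<in> lists S" "word_prod W us = w" "length us = ll w" by (rule reduced_word[OF assms(2)])
  obtain vs where vs: "vs \<in> lists S" "word_prod W vs = s \<otimes> w" "length vs = ll (s \<otimes> w)"
    using reduced_word assms by (metis gen_carrier m_closed)
  have "even (length (s # us)) = even (length vs)"
    by (rule word_parity) (use us vs assms in auto)
  then show ?thesis using us vs by auto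
qed

lemma len_gen_le: "s \<in> S \<Longrightarrow> ll s \<le> 1"
  using len_le[of "[s]" s] by simp

text \<open>The triangle inequality leaves a change of at most one, and parity excludes no change at
  all.\<close>

lemma len_gen_mult:
  assumes "s \<in> S" "w \<in> carrier W" shows "ll (s \<otimes> w) = Suc (ll w) \<or> ll w = Suc (ll (s \<otimes> w))"
proof -
  have "ll (s \<otimes> w) \<le> ll w + 1" 
    using len_mult_le[of s w] len_gen_le[of s] assms by auto
  moreover have "ll w \<le> ll (s \<otimes> w) + 1"
    using len_mult_le[of s "s \<otimes> w"] len_gen_le[of s] assms by auto
  moreover have "even (ll (s \<otimes> w)) \<longleftrightarrow> odd (ll w)" using len_gen_mult_parity assms by blast
  ultimately show ?thesis by presburger
qed

lemma len_gen: "s \<in> S \<Longrightarrow> ll s = 1"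
  using len_gen_mult[of s \<one>] by auto

section \<open>Inversion counts and the exchange condition\<close>

text \<open>The elements \<open>t\<close> for which deleting one letter of the word multiplies its product on the
  right by \<open>t\<close>.\<close>

fun right_inversions :: "'w list \<Rightarrow> 'w list" where
  "right_inversions [] = []"
| "right_inversions (s # ws) = (inv (word_prod W ws) \<otimes> s \<otimes> word_prod W ws) # right_inversions ws"

text \<open>Occurrences are counted with multiplicity: the count depends on the word, only its
  parity on the element. That parity is the sign occurring in the action of W on reflections times
  {1,-1}.\<close>

definition inversion_count :: "'w list \<Rightarrow> 'w \<Rightarrow> nat" where
  "inversion_count ws t = count_list (right_inversions ws) t"

lemma inversion_count_Nil [simp]: "inversion_count [] t = 0"
  by (simp add: inversion_count_def)

lemma inversion_count_Cons:
  "inversion_count (s # ws) t =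
    (if t = inv (word_prod W ws) \<otimes> s \<otimes> word_prod W ws then 1 else 0) + inversion_count ws t"
  by (simp add: inversion_count_def)

lemma conj_eq_iff:
  assumes "x \<in> carrier W" "v \<in> carrier W" "t \<in> carrier W"
  shows "t = inv v \<otimes> x \<otimes> v \<longleftrightarrow> v \<otimes> t \<otimes> inv v = x"
  using assms by (metis (no_types, lifting) inv_closed inv_solve_left inv_solve_right m_assoc m_closed)

text \<open>The product of \<open>vs\<close> stands to the right of every letter of
  \<open>us\<close> and conjugates the deletion elements of \<open>us\<close>; shifting the
  conjugation to \<open>t\<close> gives this cocycle rule.\<close>

lemma inversion_count_append:
  assumes "us \<in> lists S" "vs \<in> lists S" "t \<in> carrier W"
  shows "inversion_count (us @ vs) t =
    inversion_count us (word_prod W vs \<otimes> t \<otimes> inv (word_prod W vs)) + inversion_count vs t"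
  using assms(1)
proof (induction us)
  case Nil
  then show ?case by simp
next
  case (Cons s us)
  let ?u = "word_prod W us" and ?v = "word_prod W vs"
  have c: "s \<in> carrier W" "?u \<in> carrier W" "?v \<in> carrier W" "t \<in> carrier W" "us \<in> lists S"
    using Cons assms by auto
  have "inv (?u \<otimes> ?v) \<otimes> s \<otimes> (?u \<otimes> ?v) = inv ?v \<otimes> (inv ?u \<otimes> s \<otimes> ?u) \<otimes> ?v"
    using c by (simp add: inv_mult_group m_assoc)
  then have "t = inv (?u \<otimes> ?v) \<otimes> s \<otimes> (?u \<otimes> ?v) \<longleftrightarrow> ?v \<otimes> t \<otimes> inv ?v = inv ?u \<otimes> s \<otimes> ?u"
    using c by (simp only:) (rule conj_eq_iff; simp)
  then show ?case using Cons c assms(2) by (simp add: inversion_count_Cons)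
qed

text \<open>The deletion elements of an alternating word are the reflections t(st)^j of the dihedral
  group generated by s and t. The recursion produces them by decreasing j, an order that
  \<open>count_list\<close> does not see.\<close>

lemma inversion_count_alt:
  assumes "s \<in> S" "t \<in> S"
  shows "inversion_count (alt_word (2 * k) s t) r = count_list (map (\<lambda>j. t \<otimes> (s \<otimes> t) [^] j) [0..<2 * k]) r"
proof (induction k)
  case 0
  then show ?case by simp
next
  case (Suc k)
  let ?a = "s \<otimes> t"
  have st: "s \<in> carrier W" "t \<in> carrier W" using assms by auto
  \<comment> \<open>Dihedral relation: conjugation by \<open>t\<close> inverts
    \<open>st\<close>.\<close>
  have conj: "inv (?a [^] k) \<otimes> t = t \<otimes> ?a [^] k" for k :: nat
  proof (induction k)
    case (Suc k)
    have "inv (?a [^] Suc k) \<otimes> t = inv (?a [^] k \<otimes> ?a) \<otimes> t" by simp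
    also have "\<dots> = t \<otimes> s \<otimes> (inv (?a [^] k) \<otimes> t)"
      using st assms by (subst inv_mult_group) (auto simp: inv_mult_group m_assoc)
    also have "\<dots> = t \<otimes> (s \<otimes> t \<otimes> ?a [^] k)"
      using st by (simp add: Suc m_assoc)
    also have "\<dots> = t \<otimes> ?a [^] Suc k" using st by (subst nat_pow_Suc2) auto
    finally show ?case .
  qed (use st in simp)
  have 1: "inv (?a [^] k) \<otimes> t \<otimes> ?a [^] k = t \<otimes> ?a [^] (2 * k)"
    using st by (simp add: conj m_assoc nat_pow_mult mult_2)
  have "inv (t \<otimes> ?a [^] k) \<otimes> s \<otimes> (t \<otimes> ?a [^] k) = inv (?a [^] k) \<otimes> t \<otimes> (?a \<otimes> ?a [^] k)"
    using st assms by (simp add: inv_mult_group m_assoc)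
  also have "?a \<otimes> ?a [^] k = ?a [^] (Suc k)" using st by (subst nat_pow_Suc2) auto
  also have "inv (?a [^] k) \<otimes> t \<otimes> ?a [^] Suc k = t \<otimes> ?a [^] (k + Suc k)"
    using st by (simp only: conj) (simp add: m_assoc nat_pow_mult[symmetric])
  finally have 2: "inv (t \<otimes> ?a [^] k) \<otimes> s \<otimes> (t \<otimes> ?a [^] k) = t \<otimes> ?a [^] (2 * k + 1)"
    by (simp add: mult_2)
  show ?case
    using Suc assms unfolding alt_word_double_Suc
    by (auto simp: inversion_count_Cons word_prod_alt 1 2 simp del: nat_pow_Suc alt_word.simps)
qed

text \<open>The exponents run through exactly two periods of j -> t(st)^j, so each reflection is met
  an even number of times. For infinite order the relator is empty.\<close>

lemma inversion_count_relator:
  assumes "s \<in> S" "t \<in> S"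
  shows "even (inversion_count (alt_word (2 * coxeter_order W s t) s t) r)"
proof -
  let ?m = "coxeter_order W s t" and ?f = "\<lambda>j. t \<otimes> (s \<otimes> t) [^] (j::nat)"
  have a: "(s \<otimes> t) [^] ?m = \<one>" using assms by (simp add: coxeter_order_def pow_ord_eq_1)
  have period: "?f (j + ?m) = ?f j" for j
    using assms a by (simp add: nat_pow_mult[symmetric])
  have "inversion_count (alt_word (2 * ?m) s t) r = count_list (map ?f [0..<2 * ?m]) r"
    by (rule inversion_count_alt[OF assms])
  also have "[0..<2 * ?m] = [0..<?m] @ map (\<lambda>j. j + ?m) [0..<?m]"
    unfolding map_add_upt mult_2 by (rule upt_add_eq_append) simp
  also have "map ?f \<dots> = map ?f [0..<?m] @ map ?f [0..<?m]"
    by (simp add: comp_def period)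
  finally show ?thesis by simp
qed

text \<open>A relator has product one, so inserting it does not change the conjugation seen by the
  prefix, and its own contribution is even.\<close>

lemma coxeter_equiv_inversion_count:
  assumes "coxeter_equiv W S us vs"
  shows "us \<in> lists S \<and> vs \<in> lists S \<and> word_prod W us = word_prod W vs \<and>
    (\<forall>r \<in> carrier W. even (inversion_count us r) = even (inversion_count vs r))"
  using assms
proof (induction rule: coxeter_equiv.induct)
  case (relator us vs s t)
  let ?a = "alt_word (2 * coxeter_order W s t) s t"
  have a: "?a \<in> lists S" "word_prod W ?a = \<one>" using relator word_prod_relator by auto
  have av: "?a @ vs \<in> lists S" using a(1) relator(2) by (simp only: append_in_lists_conv)
  have uv: "us @ vs \<in> lists S" "us @ ?a @ vs \<in> lists S"
    using a(1) relator(1,2) by (simp_all only: append_in_lists_conv)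
  have p: "word_prod W (?a @ vs) = word_prod W vs"
    using word_prod_append[OF a(1) relator(2)] a(2) relator(2) by simp
  have "even (inversion_count (us @ ?a @ vs) r) = even (inversion_count (us @ vs) r)"
    if r: "r \<in> carrier W" for r
    using inversion_count_relator[OF relator(3,4)]
    unfolding inversion_count_append[OF relator(1) av r] inversion_count_append[OF a(1) relator(2) r]
      inversion_count_append[OF relator(1,2) r] p by simp
  moreover have "word_prod W (us @ ?a @ vs) = word_prod W (us @ vs)"
    unfolding word_prod_append[OF relator(1) av] word_prod_append[OF relator(1,2)] p ..
  ultimately show ?case using uv by blast
qed auto

text \<open>\<open>presentation\<close> speaks only of words for the identity. Appending
  \<open>rev vs\<close> to both words leads to that case, and the two counts then share the summand
  of \<open>rev vs\<close>.\<close>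

lemma inversion_count_parity:
  assumes "us \<in> lists S" "vs \<in> lists S" "word_prod W us = word_prod W vs" "r \<in> carrier W"
  shows "even (inversion_count us r) = even (inversion_count vs r)"
proof -
  have *: "even (inversion_count (us @ rev vs) r')" 
    if "us \<in> lists S" "vs \<in> lists S" "word_prod W us = word_prod W vs" "r' \<in> carrier W" for us vs r'
  proof -
    have "word_prod W (us @ rev vs) = \<one>" using that by (simp add: word_prod_rev)
    then have "coxeter_equiv W S (us @ rev vs) []" using presentation that by auto
    from coxeter_equiv_inversion_count[OF this] that(4) show ?thesis by simp
  qed
  define v where "v = word_prod W vs"
  \<comment> \<open>Chosen so that conjugation by the product \<open>inv v\<close> of
    \<open>rev vs\<close> gives back \<open>r\<close>.\<close>
  define r' where "r' = v \<otimes> r \<otimes> inv v"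
  have v: "v \<in> carrier W" using assms v_def by auto
  have r': "r' \<in> carrier W" using v assms r'_def by auto
  have cancel: "inv v \<otimes> r' \<otimes> v = r" unfolding r'_def using v assms by (simp add: m_assoc)
  have "inversion_count (us @ rev vs) r' = inversion_count us r + inversion_count (rev vs) r'"
    using assms r' v cancel v_def by (simp add: inversion_count_append word_prod_rev)
  moreover have "inversion_count (vs @ rev vs) r' = inversion_count vs r + inversion_count (rev vs) r'"
    using assms r' v cancel v_def by (simp add: inversion_count_append word_prod_rev)
  ultimately show ?thesis
    using *[OF assms(1-3) r'] *[OF assms(2,2) HOL.refl r'] by simp
qed

text \<open>The halves of the palindrome contribute equal parities because
  \<open>xs @ rev xs\<close> represents the identity; the middle letter adds one more
  occurrence.\<close>

lemma inversion_count_reflection: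
  assumes "xs \<in> lists S" "s \<in> S"
  defines "t \<equiv> word_prod W xs \<otimes> s \<otimes> inv (word_prod W xs)"
  shows "odd (inversion_count (xs @ s # rev xs) t)"
proof -
  let ?x = "word_prod W xs"
  have x: "?x \<in> carrier W" "s \<in> carrier W" using assms by auto
  have t: "t \<in> carrier W" using x t_def by auto
  have cancel: "inv ?x \<otimes> t \<otimes> ?x = s" unfolding t_def using x by (simp add: m_assoc)
  have "even (inversion_count (xs @ rev xs) t)"
    using inversion_count_parity[of "xs @ rev xs" "[]" t] t assms(1) by (simp add: word_prod_rev)
  moreover have "inversion_count (xs @ rev xs) t = inversion_count xs s + inversion_count (rev xs) t"
    using assms(1) t cancel x by (simp add: inversion_count_append word_prod_rev)
  moreover have "inversion_count (s # rev xs) t = Suc (inversion_count (rev xs) t)"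
    using assms(1) by (simp add: inversion_count_Cons word_prod_rev t_def)
  moreover have "(s \<otimes> inv ?x) \<otimes> t \<otimes> inv (s \<otimes> inv ?x) = s \<otimes> (inv ?x \<otimes> t \<otimes> ?x) \<otimes> s"
    using x t assms by (simp add: inv_mult_group m_assoc)
  then have "(s \<otimes> inv ?x) \<otimes> t \<otimes> inv (s \<otimes> inv ?x) = s"
    using assms(2) x by (simp only: cancel gen_sq l_one)
  then have "inversion_count (xs @ s # rev xs) t = inversion_count xs s + inversion_count (s # rev xs) t"
    using assms(1,2) t by (simp add: inversion_count_append word_prod_rev)
  ultimately show ?thesis by simp
qed

lemma reflection_word:
  assumes "t \<in> reflections W S"
  obtains ts where "ts \<in> lists S" "word_prod W ts = t" "odd (inversion_count ts t)"
proof -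
  obtain x s where x: "t = x \<otimes> s \<otimes> inv x" "x \<in> carrier W" "s \<in> S"
    using assms unfolding reflections_def by blast
  obtain xs where xs: "xs \<in> lists S" "word_prod W xs = x" using word_exists[OF x(2)] by blast
  show thesis
  proof (rule that[of "xs @ s # rev xs"])
    show "odd (inversion_count (xs @ s # rev xs) t)"
      using inversion_count_reflection[of xs s] x xs by simp
    show "word_prod W (xs @ s # rev xs) = t" using x xs by (simp add: word_prod_rev m_assoc)
  qed (use x xs in auto)
qed

lemma reflection_closed: "t \<in> reflections W S \<Longrightarrow> t \<in> carrier W"
  unfolding reflections_def by auto

lemma reflection_square:
  assumes "t \<in> reflections W S" shows "t \<otimes> t = \<one>"
proof -
  obtain x s where x: "t = x \<otimes> s \<otimes> inv x" "x \<in> carrier W" "s \<in> S"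
    using assms unfolding reflections_def by blast
  then show ?thesis by (simp add: m_assoc)
qed

lemma reflection_inv: "t \<in> reflections W S \<Longrightarrow> inv t = t"
  using reflection_square reflection_closed by (simp add: inv_equality)

lemma right_inversions_closed:
  "ws \<in> lists S \<Longrightarrow> t \<in> set (right_inversions ws) \<Longrightarrow> t \<in> carrier W"
proof (induction ws)
  case (Cons s ws)
  then have c: "word_prod W ws \<in> carrier W" "s \<in> carrier W" "ws \<in> lists S" by simp_all
  from Cons.prems(2) have "t = inv (word_prod W ws) \<otimes> s \<otimes> word_prod W ws \<or> t \<in> set (right_inversions ws)"
    by simp
  then show ?case using c Cons.IH by (elim disjE) simp_all
qed simp

lemma subseq_in_lists: "subseq us ws \<Longrightarrow> ws \<in> lists S \<Longrightarrow> us \<in> lists S"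
  by (induction rule: list_emb.induct) auto

lemma right_inversion_deletion:
  assumes "ws \<in> lists S" "t \<in> set (right_inversions ws)"
  shows "\<exists>vs. subseq vs ws \<and> length vs < length ws \<and> word_prod W vs = word_prod W ws \<otimes> t"
  using assms
proof (induction ws)
  case (Cons s ws)
  let ?w = "word_prod W ws"
  have c: "?w \<in> carrier W" "s \<in> S" using Cons by auto
  consider "t = inv ?w \<otimes> s \<otimes> ?w" | "t \<in> set (right_inversions ws)" using Cons.prems by auto
  then show ?case
  proof cases
    case 1
    have "word_prod W (s # ws) \<otimes> t = ?w" unfolding 1 using c by (simp add: m_assoc)
    moreover have "subseq ws (s # ws)" by (rule list_emb_Cons) simp
    ultimately show ?thesis by (intro exI[of _ ws]) auto
  next
    case 2
    then obtain vs where vs: "subseq vs ws" "length vs < length ws" "word_prod W vs = ?w \<otimes> t"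
      using Cons by auto
    have "t \<in> carrier W" by (rule right_inversions_closed[OF _ 2]) (use Cons.hyps in simp)
    then have "word_prod W (s # vs) = word_prod W (s # ws) \<otimes> t" using vs c by (simp add: m_assoc)
    moreover have "subseq (s # vs) (s # ws)" using vs by simp
    ultimately show ?thesis using vs by (intro exI[of _ "s # vs"]) auto
  qed
qed simp

text \<open>Were \<open>t\<close> not an inversion of \<open>ws\<close>, it would occur an odd
  number of times in a reduced word of \<open>wt\<close>, and a deletion there would give a word for
  \<open>w\<close> shorter than the length of \<open>wt\<close>. Arbitrary words \<open>ws\<close>
  are allowed because the subwords met in \<open>bruhat_le_subword\<close> may fail to be
  reduced.\<close>

lemma strong_exchange:
  assumes "ws \<in> lists S" "t \<in> reflections W S" "ll (word_prod W ws \<otimes> t) < ll (word_prod W ws)"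
  shows "\<exists>vs. subseq vs ws \<and> word_prod W vs = word_prod W ws \<otimes> t"
proof -
  define w where "w = word_prod W ws"
  have w: "w \<in> carrier W" and t: "t \<in> carrier W" "t \<otimes> t = \<one>" "inv t = t"
    using assms reflection_closed reflection_square reflection_inv unfolding w_def by auto
  have "t \<in> set (right_inversions ws)"
  proof (rule ccontr)
    assume nt: "t \<notin> set (right_inversions ws)"
    obtain ts where ts: "ts \<in> lists S" "word_prod W ts = t" "odd (inversion_count ts t)"
      by (rule reflection_word[OF assms(2)])
    obtain us where us: "us \<in> lists S" "word_prod W us = w \<otimes> t" "length us = ll (w \<otimes> t)"
      using reduced_word w t by (metis m_closed)
    have "even (inversion_count us t) = even (inversion_count (ws @ ts) t)"
      by (rule inversion_count_parity) (use ts assms us w_def t in auto)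
    also have "inversion_count (ws @ ts) t = inversion_count ws t + inversion_count ts t"
      using assms ts t by (simp add: inversion_count_append)
    also have "inversion_count ws t = 0" using nt by (simp add: inversion_count_def count_list_0_iff)
    finally have "inversion_count us t \<noteq> 0" using ts(3) by (intro notI) simp
    then have "t \<in> set (right_inversions us)"
      by (simp add: inversion_count_def count_list_0_iff)
    from right_inversion_deletion[OF us(1) this]
    obtain vs where "subseq vs us" "length vs < ll (w \<otimes> t)" "word_prod W vs = w"
      using us w t by (auto simp: m_assoc)
    moreover have "vs \<in> lists S" by (rule subseq_in_lists[OF calculation(1) us(1)])
    ultimately show False using len_le[of vs w] assms(3) w_def by simp
  qed
  then show ?thesis using right_inversion_deletion[OF assms(1)] by blast
qed

section \<open>The Bruhat order\<close>

lemma bruhat_step_len: "bruhat_step W S u w \<Longrightarrow> ll u < ll w"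
  by (simp add: bruhat_step_def)

lemma bruhat_le_len: "bruhat_le W S u w \<Longrightarrow> u = w \<or> ll u < ll w"
  unfolding bruhat_le_def by (induction rule: rtranclp_induct) (auto dest: bruhat_step_len)

lemma bruhat_less_len: "bruhat_less W S u w \<Longrightarrow> ll u < ll w"
  using bruhat_le_len unfolding bruhat_less_def by blast

lemma bruhat_less_irrefl [simp]: "\<not> bruhat_less W S w w"
  by (simp add: bruhat_less_def)

lemma bruhat_less_asym: "bruhat_less W S u w \<Longrightarrow> \<not> bruhat_less W S w u"
  using bruhat_less_len[of u w] bruhat_less_len[of w u] by linarith

lemma bruhat_less_trans:
  assumes "bruhat_less W S u v" "bruhat_less W S v w" shows "bruhat_less W S u w"
proof -
  have "bruhat_le W S u w" using assms unfolding bruhat_less_def bruhat_le_def by auto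
  moreover have "u \<noteq> w" using bruhat_less_len[OF assms(1)] bruhat_less_len[OF assms(2)] by auto
  ultimately show ?thesis unfolding bruhat_less_def by simp
qed

lemma bruhat_step_subword:
  assumes "bruhat_step W S u w" "ws \<in> lists S" "word_prod W ws = w"
  shows "\<exists>us. subseq us ws \<and> word_prod W us = u"
proof -
  obtain t where t: "t \<in> reflections W S" "w = u \<otimes> t" "u \<in> carrier W" "ll u < ll w"
    using assms(1) unfolding bruhat_step_def by blast
  then have "u = w \<otimes> t" using reflection_square reflection_closed by (simp add: m_assoc)
  then show ?thesis using strong_exchange[of ws t] assms t by auto
qed

lemma bruhat_le_subword:
  assumes "bruhat_le W S u w" "ws \<in> lists S" "word_prod W ws = w"
  shows "\<exists>us. subseq us ws \<and> word_prod W us = u"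
  using assms(1) unfolding bruhat_le_def
proof (induction rule: converse_rtranclp_induct)
  case base
  then show ?case using assms by (metis subseq_order.refl)
next
  case (step y z)
  then obtain zs where zs: "subseq zs ws" "word_prod W zs = z" by blast
  then obtain ys where "subseq ys zs" "word_prod W ys = y"
    using bruhat_step_subword[OF step(1) subseq_in_lists[OF zs(1) assms(2)] zs(2)] by blast
  then show ?case using subseq_order.trans[OF _ zs(1)] by blast
qed

text \<open>A single word for \<open>w\<close> has finitely many subwords, and these represent
  everything below \<open>w\<close>, even when \<open>S\<close> is infinite.\<close>

lemma finite_bruhat_less:
  assumes "w \<in> carrier W" shows "finite {y. bruhat_less W S y w}"
proof -
  obtain ws where ws: "ws \<in> lists S" "word_prod W ws = w" using word_exists[OF assms] by blast
  have "{y. bruhat_less W S y w} \<subseteq> word_prod W ` {us. subseq us ws}"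
    using bruhat_le_subword[OF _ ws] unfolding bruhat_less_def by blast
  moreover have "finite {us. subseq us ws}" unfolding set_subseqs_eq[symmetric] by (rule finite_set)
  ultimately show ?thesis by (metis finite_surj)
qed

lemma bruhat_less_gen:
  assumes "s \<in> S" "w \<in> carrier W"
  shows "bruhat_less W S w (s \<otimes> w) \<longleftrightarrow> ll w < ll (s \<otimes> w)"
proof
  assume "ll w < ll (s \<otimes> w)"
  \<comment> \<open>\<open>bruhat_step\<close> multiplies by a reflection on the right, so left
    multiplication by \<open>s\<close> is rewritten with a conjugate of \<open>s\<close>; the double
    inverse matches the shape required in \<open>reflections\<close>.\<close>
  moreover have "s \<otimes> w = w \<otimes> (inv w \<otimes> s \<otimes> inv (inv w))"
    using assms by (simp add: m_assoc)
  moreover have "inv w \<otimes> s \<otimes> inv (inv w) \<in> reflections W S"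
    using assms unfolding reflections_def by blast
  ultimately have *: "bruhat_step W S w (s \<otimes> w)"
    unfolding bruhat_step_def using assms by blast
  have "w \<noteq> s \<otimes> w" using bruhat_step_len[OF *] by auto
  then show "bruhat_less W S w (s \<otimes> w)"
    using r_into_rtranclp[of "bruhat_step W S", OF *] unfolding bruhat_less_def bruhat_le_def by blast
qed (rule bruhat_less_len)

lemma bruhat_less_gen':
  assumes "s \<in> S" "w \<in> carrier W"
  shows "bruhat_less W S (s \<otimes> w) w \<longleftrightarrow> ll (s \<otimes> w) < ll w"
  using bruhat_less_gen[of s "s \<otimes> w"] assms by simp

end

section \<open>The bar involution of the Hecke algebra\<close>

lemma poly_mapping_split_single:
  assumes "k \<in> Poly_Mapping.keys (f :: 'a \<Rightarrow>\<^sub>0 'b :: cancel_comm_monoid_add)"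
  obtains g where "f = Poly_Mapping.single k (Poly_Mapping.lookup f k) + g"
    "Poly_Mapping.keys g = Poly_Mapping.keys f - {k}"
proof -
  let ?g = "Poly_Mapping.update k 0 f"
  show thesis
  proof (rule that[of ?g])
    show "f = Poly_Mapping.single k (Poly_Mapping.lookup f k) + ?g"
      by (rule poly_mapping_eqI) (auto simp: lookup_add lookup_single lookup_update when_def)
    show "Poly_Mapping.keys ?g = Poly_Mapping.keys f - {k}"
      by (auto simp: keys_update in_keys_iff)
  qed
qed

text \<open>One induction serves Laurent polynomials, elements of the free algebra and coordinate
  vectors, all of which are finitely supported functions; \<open>A\<close> carries a support
  restriction along.\<close>

lemma poly_mapping_single_induct [consumes 1, case_names zero single add]:
  fixes f :: "'a \<Rightarrow>\<^sub>0 'b :: cancel_comm_monoid_add"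
  assumes "Poly_Mapping.keys f \<subseteq> A" and "P 0"
    and single: "\<And>k v. k \<in> A \<Longrightarrow> P (Poly_Mapping.single k v)"
    and add: "\<And>f g. Poly_Mapping.keys f \<subseteq> A \<Longrightarrow> Poly_Mapping.keys g \<subseteq> A \<Longrightarrow> P f \<Longrightarrow> P g \<Longrightarrow> P (f + g)"
  shows "P f"
  using finite_keys[of f] assms(1)
proof (induction "Poly_Mapping.keys f" arbitrary: f rule: finite_psubset_induct)
  case psubset
  show ?case
  proof (cases "f = 0")
    case True
    with assms(2) show ?thesis by simp
  next
    case False
    then obtain k where k: "k \<in> Poly_Mapping.keys f"
      by (metis all_not_in_conv in_keys_iff lookup_zero poly_mapping_eqI)
    then obtain g where g: "f = Poly_Mapping.single k (Poly_Mapping.lookup f k) + g"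
        "Poly_Mapping.keys g = Poly_Mapping.keys f - {k}"
      by (rule poly_mapping_split_single)
    have "P g" using psubset g k by (intro psubset(2)) auto
    moreover have "P (Poly_Mapping.single k (Poly_Mapping.lookup f k))" using single k psubset by auto
    ultimately have "P (Poly_Mapping.single k (Poly_Mapping.lookup f k) + g)"
      using g k psubset by (intro add) auto
    then show ?thesis using g(1) by simp
  qed
qed

abbreviation hecke_zeta :: laurent where "hecke_zeta \<equiv> lq - lq_inv"

lemma laurent_bar_lookup [simp]: "Poly_Mapping.lookup (laurent_bar a) k = Poly_Mapping.lookup a (- k)"
  unfolding laurent_bar_def by (simp add: map_key.rep_eq)

lemma laurent_bar_add: "laurent_bar (a + b) = laurent_bar a + laurent_bar b"
  by (rule poly_mapping_eqI) (simp add: lookup_add)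

lemma laurent_bar_minus: "laurent_bar (a - b) = laurent_bar a - laurent_bar b"
  by (rule poly_mapping_eqI) (simp add: lookup_minus)

lemma laurent_bar_uminus: "laurent_bar (- a) = - laurent_bar a"
  by (rule poly_mapping_eqI) simp

lemma laurent_bar_zero [simp]: "laurent_bar 0 = 0"
  by (rule poly_mapping_eqI) simp

lemma laurent_bar_bar [simp]: "laurent_bar (laurent_bar a) = a"
  by (rule poly_mapping_eqI) simp

lemma laurent_bar_single [simp]: "laurent_bar (Poly_Mapping.single k v) = Poly_Mapping.single (- k) v"
  by (rule poly_mapping_eqI) (auto simp: lookup_single when_def)

lemma laurent_bar_one [simp]: "laurent_bar 1 = 1"
  by (metis laurent_bar_single minus_zero single_one)

lemma laurent_bar_mult: "laurent_bar (a * b) = laurent_bar a * laurent_bar b"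
proof -
  have "Poly_Mapping.keys a \<subseteq> UNIV" "Poly_Mapping.keys b \<subseteq> UNIV" by auto
  from this(1) show ?thesis
  proof (induction a rule: poly_mapping_single_induct)
    case (single k v)
    from \<open>Poly_Mapping.keys b \<subseteq> UNIV\<close> show ?case
      by (induction b rule: poly_mapping_single_induct)
        (auto simp: mult_single laurent_bar_add distrib_left)
  qed (auto simp: laurent_bar_add distrib_right)
qed

lemma laurent_bar_of_int [simp]: "laurent_bar (of_int n) = of_int n"
  unfolding single_of_int[symmetric] by simp

lemma laurent_bar_lq [simp]: "laurent_bar lq = lq_inv" "laurent_bar lq_inv = lq"
  by (simp_all add: lq_def lq_inv_def)

lemma lq_mult_inv [simp]: "lq * lq_inv = 1" "lq_inv * lq = 1"
  by (simp_all add: lq_def lq_inv_def mult_single)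

section \<open>The free algebra and the lift of bar\<close>

lemma free_monom_Nil [simp]: "free_monom [] = 1"
  by (simp add: free_monom_def zero_free_word_def[symmetric])

lemma Word_plus [simp]: "Word us + Word vs = Word (us @ vs)"
  by (simp add: plus_free_word_def)

lemma free_monom_mult: "free_monom us * free_monom vs = free_monom (us @ vs)"
  by (simp add: free_monom_def mult_single)

lemma free_monom_Cons: "free_monom (s # ws) = free_monom [s] * free_monom ws"
  by (simp add: free_monom_mult)

lemma single_free_word: "Poly_Mapping.single (Word ws) a = free_const a * free_monom ws"
  by (simp add: free_const_def free_monom_def mult_single)

lemma free_const_one [simp]: "free_const 1 = 1"
  by (simp add: free_const_def zero_free_word_def[symmetric])

lemma free_const_zero [simp]: "free_const 0 = 0"
  by (simp add: free_const_def)

lemma free_const_add: "free_const (a + b) = free_const a + free_const b"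
  by (simp add: free_const_def single_add)

lemma free_const_minus: "free_const (a - b) = free_const a - free_const b"
  by (simp add: free_const_def single_diff)

lemma free_const_mult: "free_const (a * b) = free_const a * free_const b"
  by (simp add: free_const_def mult_single)

lemma free_const_central: "free_const a * f = f * free_const a"
proof -
  have "Poly_Mapping.keys f \<subseteq> UNIV" by simp
  then show ?thesis
    by (induction f rule: poly_mapping_single_induct)
      (auto simp: free_const_def mult_single distrib_left distrib_right plus_free_word_def mult.commute)
qed

text \<open>The letters keep their order because bar is multiplicative; in the Hecke algebra the
  result is therefore the inverse of the reversed word.\<close>

definition free_bar_word :: "'w list \<Rightarrow> 'w free_elt" where
  "free_bar_word ws = foldr (\<lambda>s x. (free_monom [s] - free_const hecke_zeta) * x) ws 1"

text \<open>Lifts the bar involution to the free algebra, using that the inverse of a generator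
  \<open>T\<^sub>s\<close> of the Hecke algebra is \<open>T\<^sub>s - (q - q\<^sup>-\<^sup>1)\<close>.\<close>

definition free_bar :: "'w free_elt \<Rightarrow> 'w free_elt" where
  "free_bar f = (\<Sum>u \<in> Poly_Mapping.keys f.
     free_const (laurent_bar (Poly_Mapping.lookup f u)) * free_bar_word (letters u))"

lemma free_bar_superset:
  assumes "finite A" "Poly_Mapping.keys f \<subseteq> A"
  shows "free_bar f = (\<Sum>u \<in> A. free_const (laurent_bar (Poly_Mapping.lookup f u)) * free_bar_word (letters u))"
  unfolding free_bar_def using assms by (intro sum.mono_neutral_left) (auto simp: in_keys_iff)

lemma free_bar_add: "free_bar (f + g) = free_bar f + free_bar g"
proof -
  let ?A = "Poly_Mapping.keys f \<union> Poly_Mapping.keys g"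
  have "Poly_Mapping.keys (f + g) \<subseteq> ?A" by (rule keys_add)
  then show ?thesis
    by (simp add: free_bar_superset[of ?A] lookup_add laurent_bar_add free_const_add distrib_right sum.distrib)
qed

lemma free_bar_zero [simp]: "free_bar 0 = 0"
  by (simp add: free_bar_def)

lemma free_bar_uminus: "free_bar (- f) = - free_bar f"
  using free_bar_add[of f "- f"] by (simp add: minus_unique)

lemma free_bar_minus: "free_bar (f - g) = free_bar f - free_bar g"
  using free_bar_add[of f "- g"] by (simp add: free_bar_uminus)

lemma free_bar_single: "free_bar (Poly_Mapping.single u a) = free_const (laurent_bar a) * free_bar_word (letters u)"
  by (cases "a = 0") (auto simp: free_bar_def)

lemma free_bar_word_append: "free_bar_word (us @ vs) = free_bar_word us * free_bar_word vs"
  by (induction us) (auto simp: free_bar_word_def mult.assoc)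

lemma free_bar_mult: "free_bar (f * g) = free_bar f * free_bar g"
proof -
  have "Poly_Mapping.keys f \<subseteq> UNIV" "Poly_Mapping.keys g \<subseteq> UNIV" by auto
  from this(1) show ?thesis
  proof (induction f rule: poly_mapping_single_induct)
    case (single u a)
    from \<open>Poly_Mapping.keys g \<subseteq> UNIV\<close> show ?case
    proof (induction g rule: poly_mapping_single_induct)
      case (single v b)
      have "free_bar_word (letters u) * free_const (laurent_bar b) =
          free_const (laurent_bar b) * free_bar_word (letters u)"
        by (rule free_const_central[symmetric])
      then show ?case
        by (simp add: mult_single free_bar_single plus_free_word_def free_bar_word_append
            laurent_bar_mult free_const_mult mult.assoc) (metis mult.assoc)
    qed (auto simp: free_bar_add distrib_left)
  qed (auto simp: free_bar_add distrib_right)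
qed

lemma free_bar_const [simp]: "free_bar (free_const a) = free_const (laurent_bar a)"
  by (simp add: free_const_def free_bar_single free_bar_word_def)

lemma free_bar_one [simp]: "free_bar 1 = 1"
  using free_bar_const[of 1] by simp

lemma free_bar_monom: "free_bar (free_monom ws) = free_bar_word ws"
  by (simp add: free_monom_def free_bar_single)

lemma free_bar_gen: "free_bar (free_monom [s]) = free_monom [s] - free_const hecke_zeta"
  by (simp add: free_bar_monom free_bar_word_def)

text \<open>An involution already before relations are imposed: bar sends q - q^-1 to its negative,
  so the two corrections of a generator cancel.\<close>

lemma free_bar_bar: "free_bar (free_bar f) = f"
proof -
  have word: "free_bar (free_bar_word ws) = free_monom ws" for ws :: "'a list"
  proof (induction ws)
    case (Cons s ws)
    have "free_bar (free_monom [s] - free_const hecke_zeta) = free_monom [s]"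
      unfolding free_bar_minus free_bar_gen free_bar_const laurent_bar_minus
      by (simp add: free_const_minus)
    moreover have "free_bar_word (s # ws) = (free_monom [s] - free_const hecke_zeta) * free_bar_word ws"
      by (simp add: free_bar_word_def)
    ultimately have "free_bar (free_bar_word (s # ws)) = free_monom [s] * free_monom ws"
      by (simp only: free_bar_mult Cons)
    then show ?case by (simp add: free_monom_mult)
  qed (simp add: free_bar_word_def)
  have "Poly_Mapping.keys f \<subseteq> UNIV" by simp
  then show ?thesis
  proof (induction f rule: poly_mapping_single_induct)
    case (single u a)
    then show ?case
      using single_free_word[of "letters u" a]
      unfolding free_bar_single free_bar_mult word by simp
  qed (auto simp: free_bar_add)
qed

lemma keys_uminus: "Poly_Mapping.keys (- f :: 'a \<Rightarrow>\<^sub>0 'b :: ab_group_add) = Poly_Mapping.keys f"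
  by (auto simp: in_keys_iff)

lemma ring_free_algebra: "ring (free_algebra S)"
proof (rule ringI)
  show "abelian_group (free_algebra S)"
  proof (rule abelian_groupI)
    fix x assume x: "x \<in> carrier (free_algebra S)"
    then show "\<exists>y \<in> carrier (free_algebra S). y \<oplus>\<^bsub>free_algebra S\<^esub> x = \<zero>\<^bsub>free_algebra S\<^esub>"
      by (intro bexI[of _ "- x"]) (auto simp: free_algebra_def keys_uminus)
  qed (use keys_add in \<open>fastforce simp: free_algebra_def add_ac\<close>)+
  show "monoid (free_algebra S)"
  proof
    fix x y assume "x \<in> carrier (free_algebra S)" "y \<in> carrier (free_algebra S)"
    then show "x \<otimes>\<^bsub>free_algebra S\<^esub> y \<in> carrier (free_algebra S)"
      using keys_mult[of x y] by (fastforce simp: free_algebra_def plus_free_word_def)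
  qed (auto simp: free_algebra_def mult.assoc zero_free_word_def)
qed (auto simp: free_algebra_def distrib_left distrib_right)

lemma free_algebra_simps [simp]:
  "x \<oplus>\<^bsub>free_algebra S\<^esub> y = x + y" "x \<otimes>\<^bsub>free_algebra S\<^esub> y = x * y"
  "\<one>\<^bsub>free_algebra S\<^esub> = 1" "\<zero>\<^bsub>free_algebra S\<^esub> = 0"
  by (simp_all add: free_algebra_def)

lemma free_algebra_const [simp]: "free_const a \<in> carrier (free_algebra S)"
  by (auto simp: free_algebra_def free_const_def split: if_splits)

lemma free_algebra_monom [simp]: "ws \<in> lists S \<Longrightarrow> free_monom ws \<in> carrier (free_algebra S)"
  by (auto simp: free_algebra_def free_monom_def)

lemma free_algebra_closed [simp]:
  assumes "x \<in> carrier (free_algebra S)" "y \<in> carrier (free_algebra S)"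
  shows "x + y \<in> carrier (free_algebra S)" "x * y \<in> carrier (free_algebra S)"
    "x - y \<in> carrier (free_algebra S)"
proof -
  interpret ring "free_algebra S" by (rule ring_free_algebra)
  show "x + y \<in> carrier (free_algebra S)" "x * y \<in> carrier (free_algebra S)"
    using a_closed[OF assms] m_closed[OF assms] by simp_all
  have "- y \<in> carrier (free_algebra S)" using assms(2) by (simp add: free_algebra_def keys_uminus)
  from a_closed[OF assms(1) this] show "x - y \<in> carrier (free_algebra S)" by simp
qed

lemma free_algebra_induct [consumes 1, case_names const gen add mult]:
  assumes "f \<in> carrier (free_algebra S)"
    and const: "\<And>a. P (free_const a)" and gen: "\<And>s. s \<in> S \<Longrightarrow> P (free_monom [s])"
    and add: "\<And>x y. x \<in> carrier (free_algebra S) \<Longrightarrow> y \<in> carrier (free_algebra S) \<Longrightarrow> P x \<Longrightarrow> P y \<Longrightarrow> P (x + y)"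
    and mult: "\<And>x y. x \<in> carrier (free_algebra S) \<Longrightarrow> y \<in> carrier (free_algebra S) \<Longrightarrow> P x \<Longrightarrow> P y \<Longrightarrow> P (x * y)"
  shows "P f"
proof -
  have monom: "P (free_monom ws)" if "ws \<in> lists S" for ws
    using that
  proof (induction ws)
    case Nil
    show ?case using const[of 1] by simp
  next
    case (Cons s ws)
    then show ?case unfolding free_monom_Cons[of s ws] by (intro mult gen) auto
  qed
  have sub: "{f. Poly_Mapping.keys f \<subseteq> {u. letters u \<in> lists S}} = carrier (free_algebra S)"
    by (auto simp: free_algebra_def)
  have "Poly_Mapping.keys f \<subseteq> {u. letters u \<in> lists S}" using assms(1) sub by auto
  then show ?thesis
  proof (induction f rule: poly_mapping_single_induct)
    case zero
    show ?case using const[of 0] by simp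
  next
    case (single u a)
    then show ?case
      using single_free_word[of "letters u" a] mult[OF _ _ const monom] by simp
  next
    case (add f g)
    then show ?case using sub by (intro assms(4)) auto
  qed
qed

section \<open>The Hecke algebra as a quotient\<close>

lemma hecke_relators_closed: "hecke_relators W S \<subseteq> carrier (free_algebra S)"
proof -
  have "1 \<in> carrier (free_algebra S)" using free_algebra_const[of 1 S] by simp
  moreover have "free_monom (alt_word n s t) \<in> carrier (free_algebra S)" if "s \<in> S" "t \<in> S" for n s t
    by (rule free_algebra_monom[OF alt_word_in_lists[OF that]])
  ultimately show ?thesis unfolding hecke_relators_def
    by (auto intro!: free_algebra_closed)
qed

lemma ideal_hecke: "ideal (hecke_ideal W S) (free_algebra S)"
  unfolding hecke_ideal_def
  by (rule ring.genideal_ideal[OF ring_free_algebra hecke_relators_closed])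

lemma ring_hecke: "ring (hecke W S)"
  unfolding hecke_def by (rule ideal.quotient_is_ring[OF ideal_hecke])

text \<open>A common name for cosets, so that the homomorphism laws cover both
  \<open>hecke_T\<close> and \<open>hecke_const\<close>.\<close>

definition hecke_class :: "'w monoid \<Rightarrow> 'w set \<Rightarrow> 'w free_elt \<Rightarrow> 'w hecke_elt" where
  "hecke_class W S f = hecke_ideal W S +>\<^bsub>free_algebra S\<^esub> f"

lemma hecke_T_class: "hecke_T W S s = hecke_class W S (free_monom [s])"
  and hecke_const_class: "hecke_const W S a = hecke_class W S (free_const a)"
  by (simp_all add: hecke_T_def hecke_const_def hecke_class_def)

lemma hecke_class_hom: "hecke_class W S \<in> ring_hom (free_algebra S) (hecke W S)"
  unfolding hecke_class_def hecke_def by (rule ideal.rcos_ring_hom[OF ideal_hecke])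

lemma hecke_carrier: "carrier (hecke W S) = hecke_class W S ` carrier (free_algebra S)"
  unfolding hecke_def FactRing_def hecke_class_def A_RCOSETS_def' by auto

lemma hecke_class_cases:
  assumes "h \<in> carrier (hecke W S)"
  obtains f where "f \<in> carrier (free_algebra S)" "h = hecke_class W S f"
  using assms unfolding hecke_carrier by blast

lemma hecke_class_eq_zero:
  assumes "f \<in> carrier (free_algebra S)"
  shows "hecke_class W S f = \<zero>\<^bsub>hecke W S\<^esub> \<longleftrightarrow> f \<in> hecke_ideal W S"
proof -
  have "\<zero>\<^bsub>hecke W S\<^esub> = hecke_ideal W S" by (simp add: hecke_def FactRing_def)
  moreover have "hecke_ideal W S +>\<^bsub>free_algebra S\<^esub> f = hecke_ideal W S" if "f \<in> hecke_ideal W S"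
    by (rule abelian_subgroup.a_rcos_const[OF _ that])
      (rule abelian_subgroupI3[OF ideal.axioms(1)[OF ideal_hecke] ring.is_abelian_group[OF ring_free_algebra]])
  ultimately show ?thesis unfolding hecke_class_def
    using ideal.rcos_const_imp_mem[OF ideal_hecke assms] by blast
qed

lemma hecke_class_simps:
  assumes "x \<in> carrier (free_algebra S)" "y \<in> carrier (free_algebra S)"
  shows "hecke_class W S (x + y) = hecke_class W S x \<oplus>\<^bsub>hecke W S\<^esub> hecke_class W S y"
    "hecke_class W S (x * y) = hecke_class W S x \<otimes>\<^bsub>hecke W S\<^esub> hecke_class W S y"
  using ring_hom_add[OF hecke_class_hom assms] ring_hom_mult[OF hecke_class_hom assms] by simp_all

lemma hecke_class_closed [simp]: "x \<in> carrier (free_algebra S) \<Longrightarrow> hecke_class W S x \<in> carrier (hecke W S)"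
  by (rule ring_hom_closed[OF hecke_class_hom])

lemma hecke_class_one: "hecke_class W S 1 = \<one>\<^bsub>hecke W S\<^esub>"
  using ring_hom_one[OF hecke_class_hom] by simp

lemma hecke_class_eq:
  assumes "x \<in> carrier (free_algebra S)" "y \<in> carrier (free_algebra S)"
  shows "hecke_class W S x = hecke_class W S y \<longleftrightarrow> x - y \<in> hecke_ideal W S"
proof -
  interpret ring "hecke W S" by (rule ring_hecke)
  have "hecke_class W S ((x - y) + y) = hecke_class W S (x - y) \<oplus>\<^bsub>hecke W S\<^esub> hecke_class W S y"
    using assms by (intro hecke_class_simps) auto
  then have "hecke_class W S x = hecke_class W S (x - y) \<oplus>\<^bsub>hecke W S\<^esub> hecke_class W S y" by simp
  moreover have "hecke_class W S (x - y) \<in> carrier (hecke W S)" "hecke_class W S y \<in> carrier (hecke W S)"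
    using assms hecke_class_closed free_algebra_closed(3) by blast+
  ultimately have "hecke_class W S x = hecke_class W S y \<longleftrightarrow> hecke_class W S (x - y) = \<zero>\<^bsub>hecke W S\<^esub>"
    by (metis add.r_cancel_one)
  then show ?thesis using hecke_class_eq_zero[of "x - y" S W] assms by auto
qed

lemma hecke_const_simps:
  "hecke_const W S (a + b) = hecke_const W S a \<oplus>\<^bsub>hecke W S\<^esub> hecke_const W S b"
  "hecke_const W S (a * b) = hecke_const W S a \<otimes>\<^bsub>hecke W S\<^esub> hecke_const W S b"
  "hecke_const W S 1 = \<one>\<^bsub>hecke W S\<^esub>"
  "hecke_const W S a \<in> carrier (hecke W S)"
  by (simp_all add: hecke_const_class free_const_add free_const_mult hecke_class_simps hecke_class_one)

lemma hecke_T_closed: "s \<in> S \<Longrightarrow> hecke_T W S s \<in> carrier (hecke W S)"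
  unfolding hecke_T_class by (rule hecke_class_closed) auto

lemma hecke_const_central:
  assumes "h \<in> carrier (hecke W S)"
  shows "hecke_const W S a \<otimes>\<^bsub>hecke W S\<^esub> h = h \<otimes>\<^bsub>hecke W S\<^esub> hecke_const W S a"
proof -
  obtain f where "f \<in> carrier (free_algebra S)" "h = hecke_class W S f"
    by (rule hecke_class_cases[OF assms])
  then show ?thesis
    by (simp add: hecke_const_class hecke_class_simps(2)[symmetric] free_const_central)
qed

lemma hecke_induct [consumes 1, case_names const gen add mult]:
  assumes "h \<in> carrier (hecke W S)"
    and "\<And>a. P (hecke_const W S a)" and "\<And>s. s \<in> S \<Longrightarrow> P (hecke_T W S s)"
    and "\<And>x y. x \<in> carrier (hecke W S) \<Longrightarrow> y \<in> carrier (hecke W S) \<Longrightarrow> P x \<Longrightarrow> P y \<Longrightarrow> P (x \<oplus>\<^bsub>hecke W S\<^esub> y)"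
    and "\<And>x y. x \<in> carrier (hecke W S) \<Longrightarrow> y \<in> carrier (hecke W S) \<Longrightarrow> P x \<Longrightarrow> P y \<Longrightarrow> P (x \<otimes>\<^bsub>hecke W S\<^esub> y)"
  shows "P h"
proof -
  obtain f where f: "f \<in> carrier (free_algebra S)" "h = hecke_class W S f"
    by (rule hecke_class_cases[OF assms(1)])
  have "P (hecke_class W S f)"
    using f(1)
  proof (induction f rule: free_algebra_induct)
    case (const a)
    show ?case using assms(2) by (simp add: hecke_const_class)
  next
    case (gen s)
    then show ?case using assms(3) by (simp add: hecke_T_class)
  next
    case (add x y)
    then show ?case using assms(4) by (simp add: hecke_class_simps)
  next
    case (mult x y)
    then show ?case using assms(5) by (simp add: hecke_class_simps)
  qed
  then show ?thesis using f by simp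
qed

lemma hecke_relator_in_ideal: "f \<in> hecke_relators W S \<Longrightarrow> f \<in> hecke_ideal W S"
  unfolding hecke_ideal_def using ring.genideal_self[OF ring_free_algebra hecke_relators_closed] by blast

lemma hecke_T_square:
  assumes "s \<in> S"
  shows "hecke_T W S s \<otimes>\<^bsub>hecke W S\<^esub> hecke_T W S s =
    \<one>\<^bsub>hecke W S\<^esub> \<oplus>\<^bsub>hecke W S\<^esub> hecke_const W S hecke_zeta \<otimes>\<^bsub>hecke W S\<^esub> hecke_T W S s"
proof -
  have c: "free_monom [s] \<in> carrier (free_algebra S)" "(1 :: 'a free_elt) \<in> carrier (free_algebra S)"
    "free_const hecke_zeta * free_monom [s] \<in> carrier (free_algebra S)"
    using assms free_algebra_const[of 1 S] by auto
  have "free_monom [s] * free_monom [s] - (1 + free_const hecke_zeta * free_monom [s]) \<in> hecke_ideal W S"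
    by (rule hecke_relator_in_ideal) (use assms in \<open>auto simp: hecke_relators_def free_monom_mult\<close>)
  then have "hecke_class W S (free_monom [s] * free_monom [s]) =
      hecke_class W S (1 + free_const hecke_zeta * free_monom [s])"
    using c by (subst hecke_class_eq) auto
  then show ?thesis using c
    by (simp add: hecke_T_class hecke_const_class hecke_class_simps hecke_class_one)
qed

text \<open>Given by the representative \<open>free_bar (free_monom [s])\<close>, so that it can be
  compared with the lifted involution; \<open>hecke_inv_T\<close> identifies it with the inverse of
  \<open>hecke_T\<close>.\<close>

definition hecke_T' :: "'w monoid \<Rightarrow> 'w set \<Rightarrow> 'w \<Rightarrow> 'w hecke_elt" where
  "hecke_T' W S s = hecke_class W S (free_monom [s] - free_const hecke_zeta)"

lemma hecke_T'_closed: "s \<in> S \<Longrightarrow> hecke_T' W S s \<in> carrier (hecke W S)"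
  unfolding hecke_T'_def by (rule hecke_class_closed) auto

lemma hecke_T_T':
  assumes "s \<in> S"
  shows "hecke_T W S s \<otimes>\<^bsub>hecke W S\<^esub> hecke_T' W S s = \<one>\<^bsub>hecke W S\<^esub>"
    "hecke_T' W S s \<otimes>\<^bsub>hecke W S\<^esub> hecke_T W S s = \<one>\<^bsub>hecke W S\<^esub>"
proof -
  have c: "free_monom [s] \<in> carrier (free_algebra S)" "(1 :: 'a free_elt) \<in> carrier (free_algebra S)"
    using assms free_algebra_const[of 1 S] by auto
  have r: "free_monom [s] * free_monom [s] - (1 + free_const hecke_zeta * free_monom [s]) \<in> hecke_ideal W S"
    by (rule hecke_relator_in_ideal) (use assms in \<open>auto simp: hecke_relators_def free_monom_mult\<close>)
  have "hecke_class W S (free_monom [s] * (free_monom [s] - free_const hecke_zeta)) = hecke_class W S 1"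
    using c r by (subst hecke_class_eq) (auto simp: algebra_simps free_const_central[of _ "free_monom [s]", symmetric])
  then show "hecke_T W S s \<otimes>\<^bsub>hecke W S\<^esub> hecke_T' W S s = \<one>\<^bsub>hecke W S\<^esub>"
    using c by (simp add: hecke_T_class hecke_T'_def hecke_class_simps hecke_class_one)
  have "hecke_class W S ((free_monom [s] - free_const hecke_zeta) * free_monom [s]) = hecke_class W S 1"
    using c r by (subst hecke_class_eq) (auto simp: algebra_simps)
  then show "hecke_T' W S s \<otimes>\<^bsub>hecke W S\<^esub> hecke_T W S s = \<one>\<^bsub>hecke W S\<^esub>"
    using c by (simp add: hecke_T_class hecke_T'_def hecke_class_simps hecke_class_one)
qed

lemma hecke_inv_T:
  assumes "s \<in> S" shows "inv\<^bsub>hecke W S\<^esub> (hecke_T W S s) = hecke_T' W S s"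
  using monoid.inv_unique'[OF ring.is_monoid[OF ring_hecke] hecke_T_closed[OF assms]
      hecke_T'_closed[OF assms] hecke_T_T'[OF assms]] by simp

section \<open>Descent of bar to the Hecke algebra\<close>

lemma free_bar_word_closed: "ws \<in> lists S \<Longrightarrow> free_bar_word ws \<in> carrier (free_algebra S)"
proof (induction ws)
  case Nil
  show ?case using free_algebra_const[of 1 S] by (simp add: free_bar_word_def)
next
  case (Cons s ws)
  then show ?case by (simp add: free_bar_word_def)
qed

text \<open>Letters cancel in pairs from the middle. Questions about \<open>free_bar_word\<close>
  become questions about inverses of reversed words, where uniqueness of inverses applies.\<close>

lemma hecke_class_word_inverse:
  assumes "ws \<in> lists S"
  shows "hecke_class W S (free_monom (rev ws)) \<otimes>\<^bsub>hecke W S\<^esub> hecke_class W S (free_bar_word ws) = \<one>\<^bsub>hecke W S\<^esub>"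
    "hecke_class W S (free_bar_word ws) \<otimes>\<^bsub>hecke W S\<^esub> hecke_class W S (free_monom (rev ws)) = \<one>\<^bsub>hecke W S\<^esub>"
  using assms
proof (induction ws)
  interpret ring "hecke W S" by (rule ring_hecke)
  case Nil
  show "hecke_class W S (free_monom (rev [])) \<otimes>\<^bsub>hecke W S\<^esub> hecke_class W S (free_bar_word []) = \<one>\<^bsub>hecke W S\<^esub>"
    "hecke_class W S (free_bar_word []) \<otimes>\<^bsub>hecke W S\<^esub> hecke_class W S (free_monom (rev [])) = \<one>\<^bsub>hecke W S\<^esub>"
    by (simp_all add: hecke_class_one free_bar_word_def)
next
  interpret ring "hecke W S" by (rule ring_hecke)
  case (Cons s ws)
  let ?A = "hecke_class W S (free_monom (rev ws))" and ?B = "hecke_class W S (free_bar_word ws)"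
  let ?T = "hecke_T W S s" and ?T' = "hecke_T' W S s"
  have s: "s \<in> S" and ws: "ws \<in> lists S" "rev ws \<in> lists S" using Cons by (auto simp: in_lists_conv_set)
  have c: "?A \<in> carrier (hecke W S)" "?B \<in> carrier (hecke W S)"
    by (rule hecke_class_closed free_algebra_monom free_bar_word_closed ws)+
  have T: "?T \<in> carrier (hecke W S)" "?T' \<in> carrier (hecke W S)"
    by (rule hecke_T_closed[OF s] hecke_T'_closed[OF s])+
  have A: "hecke_class W S (free_monom (rev (s # ws))) = ?A \<otimes>\<^bsub>hecke W S\<^esub> ?T"
    using ws s by (simp add: hecke_T_class free_monom_mult[symmetric] hecke_class_simps del: in_lists_conv_set)
  have B: "hecke_class W S (free_bar_word (s # ws)) = ?T' \<otimes>\<^bsub>hecke W S\<^esub> ?B"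
    using ws s free_bar_word_closed[OF ws(1)] unfolding hecke_T'_def
    by (subst hecke_class_simps(2)[symmetric]) (auto simp: free_bar_word_def)
  have "?A \<otimes>\<^bsub>hecke W S\<^esub> ?T \<otimes>\<^bsub>hecke W S\<^esub> (?T' \<otimes>\<^bsub>hecke W S\<^esub> ?B) =
      ?A \<otimes>\<^bsub>hecke W S\<^esub> (?T \<otimes>\<^bsub>hecke W S\<^esub> ?T') \<otimes>\<^bsub>hecke W S\<^esub> ?B"
    using c T by (simp add: m_assoc)
  then show "hecke_class W S (free_monom (rev (s # ws))) \<otimes>\<^bsub>hecke W S\<^esub> hecke_class W S (free_bar_word (s # ws)) = \<one>\<^bsub>hecke W S\<^esub>"
    unfolding A B using Cons.IH c by (simp add: hecke_T_T'[OF s])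
  have "?T' \<otimes>\<^bsub>hecke W S\<^esub> ?B \<otimes>\<^bsub>hecke W S\<^esub> (?A \<otimes>\<^bsub>hecke W S\<^esub> ?T) =
      ?T' \<otimes>\<^bsub>hecke W S\<^esub> (?B \<otimes>\<^bsub>hecke W S\<^esub> ?A) \<otimes>\<^bsub>hecke W S\<^esub> ?T"
    using c T by (simp add: m_assoc)
  then show "hecke_class W S (free_bar_word (s # ws)) \<otimes>\<^bsub>hecke W S\<^esub> hecke_class W S (free_monom (rev (s # ws))) = \<one>\<^bsub>hecke W S\<^esub>"
    unfolding A B using Cons.IH T by (simp add: hecke_T_T'[OF s])
qed

lemma alt_word_snoc: "alt_word (Suc n) s t = alt_word n s t @ [if even n then s else t]"
  by (induction n arbitrary: s t) auto

text \<open>Reversal fixes the two alternating words of a given length or exchanges them, so it maps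
  a braid relation to itself.\<close>

lemma rev_alt_word: "rev (alt_word n s t) = (if even n then alt_word n t s else alt_word n s t)"
proof (induction n)
  case (Suc n)
  have "rev (alt_word (Suc n) s t) = (if even n then s else t) # rev (alt_word n s t)"
    by (simp only: alt_word_snoc) simp
  then show ?case by (simp add: Suc)
qed simp

lemma free_bar_relator:
  assumes "f \<in> hecke_relators W S"
  shows "hecke_class W S (free_bar f) = \<zero>\<^bsub>hecke W S\<^esub>"
proof -
  interpret ring "hecke W S" by (rule ring_hecke)
  have one: "(1 :: 'a free_elt) \<in> carrier (free_algebra S)" using free_algebra_const[of 1 S] by simp
  from assms consider
      (square) s where "s \<in> S" "f = free_monom [s, s] - (1 + free_const (lq - lq_inv) * free_monom [s])"
    | (braid) s t where "s \<in> S" "t \<in> S" "coxeter_order W s t \<noteq> 0"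
        "f = free_monom (alt_word (coxeter_order W s t) s t) - free_monom (alt_word (coxeter_order W s t) t s)"
    unfolding hecke_relators_def by blast
  then show ?thesis
  proof cases
    case square
    \<comment> \<open>With z = q - q^-1, expanding (T - z)^2 - 1 + z(T - z) gives back T^2 - 1 -
      zT.\<close>
    have "free_bar f = f"
    proof -
      have z: "laurent_bar hecke_zeta = - hecke_zeta" by (simp add: laurent_bar_minus)
      have "free_const (- hecke_zeta) = - (free_const hecke_zeta :: 'a free_elt)"
        using free_const_minus[of 0 hecke_zeta] by simp
      then have "free_bar f = (free_monom [s] - free_const hecke_zeta) * (free_monom [s] - free_const hecke_zeta)
          - (1 - free_const hecke_zeta * (free_monom [s] - free_const hecke_zeta))"
        unfolding square(2) free_monom_Cons[of s "[s]"]
        by (simp only: free_bar_minus free_bar_add free_bar_mult free_bar_gen free_bar_const free_bar_one z) simp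
      also have "\<dots> = f"
        unfolding square(2) free_monom_Cons[of s "[s]"]
        by (simp add: algebra_simps free_const_central[of _ "free_monom [s]", symmetric])
      finally show ?thesis .
    qed
    then show ?thesis using hecke_relator_in_ideal[OF assms] hecke_class_eq_zero hecke_relators_closed assms
      by fastforce
  next
    case braid
    let ?m = "coxeter_order W s t"
    let ?u = "alt_word ?m s t" and ?v = "alt_word ?m t s"
    have uv: "?u \<in> lists S" "?v \<in> lists S" using alt_word_in_lists[OF braid(1,2)] alt_word_in_lists[OF braid(2,1)] by blast+
    have "hecke_class W S (free_monom ?u) = hecke_class W S (free_monom ?v)"
      using uv hecke_relator_in_ideal[OF assms] unfolding braid(4)
      by (subst hecke_class_eq) (auto simp del: in_lists_conv_set)
    then have eq: "hecke_class W S (free_monom (rev ?u)) = hecke_class W S (free_monom (rev ?v))"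
      by (simp add: rev_alt_word)
    have rv: "rev ?v \<in> lists S" using uv by (simp add: rev_alt_word del: in_lists_conv_set)
    have cl: "hecke_class W S (free_monom (rev ?v)) \<in> carrier (hecke W S)"
       "hecke_class W S (free_bar_word ?u) \<in> carrier (hecke W S)"
       "hecke_class W S (free_bar_word ?v) \<in> carrier (hecke W S)"
      by (rule hecke_class_closed free_bar_word_closed free_algebra_monom uv rv)+
    \<comment> \<open>Both sides are inverses of one element, the common class of the reversed braid
      words.\<close>
    have "hecke_class W S (free_bar_word ?u) = hecke_class W S (free_bar_word ?v)"
      using inv_unique[OF hecke_class_word_inverse(2)[OF uv(1), of W, unfolded eq]
          hecke_class_word_inverse(1)[OF uv(2), of W]] cl by blast
    then show ?thesis
      using hecke_class_eq[OF free_bar_word_closed[OF uv(1)] free_bar_word_closed[OF uv(2)]]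
        hecke_class_eq_zero[OF free_algebra_closed(3)[OF free_bar_word_closed[OF uv(1)] free_bar_word_closed[OF uv(2)]]]
      unfolding braid(4) free_bar_minus free_bar_monom by blast
  qed
qed

lemma free_bar_closed:
  assumes "f \<in> carrier (free_algebra S)" shows "free_bar f \<in> carrier (free_algebra S)"
  using assms
proof (induction f rule: free_algebra_induct)
  case (gen s)
  then show ?case unfolding free_bar_gen by (intro free_algebra_closed) auto
qed (auto simp: free_bar_add free_bar_mult)

lemma free_bar_hom: "free_bar \<in> ring_hom (free_algebra S) (free_algebra S)"
  by (rule ring_hom_memI) (auto simp: free_bar_closed free_bar_add free_bar_mult)

text \<open>The lift followed by the quotient map kills the relators, and its kernel is an ideal;
  minimality of the generated ideal does the rest.\<close>

lemma free_bar_ideal: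
  assumes "f \<in> hecke_ideal W S" shows "free_bar f \<in> hecke_ideal W S"
proof -
  let ?h = "hecke_class W S \<circ> free_bar"
  have "?h \<in> ring_hom (free_algebra S) (hecke W S)"
    by (rule ring_hom_trans[OF free_bar_hom hecke_class_hom])
  then interpret h: ring_hom_ring "free_algebra S" "hecke W S" ?h
    by (rule ring_hom_ringI2[OF ring_free_algebra ring_hecke])
  have "hecke_relators W S \<subseteq> a_kernel (free_algebra S) (hecke W S) ?h"
    using free_bar_relator hecke_relators_closed by (fastforce simp: a_kernel_def')
  then have "hecke_ideal W S \<subseteq> a_kernel (free_algebra S) (hecke W S) ?h"
    unfolding hecke_ideal_def
    by (rule ring.genideal_minimal[OF ring_free_algebra h.kernel_is_ideal])
  then have "f \<in> carrier (free_algebra S)" "hecke_class W S (free_bar f) = \<zero>\<^bsub>hecke W S\<^esub>"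
    using assms by (auto simp: a_kernel_def')
  then show ?thesis using hecke_class_eq_zero[OF free_bar_closed] by blast
qed

text \<open>Restricted to the carrier because \<open>hecke_bar\<close> asks for an extensional
  function; the chosen representative does not matter by \<open>free_bar_ideal\<close>.\<close>

definition hecke_bar_map :: "'w monoid \<Rightarrow> 'w set \<Rightarrow> 'w hecke_elt \<Rightarrow> 'w hecke_elt" where
  "hecke_bar_map W S = restrict (\<lambda>h. hecke_class W S
     (free_bar (SOME f. f \<in> carrier (free_algebra S) \<and> hecke_class W S f = h))) (carrier (hecke W S))"

lemma hecke_bar_map_class:
  assumes "f \<in> carrier (free_algebra S)"
  shows "hecke_bar_map W S (hecke_class W S f) = hecke_class W S (free_bar f)"
proof -
  let ?P = "\<lambda>g. g \<in> carrier (free_algebra S) \<and> hecke_class W S g = hecke_class W S f"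
  define g where "g = (SOME g. ?P g)"
  have g: "g \<in> carrier (free_algebra S)" "hecke_class W S g = hecke_class W S f"
    using someI[of ?P f] assms unfolding g_def by auto
  then have "g - f \<in> hecke_ideal W S" using hecke_class_eq[OF g(1) assms] by blast
  then have "free_bar g - free_bar f \<in> hecke_ideal W S"
    using free_bar_ideal[of "g - f"] by (simp add: free_bar_minus)
  then have "hecke_class W S (free_bar g) = hecke_class W S (free_bar f)"
    using hecke_class_eq[OF free_bar_closed[OF g(1)] free_bar_closed[OF assms]] by blast
  then show ?thesis unfolding hecke_bar_map_def g_def
    using hecke_class_closed[OF assms] by simp
qed

text \<open>Constants and the \<open>hecke_T\<close> generate the algebra, and extensionality
  settles the values off the carrier.\<close>

lemma hecke_bar_unique:
  assumes f: "f \<in> extensional (carrier (hecke W S))" "f \<in> ring_hom (hecke W S) (hecke W S)"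
      "\<forall>a. f (hecke_const W S a) = hecke_const W S (laurent_bar a)"
      "\<forall>s \<in> S. f (hecke_T W S s) = inv\<^bsub>hecke W S\<^esub> (hecke_T W S s)"
    and g: "g \<in> extensional (carrier (hecke W S))" "g \<in> ring_hom (hecke W S) (hecke W S)"
      "\<forall>a. g (hecke_const W S a) = hecke_const W S (laurent_bar a)"
      "\<forall>s \<in> S. g (hecke_T W S s) = inv\<^bsub>hecke W S\<^esub> (hecke_T W S s)"
  shows "f = g"
proof (rule extensionalityI[OF f(1) g(1)])
  fix h assume "h \<in> carrier (hecke W S)"
  then show "f h = g h"
  proof (induction h rule: hecke_induct)
    case (add x y)
    then show ?case using ring_hom_add[OF f(2)] ring_hom_add[OF g(2)] by simp
  next
    case (mult x y)
    then show ?case using ring_hom_mult[OF f(2)] ring_hom_mult[OF g(2)] by simp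
  qed (use f g in auto)
qed

text \<open>The \<open>THE\<close> in \<open>hecke_bar\<close> carries information only after
  existence and uniqueness. This value at the generators is what the coordinate form of bar extracts
  from it.\<close>

lemma hecke_bar_T: "s \<in> S \<Longrightarrow> hecke_bar W S (hecke_T W S s) = hecke_T' W S s"
proof -
  let ?b = "hecke_bar_map W S"
  have hom: "?b \<in> ring_hom (hecke W S) (hecke W S)"
  proof (rule ring_hom_memI)
    fix x assume "x \<in> carrier (hecke W S)"
    then obtain f where f: "f \<in> carrier (free_algebra S)" "x = hecke_class W S f" by (rule hecke_class_cases)
    then show "?b x \<in> carrier (hecke W S)"
      using hecke_class_closed[of "free_bar f"] free_bar_closed by (metis hecke_bar_map_class)
    fix y assume "y \<in> carrier (hecke W S)"
    then obtain g where g: "g \<in> carrier (free_algebra S)" "y = hecke_class W S g" by (rule hecke_class_cases)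
    show "?b (x \<otimes>\<^bsub>hecke W S\<^esub> y) = ?b x \<otimes>\<^bsub>hecke W S\<^esub> ?b y"
      using f g free_bar_closed[OF f(1)] free_bar_closed[OF g(1)]
      by (simp add: hecke_class_simps(2)[symmetric] hecke_bar_map_class free_bar_mult)
    show "?b (x \<oplus>\<^bsub>hecke W S\<^esub> y) = ?b x \<oplus>\<^bsub>hecke W S\<^esub> ?b y"
      using f g free_bar_closed[OF f(1)] free_bar_closed[OF g(1)]
      by (simp add: hecke_class_simps(1)[symmetric] hecke_bar_map_class free_bar_add)
  next
    have "(1 :: 'a free_elt) \<in> carrier (free_algebra S)" using free_algebra_const[of 1 S] by simp
    then show "?b \<one>\<^bsub>hecke W S\<^esub> = \<one>\<^bsub>hecke W S\<^esub>"
      by (simp add: hecke_class_one[symmetric] hecke_bar_map_class)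
  qed
  have T: "?b (hecke_T W S s) = hecke_T' W S s" if "s \<in> S" for s
    using that by (simp add: hecke_T_class hecke_T'_def hecke_bar_map_class free_bar_gen)
  have inv: "?b (?b h) = h" if h: "h \<in> carrier (hecke W S)" for h
  proof -
    obtain f where f: "f \<in> carrier (free_algebra S)" "h = hecke_class W S f" by (rule hecke_class_cases[OF h])
    show ?thesis unfolding f(2)
      using free_bar_closed[OF f(1)] by (simp add: hecke_bar_map_class f(1) free_bar_bar)
  qed
  have ext: "?b \<in> extensional (carrier (hecke W S))" by (simp add: hecke_bar_map_def)
  have const: "?b (hecke_const W S a) = hecke_const W S (laurent_bar a)" for a
    by (simp add: hecke_const_class hecke_bar_map_class)
  have Ti: "\<forall>s \<in> S. ?b (hecke_T W S s) = inv\<^bsub>hecke W S\<^esub> (hecke_T W S s)"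
    by (simp add: T hecke_inv_T)
  have eq: "hecke_bar W S = ?b" unfolding hecke_bar_def
  proof (rule the_equality)
    show "?b \<in> extensional (carrier (hecke W S)) \<and> ?b \<in> ring_hom (hecke W S) (hecke W S) \<and>
     (\<forall>h \<in> carrier (hecke W S). ?b (?b h) = h) \<and>
     (\<forall>a. ?b (hecke_const W S a) = hecke_const W S (laurent_bar a)) \<and>
     (\<forall>s \<in> S. ?b (hecke_T W S s) = inv\<^bsub>hecke W S\<^esub> (hecke_T W S s))"
      using ext hom inv const Ti by blast
  next
    fix f assume "f \<in> extensional (carrier (hecke W S)) \<and> f \<in> ring_hom (hecke W S) (hecke W S) \<and>
     (\<forall>h \<in> carrier (hecke W S). f (f h) = h) \<and>
     (\<forall>a. f (hecke_const W S a) = hecke_const W S (laurent_bar a)) \<and>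
     (\<forall>s \<in> S. f (hecke_T W S s) = inv\<^bsub>hecke W S\<^esub> (hecke_T W S s))"
    then show "f = ?b" using ext hom const Ti by (intro hecke_bar_unique) blast+
  qed
  show "hecke_bar W S (hecke_T W S s) = hecke_T' W S s" if "s \<in> S" unfolding eq by (rule T[OF that])
qed

section \<open>The W-graph formula in coordinates\<close>

lemma laurent_posI: "(\<And>k. k < 0 \<Longrightarrow> Poly_Mapping.lookup a k = 0) \<Longrightarrow> a \<in> laurent_pos"
  unfolding laurent_pos_def by (auto simp: in_keys_iff) (meson not_less)

lemma laurent_posD: "a \<in> laurent_pos \<Longrightarrow> k < 0 \<Longrightarrow> Poly_Mapping.lookup a k = 0"
  unfolding laurent_pos_def by (metis in_keys_iff mem_Collect_eq not_less)

lemma lookup_single_shift: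
  fixes a :: laurent
  shows "Poly_Mapping.lookup (Poly_Mapping.single i c * a) k = c * Poly_Mapping.lookup a (k - i)"
proof -
  have "Poly_Mapping.keys a \<subseteq> UNIV" by simp
  then show ?thesis
    by (induction a rule: poly_mapping_single_induct)
      (auto simp: mult_single lookup_add lookup_single when_def distrib_left)
qed

lemma lookup_lq_mult [simp]: "Poly_Mapping.lookup (lq * a) k = Poly_Mapping.lookup a (k - 1)"
  by (simp add: lq_def lookup_single_shift)

lemma lookup_lq_inv_mult [simp]: "Poly_Mapping.lookup (lq_inv * a) k = Poly_Mapping.lookup a (k + 1)"
  by (simp add: lq_inv_def lookup_single_shift)

lemma lq_mult_inv_right [simp]: "lq * a * lq_inv = a"
  by (metis lq_mult_inv(1) mult.assoc mult.commute mult_1)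

lemma lq_mult_pos: "a \<in> (*) lq ` laurent_pos \<longleftrightarrow> (\<forall>k \<le> 0. Poly_Mapping.lookup a k = 0)"
proof
  assume a: "\<forall>k \<le> 0. Poly_Mapping.lookup a k = 0"
  have "lq_inv * a \<in> laurent_pos" by (rule laurent_posI) (use a in simp)
  moreover have "a = lq * (lq_inv * a)" by (simp add: mult.assoc[symmetric])
  ultimately show "a \<in> (*) lq ` laurent_pos" by blast
next
  assume "a \<in> (*) lq ` laurent_pos"
  then obtain b where "b \<in> laurent_pos" "a = lq * b" by blast
  then show "\<forall>k \<le> 0. Poly_Mapping.lookup a k = 0" by (simp add: laurent_posD)
qed

lemma laurent_pos_add: "a \<in> laurent_pos \<Longrightarrow> b \<in> laurent_pos \<Longrightarrow> a + b \<in> laurent_pos"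
  by (rule laurent_posI) (simp add: lookup_add laurent_posD)

lemma laurent_pos_uminus: "a \<in> laurent_pos \<Longrightarrow> - a \<in> laurent_pos"
  by (rule laurent_posI) (simp add: laurent_posD)

lemma laurent_pos_zero: "0 \<in> laurent_pos"
  by (rule laurent_posI) simp

lemma laurent_pos_of_int: "of_int n \<in> laurent_pos"
  by (rule laurent_posI) (simp add: lookup_of_int)

lemma laurent_pos_one: "1 \<in> laurent_pos"
  using laurent_pos_of_int[of 1] by simp

lemma laurent_pos_lq: "lq \<in> laurent_pos"
  by (rule laurent_posI) (simp add: lq_def lookup_single)

lemma laurent_pos_mult:
  assumes "a \<in> laurent_pos" "b \<in> laurent_pos" shows "a * b \<in> laurent_pos"
  using keys_mult[of a b] assms unfolding laurent_pos_def by fastforce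

lemma lq_laurent_pos_mult: "a \<in> (*) lq ` laurent_pos \<Longrightarrow> b \<in> laurent_pos \<Longrightarrow> a * b \<in> (*) lq ` laurent_pos"
  by (auto simp: mult.assoc intro!: imageI laurent_pos_mult)

lemma lq_laurent_pos_add:
  "a \<in> (*) lq ` laurent_pos \<Longrightarrow> b \<in> (*) lq ` laurent_pos \<Longrightarrow> a + b \<in> (*) lq ` laurent_pos"
  unfolding lq_mult_pos by (simp add: lookup_add)

lemma lq_laurent_pos_uminus: "a \<in> (*) lq ` laurent_pos \<Longrightarrow> - a \<in> (*) lq ` laurent_pos"
  unfolding lq_mult_pos by simp

text \<open>The reason why constant terms are the right edge weights: this difference is what a
  descent term leaves behind in \<open>T_unit_ascent\<close>, and it has to vanish modulo q.\<close>

lemma lq_laurent_pos_const: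
  "a \<in> laurent_pos \<Longrightarrow> of_int (constant_term a) - a \<in> (*) lq ` laurent_pos"
  unfolding lq_mult_pos
  by (auto simp: lookup_minus lookup_of_int constant_term_def when_def laurent_posD)

text \<open>Bar exchanges the coefficients in degrees k and -k, so vanishing for k \<le> 0 spreads
  to all degrees.\<close>

lemma bar_invariant_lq_pos:
  assumes "a \<in> (*) lq ` laurent_pos" "laurent_bar a = a" shows "a = 0"
proof (rule poly_mapping_eqI)
  fix k
  have "Poly_Mapping.lookup a k = Poly_Mapping.lookup a (- k)"
    using assms(2) by (metis laurent_bar_lookup)
  then show "Poly_Mapping.lookup a k = Poly_Mapping.lookup 0 k"
    using assms(1) unfolding lq_mult_pos by (cases "k \<le> 0") auto
qed

text \<open>Compare the coefficients of \<open>q\<^sup>n\<^sup>+\<^sup>2\<close> and \<open>q\<^sup>-\<^sup>n\<^sup>-\<^sup>2\<close> where \<open>n\<close> is the degree of \<open>a\<close>.\<close>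

lemma bar_invariant_quadratic:
  assumes "a \<in> laurent_pos" "laurent_bar (lq * (lq * a) + a) = lq * (lq * a) + a" shows "a = 0"
proof (rule ccontr)
  assume "a \<noteq> 0"
  then have ne: "Poly_Mapping.keys a \<noteq> {}" by (metis all_not_in_conv in_keys_iff lookup_zero poly_mapping_eqI)
  define n where "n = Max (Poly_Mapping.keys a)"
  have n: "n \<in> Poly_Mapping.keys a" "\<And>k. k > n \<Longrightarrow> Poly_Mapping.lookup a k = 0"
    unfolding n_def using ne Max_in[of "Poly_Mapping.keys a"] Max_ge[of "Poly_Mapping.keys a"]
    by (simp, meson in_keys_iff not_less finite_keys)
  then have "n \<ge> 0" using assms(1) by (auto simp: laurent_pos_def)
  have "Poly_Mapping.lookup (lq * (lq * a) + a) (n + 2) = Poly_Mapping.lookup (lq * (lq * a) + a) (- (n + 2))"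
    using assms(2) by (metis laurent_bar_lookup)
  then have "Poly_Mapping.lookup a n = 0"
    using n(2)[of "n + 2"] \<open>n \<ge> 0\<close> assms(1) by (simp add: lookup_add laurent_posD)
  with n(1) show False by (simp add: in_keys_iff)
qed

text \<open>Coordinate vectors are a whole type, so ordinary additive arithmetic applies without
  carrier conditions; membership in a module becomes a condition on \<open>keys\<close>.\<close>

definition vscale :: "laurent \<Rightarrow> ('x \<Rightarrow>\<^sub>0 laurent) \<Rightarrow> ('x \<Rightarrow>\<^sub>0 laurent)" where
  "vscale a f = Poly_Mapping.map ((*) a) f"

definition vunit :: "'x \<Rightarrow> ('x \<Rightarrow>\<^sub>0 laurent)" where
  "vunit x = Poly_Mapping.single x 1"

text \<open>The module involution in coordinates: it acts on coefficients alone because the basis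
  vectors \<open>c w\<close> are fixed by it.\<close>

definition vbar :: "('x \<Rightarrow>\<^sub>0 laurent) \<Rightarrow> ('x \<Rightarrow>\<^sub>0 laurent)" where
  "vbar f = Poly_Mapping.map laurent_bar f"

lemma lookup_vscale [simp]: "Poly_Mapping.lookup (vscale a f) x = a * Poly_Mapping.lookup f x"
  unfolding vscale_def by (simp add: map.rep_eq when_def)

lemma lookup_vunit: "Poly_Mapping.lookup (vunit x) y = (if x = y then 1 else 0)"
  by (simp add: vunit_def lookup_single when_def)

lemma lookup_vbar [simp]: "Poly_Mapping.lookup (vbar f) x = laurent_bar (Poly_Mapping.lookup f x)"
  unfolding vbar_def by (simp add: map.rep_eq when_def)

lemma vscale_simps:
  "vscale a (f + g) = vscale a f + vscale a g" "vscale a (f - g) = vscale a f - vscale a g"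
  "vscale (a + b) f = vscale a f + vscale b f" "vscale (a - b) f = vscale a f - vscale b f"
  "vscale (- a) f = - vscale a f" "vscale a (- f) = - vscale a f"
  by (rule poly_mapping_eqI, simp add: lookup_add lookup_minus algebra_simps)+

lemma vscale_vscale [simp]: "vscale a (vscale b f) = vscale (a * b) f"
  by (rule poly_mapping_eqI) (simp add: mult.assoc)

lemma vscale_one [simp]: "vscale 1 f = f" and vscale_zero [simp]: "vscale 0 f = 0" "vscale a 0 = 0"
  by (rule poly_mapping_eqI, simp)+

lemma vscale_sum: "vscale a (\<Sum>i \<in> A. f i) = (\<Sum>i \<in> A. vscale a (f i))"
  by (rule poly_mapping_eqI) (simp add: lookup_sum sum_distrib_left)

lemma vbar_simps:
  "vbar (f + g) = vbar f + vbar g" "vbar (f - g) = vbar f - vbar g"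
  "vbar (vscale a f) = vscale (laurent_bar a) (vbar f)"
  "vbar (vunit x) = vunit x" "vbar 0 = 0" "vbar (vbar f) = f"
  by (rule poly_mapping_eqI, simp add: lookup_add lookup_minus laurent_bar_add laurent_bar_minus
      laurent_bar_mult lookup_vunit)+

lemma vbar_sum: "vbar (\<Sum>i \<in> A. f i) = (\<Sum>i \<in> A. vbar (f i))"
  by (induction A rule: infinite_finite_induct) (auto simp: vbar_simps)

lemma vunit_expansion:
  assumes "finite A" "Poly_Mapping.keys f \<subseteq> A"
  shows "f = (\<Sum>x \<in> A. vscale (Poly_Mapping.lookup f x) (vunit x))"
proof (rule poly_mapping_eqI)
  fix y
  have "Poly_Mapping.lookup (\<Sum>x \<in> A. vscale (Poly_Mapping.lookup f x) (vunit x)) y =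
      (\<Sum>x \<in> A. if x = y then Poly_Mapping.lookup f x else 0)"
    by (auto simp: lookup_sum lookup_vunit intro!: sum.cong)
  also have "\<dots> = Poly_Mapping.lookup f y"
    using assms by (auto simp: sum.delta in_keys_iff)
  finally show "Poly_Mapping.lookup f y = Poly_Mapping.lookup (\<Sum>x \<in> A. vscale (Poly_Mapping.lookup f x) (vunit x)) y"
    by simp
qed

text \<open>\<open>vpos\<close> is the A^+-lattice spanned by the unit vectors and
  \<open>vqpos\<close> is q times that lattice; comparing vectors modulo q means membership of the
  difference in \<open>vqpos\<close>.\<close>

definition vpos :: "('x \<Rightarrow>\<^sub>0 laurent) set" where
  "vpos = {f. \<forall>x. Poly_Mapping.lookup f x \<in> laurent_pos}"

definition vqpos :: "('x \<Rightarrow>\<^sub>0 laurent) set" where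
  "vqpos = {f. \<forall>x. Poly_Mapping.lookup f x \<in> (*) lq ` laurent_pos}"

lemma vpos_add: "f \<in> vpos \<Longrightarrow> g \<in> vpos \<Longrightarrow> f + g \<in> vpos"
  by (simp add: vpos_def lookup_add laurent_pos_add)

lemma vpos_zero: "0 \<in> vpos"
  by (simp add: vpos_def laurent_pos_zero)

lemma vpos_sum: "(\<And>i. i \<in> A \<Longrightarrow> f i \<in> vpos) \<Longrightarrow> (\<Sum>i \<in> A. f i) \<in> vpos"
  by (induction A rule: infinite_finite_induct) (auto simp: vpos_zero vpos_add)

lemma vpos_scale: "a \<in> laurent_pos \<Longrightarrow> f \<in> vpos \<Longrightarrow> vscale a f \<in> vpos"
  by (simp add: vpos_def laurent_pos_mult)

lemma vpos_unit: "vunit x \<in> vpos"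
  by (simp add: vpos_def lookup_vunit laurent_pos_one laurent_pos_zero)

lemma vqpos_zero: "0 \<in> vqpos"
  by (auto simp: vqpos_def lq_mult_pos)

lemma vqpos_add: "f \<in> vqpos \<Longrightarrow> g \<in> vqpos \<Longrightarrow> f + g \<in> vqpos"
  by (simp add: vqpos_def lookup_add lq_laurent_pos_add)

lemma vqpos_uminus: "f \<in> vqpos \<Longrightarrow> - f \<in> vqpos"
  by (simp add: vqpos_def lq_laurent_pos_uminus)

lemma vqpos_diff: "f \<in> vqpos \<Longrightarrow> g \<in> vqpos \<Longrightarrow> f - g \<in> vqpos"
  using vqpos_add[OF _ vqpos_uminus, of f g] by simp

lemma vqpos_sum: "(\<And>i. i \<in> A \<Longrightarrow> f i \<in> vqpos) \<Longrightarrow> (\<Sum>i \<in> A. f i) \<in> vqpos"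
  by (induction A rule: infinite_finite_induct) (auto simp: vqpos_zero vqpos_add)

lemma vqpos_scale: "a \<in> (*) lq ` laurent_pos \<Longrightarrow> f \<in> vpos \<Longrightarrow> vscale a f \<in> vqpos"
  by (simp add: vqpos_def vpos_def lq_laurent_pos_mult)

lemma bar_invariant_vqpos:
  assumes "f \<in> vqpos" "vbar f = f" shows "f = 0"
proof (rule poly_mapping_eqI)
  fix x
  have "laurent_bar (Poly_Mapping.lookup f x) = Poly_Mapping.lookup f x"
    using assms(2) by (metis lookup_vbar)
  then show "Poly_Mapping.lookup f x = Poly_Mapping.lookup 0 x"
    using bar_invariant_lq_pos assms(1) by (auto simp: vqpos_def)
qed

text \<open>Free of any module, so that it can be instantiated for the given ideal and for its
  subset \<open>I1\<close>.\<close>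

locale ideal_in_coxeter = coxeter_system W S for W :: "'w monoid" (structure) and S +
  fixes J I :: "'w set"
  assumes I_ne: "I \<noteq> {}" and I_ideal: "weak_ideal W S I" and J_Pos: "J \<subseteq> Pos W S I"
begin

lemma I_carrier: "w \<in> I \<Longrightarrow> w \<in> carrier W"
  using I_ideal unfolding weak_ideal_def by blast

lemma I_D_set: "w \<in> I \<Longrightarrow> w \<in> D_set W S J"
  using J_Pos I_carrier unfolding D_set_def Pos_def by auto

lemma descend_in_I:
  assumes "w \<in> I" "s \<in> S" "ll (s \<otimes> w) < ll w" shows "s \<otimes> w \<in> I"
proof -
  have w: "w \<in> carrier W" using assms I_carrier by auto
  have "w \<otimes> inv (s \<otimes> w) = s" using w assms by (simp add: inv_mult_group m_assoc[symmetric])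
  then have "left_weak_le W S (s \<otimes> w) w"
    unfolding left_weak_le_def using len_gen_mult[of s w] len_gen[of s] assms w by auto
  then show ?thesis using I_ideal assms w unfolding weak_ideal_def by auto
qed

abbreviation less where "less y w \<equiv> bruhat_less W S y w"
abbreviation DD where "DD w \<equiv> descents W S J w"

lemma finite_less: "w \<in> carrier W \<Longrightarrow> finite {y \<in> I. less y w}"
  by (rule finite_subset[OF _ finite_bruhat_less[of w]]) auto

lemma SD_iff: "w \<in> I \<Longrightarrow> s \<in> S \<Longrightarrow> s \<in> SD W S w \<longleftrightarrow> ll (s \<otimes> w) < ll w"
  unfolding SD_def using bruhat_less_gen' I_carrier by auto

lemma descents_iff:
  assumes "w \<in> I" "s \<in> S"
  shows "s \<in> DD w \<longleftrightarrow> ll (s \<otimes> w) < ll w \<or> s \<otimes> w \<notin> D_set W S J"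
  unfolding descents_def SD_def WD_def
  using assms bruhat_less_gen[of s w] bruhat_less_gen'[of s w] I_carrier len_gen_mult[of s w] by auto

lemma not_descent_cases:
  assumes "w \<in> I" "s \<in> S" "s \<notin> DD w"
  obtains (SA) "s \<in> SA W S I w" "s \<otimes> w \<in> I" "ll w < ll (s \<otimes> w)"
    | (WA) "s \<in> WA W S J I w" "s \<otimes> w \<notin> I" "ll w < ll (s \<otimes> w)"
  using assms descents_iff[OF assms(1,2)] bruhat_less_gen[of s w] I_carrier len_gen_mult[of s w]
  unfolding SA_def WA_def by auto

lemma descent_cases:
  assumes "w \<in> I" "s \<in> S" "s \<in> DD w"
  obtains (SD) "s \<in> SD W S w" "s \<otimes> w \<in> I" "ll (s \<otimes> w) < ll w" "s \<notin> DD (s \<otimes> w)" "s \<in> SA W S I (s \<otimes> w)"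
    | (WD) "s \<in> WD W S J w"
proof (cases "ll (s \<otimes> w) < ll w")
  case True
  then have I: "s \<otimes> w \<in> I" using descend_in_I assms by auto
  have w: "w \<in> carrier W" using assms I_carrier by auto
  \<comment> \<open>Multiplying \<open>sw\<close> by \<open>s\<close> returns to \<open>w\<close>,
    which is longer and lies in the ideal, hence in \<open>D_set W S J\<close>.\<close>
  have "s \<notin> DD (s \<otimes> w)" using I assms w True I_D_set by (subst descents_iff) auto
  moreover have "s \<in> SA W S I (s \<otimes> w)"
    unfolding SA_def using assms w True bruhat_less_gen'[of s w] by auto
  ultimately show ?thesis using SD I True assms SD_iff by auto
next
  case False
  then show ?thesis using WD assms unfolding descents_def using SD_iff by auto
qed

lemma SA_descent:
  assumes "w \<in> I" "s \<in> S" "s \<notin> DD w" "s \<otimes> w \<in> I" shows "s \<in> DD (s \<otimes> w)"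
  using assms I_carrier len_gen_mult[of s w] by (auto simp: descents_iff)

end

text \<open>What remains of a module once the basis (c_w) is fixed: \<open>T s\<close> is the action
  of T_s on coordinates, \<open>\<beta> w\<close> the coordinate vector of b_w. \<open>T_bar\<close>
  expresses that bar turns T_s into its inverse T_s - (q - q^-1). The element type of the module no
  longer occurs.\<close>

locale wgraph_coords = ideal_in_coxeter +
  fixes p :: "'a \<Rightarrow> 'a \<Rightarrow> laurent"
    and T :: "'a \<Rightarrow> ('a \<Rightarrow>\<^sub>0 laurent) \<Rightarrow> ('a \<Rightarrow>\<^sub>0 laurent)" and \<beta> :: "'a \<Rightarrow> ('a \<Rightarrow>\<^sub>0 laurent)"
  assumes T_add: "s \<in> S \<Longrightarrow> T s (f + g) = T s f + T s g"
    and T_scale: "s \<in> S \<Longrightarrow> T s (vscale a f) = vscale a (T s f)"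
    and T_square: "s \<in> S \<Longrightarrow> Poly_Mapping.keys f \<subseteq> I \<Longrightarrow> T s (T s f) = f + vscale hecke_zeta (T s f)"
    and T_bar: "s \<in> S \<Longrightarrow> Poly_Mapping.keys f \<subseteq> I \<Longrightarrow> vbar (T s f) = T s (vbar f) - vscale hecke_zeta (vbar f)"
    and \<beta>_expand: "w \<in> I \<Longrightarrow> \<beta> w = vunit w + vscale lq (\<Sum>y \<in> {y \<in> I. bruhat_less W S y w}. vscale (p y w) (vunit y))"
    and p_pos: "w \<in> I \<Longrightarrow> y \<in> I \<Longrightarrow> bruhat_less W S y w \<Longrightarrow> p y w \<in> laurent_pos"
    and T_SA: "w \<in> I \<Longrightarrow> s \<in> SA W S I w \<Longrightarrow> T s (\<beta> w) = \<beta> (s \<otimes> w)"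
    and T_WD: "w \<in> I \<Longrightarrow> s \<in> WD W S J w \<Longrightarrow> T s (\<beta> w) = vscale (- lq_inv) (\<beta> w)"
    and T_WA: "w \<in> I \<Longrightarrow> s \<in> WA W S J I w \<Longrightarrow> \<exists>r :: 'a \<Rightarrow> laurent. (\<forall>y. r y \<in> (*) lq ` laurent_pos) \<and>
      T s (\<beta> w) = vscale lq (\<beta> w) - (\<Sum>y \<in> {y \<in> I. bruhat_less W S y (s \<otimes> w)}. vscale (r y) (\<beta> y))"
begin

section \<open>The W-graph formula by induction on length\<close>

lemma T_zero: "s \<in> S \<Longrightarrow> T s 0 = 0"
  using T_scale[of s 0 0] by simp

lemma T_uminus: "s \<in> S \<Longrightarrow> T s (- f) = - T s f"
  using T_scale[of s "- 1" f] by (simp add: vscale_simps)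

lemma T_minus: "s \<in> S \<Longrightarrow> T s (f - g) = T s f - T s g"
  using T_add[of s f "- g"] by (simp add: T_uminus)

lemma T_sum: "s \<in> S \<Longrightarrow> T s (\<Sum>i \<in> A. f i) = (\<Sum>i \<in> A. T s (f i))"
  by (induction A rule: infinite_finite_induct) (auto simp: T_zero T_add)

lemma keys_vunit: "w \<in> I \<Longrightarrow> Poly_Mapping.keys (vunit w :: 'a \<Rightarrow>\<^sub>0 laurent) \<subseteq> I"
  by (simp add: vunit_def)

definition below where "below w = {y \<in> I. bruhat_less W S y w}"

lemma finite_below: "w \<in> I \<Longrightarrow> finite (below w)"
  unfolding below_def using finite_less I_carrier by auto

lemma belowD: "y \<in> below w \<Longrightarrow> y \<in> I" "y \<in> below w \<Longrightarrow> ll y < ll w" "y \<in> below w \<Longrightarrow> less y w"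
  unfolding below_def using bruhat_less_len by auto

lemma \<beta>_below: "w \<in> I \<Longrightarrow> \<beta> w = vunit w + (\<Sum>y \<in> below w. vscale (lq * p y w) (vunit y))"
  by (simp add: \<beta>_expand below_def vscale_sum)

lemma \<beta>_lookup:
  assumes "w \<in> I"
  shows "Poly_Mapping.lookup (\<beta> w) y = (if y = w then 1 else if y \<in> below w then lq * p y w else 0)"
proof -
  have "(\<Sum>z \<in> below w. lq * p z w * Poly_Mapping.lookup (vunit z) y) =
      (\<Sum>z \<in> below w. if z = y then lq * p z w else 0)"
    by (rule sum.cong) (auto simp: lookup_vunit)
  also have "\<dots> = (if y \<in> below w then lq * p y w else 0)"
    using finite_below[OF assms] by (simp add: sum.delta)
  finally show ?thesis
    using assms belowD(2)[of w w] by (auto simp: \<beta>_below lookup_add lookup_sum lookup_vunit)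
qed

lemma \<beta>_pos: "w \<in> I \<Longrightarrow> \<beta> w \<in> vpos"
  unfolding \<beta>_below
  by (intro vpos_add vpos_sum vpos_scale vpos_unit laurent_pos_mult laurent_pos_lq p_pos)
    (auto simp: below_def)

lemma \<beta>_unit_qpos: "w \<in> I \<Longrightarrow> \<beta> w - vunit w \<in> vqpos"
  unfolding \<beta>_below
  by (simp, intro vqpos_sum vqpos_scale vpos_unit imageI p_pos) (auto simp: below_def)

definition cmu :: "'a \<Rightarrow> 'a \<Rightarrow> laurent" where
  "cmu y w = of_int (constant_term (p y w))"

text \<open>The W-graph formula with its sum cut down to indices below \<open>w\<close> and the
  index \<open>sw\<close>; that there are no other neighbours is established only in
  \<open>neighbours\<close>.\<close>

definition ascent_form :: "'a \<Rightarrow> 'a \<Rightarrow> ('a \<Rightarrow>\<^sub>0 laurent)" where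
  "ascent_form s w = vscale lq (vunit w) + (\<Sum>z \<in> {z \<in> below w. s \<in> DD z}. vscale (cmu z w) (vunit z))
     + (if s \<otimes> w \<in> I then vunit (s \<otimes> w) else 0)"

lemma ascent_form_pos: "ascent_form s w \<in> vpos"
  unfolding ascent_form_def cmu_def
  by (auto intro!: vpos_add vpos_sum vpos_scale vpos_unit laurent_pos_lq laurent_pos_of_int vpos_zero)

text \<open>Every term except the diagonal one sits at an index having \<open>s\<close> as a
  descent, \<open>sw\<close> included.\<close>

lemma ascent_form_lookup:
  assumes "y \<in> I" "s \<in> S" "s \<notin> DD y" "w \<in> I" "s \<notin> DD w"
  shows "Poly_Mapping.lookup (ascent_form s w) y = (if y = w then lq else 0)"
proof -
  have "(\<Sum>z \<in> {z \<in> below w. s \<in> DD z}. cmu z w * Poly_Mapping.lookup (vunit z) y) = 0"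
    using assms by (intro sum.neutral) (auto simp: lookup_vunit)
  then show ?thesis
    using SA_descent[OF assms(4,2,5)] assms
    by (auto simp: ascent_form_def lookup_add lookup_sum lookup_vunit)
qed

lemma unit_from_\<beta>: "w \<in> I \<Longrightarrow> vunit w = \<beta> w - (\<Sum>y \<in> below w. vscale (lq * p y w) (vunit y))"
  by (simp add: \<beta>_below)

definition T_formula where
  "T_formula w \<longleftrightarrow> (\<forall>s \<in> S. T s (vunit w) = (if s \<in> DD w then vscale (- lq_inv) (vunit w) else ascent_form s w))"

text \<open>The quadratic relation reads (T_s + q^-1)(T_s - q) = 0. The formula at the shorter
  \<open>sw\<close> expresses c_w as (T_s - q) c_sw minus a sum of eigenvectors for -q^-1, so c_w is
  such an eigenvector too.\<close>

lemma T_unit_SD: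
  assumes w: "w \<in> I" "s \<in> S" and I: "s \<otimes> w \<in> I" and nd: "s \<notin> DD (s \<otimes> w)"
    and len: "ll (s \<otimes> w) < ll w"
    and IH: "\<And>y. y \<in> I \<Longrightarrow> ll y < ll w \<Longrightarrow> T_formula y"
  shows "T s (vunit w) = vscale (- lq_inv) (vunit w)"
proof -
  let ?v = "s \<otimes> w" let ?B = "{z \<in> below ?v. s \<in> DD z}"
  let ?\<Sigma> = "\<Sum>z \<in> ?B. vscale (cmu z ?v) (vunit z)"
  have "T s (vunit ?v) = ascent_form s ?v"
    using IH[OF I len] nd w unfolding T_formula_def by auto
  then have 1: "T s (vunit ?v) = vscale lq (vunit ?v) + ?\<Sigma> + vunit w"
    using w I_carrier by (simp add: ascent_form_def)
  have "T s (vunit z) = vscale (- lq_inv) (vunit z)" if "z \<in> ?B" for z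
    using IH[of z] that belowD[of z ?v] len w unfolding T_formula_def by auto
  then have 2: "T s ?\<Sigma> = vscale (- lq_inv) ?\<Sigma>"
    by (simp add: T_sum T_scale w vscale_sum mult.commute)
  have 3: "vunit w = T s (vunit ?v) - vscale lq (vunit ?v) - ?\<Sigma>" using 1 by simp
  have "T s (vunit w) = T s (T s (vunit ?v)) - vscale lq (T s (vunit ?v)) - vscale (- lq_inv) ?\<Sigma>"
    unfolding 3 T_minus[OF w(2)] 2 T_scale[OF w(2)] ..
  also have "T s (T s (vunit ?v)) = vunit ?v + vscale hecke_zeta (T s (vunit ?v))"
    by (rule T_square[OF w(2) keys_vunit[OF I]])
  finally have "T s (vunit w) = vunit ?v - vscale lq_inv (T s (vunit ?v)) + vscale lq_inv ?\<Sigma>"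
    by (simp add: vscale_simps)
  also have "\<dots> = vscale (- lq_inv) (vunit w)"
    unfolding 3 by (simp add: vscale_simps)
  finally show ?thesis .
qed

lemma T_unit_ascent:
  assumes w: "w \<in> I" "s \<in> S" "s \<notin> DD w"
    and IH: "\<And>y. y \<in> I \<Longrightarrow> ll y < ll w \<Longrightarrow> T_formula y"
  shows "T s (vunit w) = ascent_form s w"
proof -
  \<comment> \<open>\<open>R\<close> isolates c_sw, the leading term of T_s b_w when
    \<open>sw\<close> lies in the ideal.\<close>
  define R where "R = (if s \<otimes> w \<in> I then vunit (s \<otimes> w) else (0 :: 'a \<Rightarrow>\<^sub>0 laurent))"
  define g where "g = T s (vunit w) - ascent_form s w"
  have form: "ascent_form s w = vscale lq (vunit w)
      + (\<Sum>z \<in> below w. if s \<in> DD z then vscale (cmu z w) (vunit z) else 0) + R"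
    unfolding ascent_form_def R_def using finite_below[OF w(1)]
    by (simp add: sum.inter_filter)
  \<comment> \<open>Only the coefficient q of c_w moves under bar, by the amount that
    \<open>T_bar\<close> produces for T_s c_w.\<close>
  have "vbar (ascent_form s w) = vscale lq_inv (vunit w) - vscale lq (vunit w) + ascent_form s w"
    unfolding ascent_form_def cmu_def by (simp add: vbar_simps vbar_sum)
  moreover have "vbar (T s (vunit w)) = T s (vunit w) - vscale hecke_zeta (vunit w)"
    by (simp add: T_bar[OF w(2) keys_vunit[OF w(1)]] vbar_simps)
  ultimately have bar: "vbar g = g"
    unfolding g_def by (simp add: vbar_simps vscale_simps)
  have main: "T s (\<beta> w) - R \<in> vqpos"
    using w
  proof (cases rule: not_descent_cases)
    case SA
    then show ?thesis using T_SA[of w s] w \<beta>_unit_qpos[of "s \<otimes> w"] by (simp add: R_def)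
  next
    case WA
    then obtain r where r: "\<forall>y. r y \<in> (*) lq ` laurent_pos"
      "T s (\<beta> w) = vscale lq (\<beta> w) - (\<Sum>y \<in> {y \<in> I. less y (s \<otimes> w)}. vscale (r y) (\<beta> y))"
      using T_WA w by blast
    have "lq \<in> (*) lq ` laurent_pos" using laurent_pos_one by force
    then show ?thesis using WA r \<beta>_pos w unfolding R_def r(2)
      by (auto intro!: vqpos_diff vqpos_scale vqpos_sum)
  qed
  have "T s (vunit w) = T s (\<beta> w) - (\<Sum>y \<in> below w. vscale (lq * p y w) (T s (vunit y)))"
    by (subst unit_from_\<beta>[OF w(1)]) (simp add: T_minus T_sum T_scale w)
  then have "g = (T s (\<beta> w) - R) - vscale lq (vunit w) -
    (\<Sum>y \<in> below w. vscale (lq * p y w) (T s (vunit y)) + (if s \<in> DD y then vscale (cmu y w) (vunit y) else 0))"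
    unfolding g_def form by (simp add: sum.distrib algebra_simps)
  moreover have "vscale (lq * p y w) (T s (vunit y)) + (if s \<in> DD y then vscale (cmu y w) (vunit y) else 0) \<in> vqpos"
    if y: "y \<in> below w" for y
  proof -
    have pp: "p y w \<in> laurent_pos" using p_pos w y belowD by blast
    have Ty: "T s (vunit y) = (if s \<in> DD y then vscale (- lq_inv) (vunit y) else ascent_form s y)"
      using IH[of y] belowD[OF y] w unfolding T_formula_def by blast
    show ?thesis
    proof (cases "s \<in> DD y")
      case True
      \<comment> \<open>The eigenvalue -q^-1 cancels the factor q, leaving the constant term of
        \<open>p y w\<close> minus \<open>p y w\<close> itself.\<close>
      have "lq * p y w * (- lq_inv) = - p y w" by simp
      then have "vscale (lq * p y w) (T s (vunit y)) + (if s \<in> DD y then vscale (cmu y w) (vunit y) else 0)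
          = vscale (cmu y w - p y w) (vunit y)"
        using True by (simp add: Ty vscale_simps)
      then show ?thesis unfolding cmu_def
        using vqpos_scale[OF lq_laurent_pos_const[OF pp] vpos_unit] by simp
    next
      case False
      then show ?thesis using pp by (auto simp: Ty intro!: vqpos_scale ascent_form_pos)
    qed
  qed
  moreover have "lq \<in> (*) lq ` laurent_pos" using laurent_pos_one by force
  ultimately have "g \<in> vqpos"
    using main by (auto intro!: vqpos_diff vqpos_scale vqpos_sum vpos_unit)
  then have "g = 0" using bar bar_invariant_vqpos by blast
  then show ?thesis by (simp add: g_def)
qed

text \<open>\<open>(T\<^sub>s + q\<^sup>-\<^sup>1) c\<^sub>w\<close> is bar invariant, and its coefficient at \<open>y\<close> is \<open>-(q\<^sup>2 + 1) q\<^bsub>y,w\<^esub>\<close>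
  whenever \<open>s\<close> is not a descent of \<open>y\<close>; all such \<open>q\<^bsub>y,w\<^esub>\<close> therefore vanish.\<close>

lemma T_unit_WD:
  assumes w: "w \<in> I" "s \<in> S" "s \<in> WD W S J w"
    and IH: "\<And>y. y \<in> I \<Longrightarrow> ll y < ll w \<Longrightarrow> T_formula y"
  shows "T s (vunit w) = vscale (- lq_inv) (vunit w) \<and> (\<forall>y \<in> below w. s \<notin> DD y \<longrightarrow> p y w = 0)"
proof -
  define h where "h = T s (vunit w) + vscale lq_inv (vunit w)"
  have "vbar (T s (vunit w)) = T s (vunit w) - vscale hecke_zeta (vunit w)"
    by (simp add: T_bar[OF w(2) keys_vunit[OF w(1)]] vbar_simps)
  then have bar: "vbar h = h"
    unfolding h_def by (simp add: vbar_simps vscale_simps)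
  have "T s (vunit w) = T s (\<beta> w) - (\<Sum>y \<in> below w. vscale (lq * p y w) (T s (vunit y)))"
    by (subst unit_from_\<beta>[OF w(1)]) (simp add: T_minus T_sum T_scale w)
  moreover have "vscale lq_inv (vunit w) = vscale lq_inv (\<beta> w) - (\<Sum>y \<in> below w. vscale (p y w) (vunit y))"
    by (subst unit_from_\<beta>[OF w(1)]) (simp add: vscale_simps vscale_sum mult.assoc[symmetric])
  ultimately have "h = - (\<Sum>y \<in> below w. vscale (lq * p y w) (T s (vunit y)) + vscale (p y w) (vunit y))"
    unfolding h_def T_WD[OF w(1,3)] by (simp add: sum.distrib vscale_simps)
  also have "(\<Sum>y \<in> below w. vscale (lq * p y w) (T s (vunit y)) + vscale (p y w) (vunit y)) =
    (\<Sum>y \<in> below w. if s \<in> DD y then 0 else vscale (lq * p y w) (ascent_form s y) + vscale (p y w) (vunit y))"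
  proof (rule sum.cong)
    fix y assume y: "y \<in> below w"
    have Ty: "T s (vunit y) = (if s \<in> DD y then vscale (- lq_inv) (vunit y) else ascent_form s y)"
      using IH[of y] belowD[OF y] w unfolding T_formula_def by blast
    \<comment> \<open>A descent term disappears: q p times the eigenvalue -q^-1 cancels against
      p.\<close>
    have "lq * p y w * (- lq_inv) = - p y w" by simp
    then show "vscale (lq * p y w) (T s (vunit y)) + vscale (p y w) (vunit y) =
      (if s \<in> DD y then 0 else vscale (lq * p y w) (ascent_form s y) + vscale (p y w) (vunit y))"
      by (simp add: Ty vscale_simps)
  qed simp
  finally have h: "h = - (\<Sum>y \<in> below w. if s \<in> DD y then 0
      else vscale (lq * p y w) (ascent_form s y) + vscale (p y w) (vunit y))" .
  have zero: "p x w = 0" if x: "x \<in> below w" "s \<notin> DD x" for x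
  proof -
    \<comment> \<open>By \<open>ascent_form_lookup\<close> only the summand y = x reaches this
      coordinate, once with a further factor q through \<open>ascent_form\<close> and once
      directly.\<close>
    have "Poly_Mapping.lookup h x = - (\<Sum>y \<in> below w. if y = x then lq * (lq * p y w) + p y w else 0)"
      unfolding h lookup_uminus lookup_sum using x belowD(1) w
      by (intro arg_cong[of _ _ uminus] sum.cong)
        (auto simp: lookup_add ascent_form_lookup lookup_vunit mult.commute mult.left_commute)
    also have "\<dots> = - (lq * (lq * p x w) + p x w)"
      using x finite_below[OF w(1)] by (simp add: sum.delta)
    finally have hx: "Poly_Mapping.lookup h x = - (lq * (lq * p x w) + p x w)" .
    have "laurent_bar (Poly_Mapping.lookup h x) = Poly_Mapping.lookup h x" using bar by (metis lookup_vbar)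
    then have "laurent_bar (lq * (lq * p x w) + p x w) = lq * (lq * p x w) + p x w"
      unfolding hx laurent_bar_uminus neg_equal_iff_equal .
    then show ?thesis using bar_invariant_quadratic p_pos[of w x] x belowD w by blast
  qed
  \<comment> \<open>Each surviving summand carries a factor \<open>p y w\<close> with
    \<open>s\<close> not a descent of \<open>y\<close>.\<close>
  have "h = 0" unfolding h using zero by (auto intro!: sum.neutral)
  then have "T s (vunit w) = vscale (- lq_inv) (vunit w)"
    unfolding h_def by (simp add: vscale_simps add_eq_0_iff)
  then show ?thesis using zero by blast
qed

lemma T_formula: "w \<in> I \<Longrightarrow> T_formula w"
proof (induction "ll w" arbitrary: w rule: less_induct)
  case less
  show ?case unfolding T_formula_def
  proof
    fix s assume s: "s \<in> S"
    show "T s (vunit w) = (if s \<in> DD w then vscale (- lq_inv) (vunit w) else ascent_form s w)"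
    proof (cases "s \<in> DD w")
      case True
      from less(2) s True have "T s (vunit w) = vscale (- lq_inv) (vunit w)"
      proof (cases rule: descent_cases)
        case SD
        then show ?thesis using T_unit_SD[of w s] less s by blast
      next
        case WD
        then show ?thesis using T_unit_WD[of w s] less s by blast
      qed
      then show ?thesis using True by simp
    next
      case False
      then show ?thesis using T_unit_ascent[of w s] less s by simp
    qed
  qed
qed

lemma T_unit:
  "w \<in> I \<Longrightarrow> s \<in> S \<Longrightarrow> T s (vunit w) = (if s \<in> DD w then vscale (- lq_inv) (vunit w) else ascent_form s w)"
  using T_formula unfolding T_formula_def by blast

lemma p_WD_zero: "w \<in> I \<Longrightarrow> s \<in> WD W S J w \<Longrightarrow> y \<in> below w \<Longrightarrow> s \<notin> DD y \<Longrightarrow> p y w = 0"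
  using T_unit_WD[of w s] T_formula unfolding WD_def by blast

lemma T_expansion:
  assumes "s \<in> S" "finite A" "Poly_Mapping.keys f \<subseteq> A"
  shows "T s f = (\<Sum>x \<in> A. vscale (Poly_Mapping.lookup f x) (T s (vunit x)))"
  by (subst vunit_expansion[OF assms(2,3)]) (simp add: T_sum T_scale assms(1))

text \<open>At an index without \<open>s\<close> as a descent, the coordinate functional is an
  eigenfunctional of T_s with eigenvalue q; coefficients can be compared there whatever the edge
  weights are.\<close>

lemma T_lookup_ascent:
  assumes "w \<in> I" "s \<in> S" "s \<notin> DD w" "Poly_Mapping.keys f \<subseteq> I"
  shows "Poly_Mapping.lookup (T s f) w = lq * Poly_Mapping.lookup f w"
proof -
  have "Poly_Mapping.lookup (T s (vunit y)) w = (if y = w then lq else 0)" if "y \<in> I" for y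
    using assms that by (auto simp: T_unit ascent_form_lookup lookup_vunit)
  then have "Poly_Mapping.lookup (T s f) w = (\<Sum>x \<in> Poly_Mapping.keys f. if x = w then Poly_Mapping.lookup f x * lq else 0)"
    using assms(4) unfolding T_expansion[OF assms(2) finite_keys order.refl, of f] lookup_sum
    by (intro sum.cong) auto
  also have "\<dots> = lq * Poly_Mapping.lookup f w"
    by (simp add: sum.delta in_keys_iff mult.commute)
  finally show ?thesis .
qed

lemma lq_cancel: "lq * a = lq * b \<Longrightarrow> a = b"
  by (metis lq_mult_inv(2) mult.assoc mult_1)

lemma keys_\<beta>: "w \<in> I \<Longrightarrow> Poly_Mapping.keys (\<beta> w) \<subseteq> insert w (below w)"
  by (auto simp: in_keys_iff \<beta>_lookup split: if_splits)

lemma keys_\<beta>_I: "w \<in> I \<Longrightarrow> Poly_Mapping.keys (\<beta> w) \<subseteq> I"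
  using keys_\<beta> belowD(1) by blast

text \<open>b_u is T_s applied to b_su, and by \<open>T_lookup_ascent\<close> this multiplies the
  coordinate at \<open>y\<close> by q. After cancelling q, \<open>p y u\<close> is the coordinate of
  b_su at \<open>y\<close>: one for y = su, otherwise zero or a multiple of q.\<close>

lemma p_SD:
  assumes u: "u \<in> I" "s \<in> S" "ll (s \<otimes> u) < ll u" and y: "y \<in> below u" "s \<notin> DD y"
  shows "constant_term (p y u) = (if y = s \<otimes> u then 1 else 0)"
proof -
  let ?v = "s \<otimes> u"
  have v: "?v \<in> I" using descend_in_I u by blast
  have "s \<in> SA W S I ?v" unfolding SA_def using u v bruhat_less_gen'[of s u] I_carrier by auto
  then have "T s (\<beta> ?v) = \<beta> u" using T_SA[OF v] u I_carrier by simp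
  then have "Poly_Mapping.lookup (\<beta> u) y = lq * Poly_Mapping.lookup (\<beta> ?v) y"
    using T_lookup_ascent[of y s "\<beta> ?v"] y u v keys_\<beta>_I belowD by metis
  moreover have "y \<noteq> u" using belowD(2)[OF y(1)] by auto
  ultimately have "lq * p y u = lq * (if y = ?v then 1 else if y \<in> below ?v then lq * p y ?v else 0)"
    using y u v by (simp only: \<beta>_lookup) simp
  then have "p y u = (if y = ?v then 1 else if y \<in> below ?v then lq * p y ?v else 0)"
    by (rule lq_cancel)
  \<comment> \<open>The constant term of q p is the coefficient of p in degree -1.\<close>
  moreover have "Poly_Mapping.lookup (p y ?v) (- 1) = 0" if "y \<in> below ?v"
    using p_pos[of ?v y] v that belowD laurent_posD by (metis neg_less_0_iff_less zero_less_one)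
  ultimately show ?thesis by (auto simp: constant_term_def lookup_one)
qed

section \<open>The graph, its preorder and the cell of the identity\<close>

abbreviation \<Gamma> where "\<Gamma> \<equiv> basis_graph W S J I p"

lemma graph_simps [simp]: "verts \<Gamma> = I" "w \<in> I \<Longrightarrow> tau \<Gamma> w = DD w"
  by (auto simp: basis_graph_def)

lemma mu_below: "y \<in> below w \<Longrightarrow> w \<in> I \<Longrightarrow> mu \<Gamma> y w = constant_term (p y w)"
  and mu_above: "y \<in> below w \<Longrightarrow> w \<in> I \<Longrightarrow> mu \<Gamma> w y = constant_term (p y w)"
  by (auto simp: basis_graph_def below_def dest: bruhat_less_asym)

lemma mu_cases: "mu \<Gamma> y w \<noteq> 0 \<Longrightarrow> y \<in> I \<and> w \<in> I \<and> (y \<in> below w \<or> w \<in> below y)"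
  by (auto simp: basis_graph_def below_def split: if_splits)

lemma mu_gen:
  assumes "w \<in> I" "s \<in> S" "s \<otimes> w \<in> I" "ll w < ll (s \<otimes> w)" "s \<notin> DD w"
  shows "mu \<Gamma> (s \<otimes> w) w = 1"
proof -
  have b: "w \<in> below (s \<otimes> w)" using assms bruhat_less_gen I_carrier by (auto simp: below_def)
  show ?thesis using p_SD[of "s \<otimes> w" s w] b assms I_carrier by (simp add: mu_above)
qed

text \<open>Concerns the edges from \<open>w\<close> upwards. If \<open>s\<close> is a strong
  descent of \<open>u\<close>, then \<open>p_SD\<close> leaves only u = sw; if it is a weak descent,
  then \<open>p_WD_zero\<close> makes the edge weight vanish.\<close>

lemma neighbours:
  assumes w: "w \<in> I" "s \<in> S" "s \<notin> DD w" and u: "u \<in> I" "s \<in> DD u" "mu \<Gamma> u w \<noteq> 0"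
  shows "u \<in> below w \<or> u = s \<otimes> w"
proof (rule ccontr)
  assume "\<not> ?thesis"
  then have b: "w \<in> below u" "u \<noteq> s \<otimes> w" using mu_cases[OF u(3)] by auto
  have c: "constant_term (p w u) \<noteq> 0" using u b by (simp add: mu_above)
  from u(1) w(2) u(2) show False
  proof (cases rule: descent_cases)
    case SD
    have "w \<noteq> s \<otimes> u" using b w u I_carrier by auto
    then show False using p_SD[OF u(1) w(2) SD(3) b(1) w(3)] c by simp
  next
    case WD
    then show False using p_WD_zero[OF u(1) WD b(1) w(3)] c by (simp add: constant_term_def)
  qed
qed

text \<open>Brings \<open>ascent_form\<close> into the shape demanded by \<open>W_graph\<close>:
  indices below \<open>w\<close> of weight zero drop out, and \<open>sw\<close> enters with weight
  one.\<close>

lemma T_graph: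
  assumes w: "w \<in> I" "s \<in> S" "s \<notin> DD w"
  defines "U \<equiv> {u \<in> I. s \<in> DD u \<and> mu \<Gamma> u w \<noteq> 0}"
  shows "finite U" "T s (vunit w) = vscale lq (vunit w) + (\<Sum>u \<in> U. vscale (of_int (mu \<Gamma> u w)) (vunit u))"
proof -
  let ?B = "{z \<in> below w. s \<in> DD z}"
  let ?N = "if s \<otimes> w \<in> I then {s \<otimes> w} else {}"
  have fin: "finite (?B \<union> ?N)" using finite_below[OF w(1)] by auto
  have sub: "U \<subseteq> ?B \<union> ?N" unfolding U_def using neighbours[OF w] by auto
  show "finite U" using finite_subset[OF sub fin] .
  have N: "s \<in> DD (s \<otimes> w) \<and> ll w < ll (s \<otimes> w) \<and> mu \<Gamma> (s \<otimes> w) w = 1" if "s \<otimes> w \<in> I"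
  proof -
    have "ll w < ll (s \<otimes> w)" using w that descents_iff len_gen_mult[of s w] I_carrier by fastforce
    then show ?thesis using mu_gen[OF w(1,2) that _ w(3)] SA_descent w that by blast
  qed
  have "(\<Sum>u \<in> U. vscale (of_int (mu \<Gamma> u w)) (vunit u)) =
      (\<Sum>u \<in> ?B \<union> ?N. vscale (of_int (mu \<Gamma> u w)) (vunit u))"
    using fin sub N belowD(1) by (intro sum.mono_neutral_left) (auto simp: U_def split: if_splits)
  also have "\<dots> = (\<Sum>u \<in> ?B. vscale (of_int (mu \<Gamma> u w)) (vunit u)) + (\<Sum>u \<in> ?N. vscale (of_int (mu \<Gamma> u w)) (vunit u))"
    using finite_below[OF w(1)] N belowD(2)[of "s \<otimes> w" w] by (intro sum.union_disjoint) auto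
  also have "(\<Sum>u \<in> ?B. vscale (of_int (mu \<Gamma> u w)) (vunit u)) = (\<Sum>z \<in> ?B. vscale (cmu z w) (vunit z))"
    using w(1) by (intro sum.cong) (auto simp: cmu_def mu_below)
  also have "(\<Sum>u \<in> ?N. vscale (of_int (mu \<Gamma> u w)) (vunit u)) = (if s \<otimes> w \<in> I then vunit (s \<otimes> w) else 0)"
    using N by auto
  finally show "T s (vunit w) = vscale lq (vunit w) + (\<Sum>u \<in> U. vscale (of_int (mu \<Gamma> u w)) (vunit u))"
    using w by (simp add: T_unit ascent_form_def add.assoc)
qed

lemma arrow_gen:
  assumes "w \<in> I" "s \<in> S" "ll (s \<otimes> w) < ll w"
  shows "arrow \<Gamma> w (s \<otimes> w)"
proof -
  have I: "s \<otimes> w \<in> I" using descend_in_I assms by blast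
  have D: "s \<in> DD w" using assms descents_iff by blast
  have nd: "s \<notin> DD (s \<otimes> w)"
    using I assms I_D_set I_carrier by (subst descents_iff) auto
  have "mu \<Gamma> w (s \<otimes> w) = 1"
    using mu_gen[of "s \<otimes> w" s] assms I nd I_carrier by simp
  then show ?thesis unfolding arrow_def using assms I D nd by auto
qed

text \<open>Letters are stripped from the left. Additivity of lengths forces each of them to shorten
  the element by one, so each removal is an arrow.\<close>

lemma suffix_le:
  assumes "ws \<in> lists S" "u \<in> carrier W" "word_prod W ws \<otimes> u \<in> I"
    "ll (word_prod W ws \<otimes> u) = length ws + ll u"
  shows "u \<in> I \<and> wg_le \<Gamma> (word_prod W ws \<otimes> u) u"
  using assms(1,3,4)
proof (induction ws rule: lists.induct)
  case Nil
  then show ?case using assms(2) by (simp add: wg_le_def)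
next
  case (Cons s ws)
  let ?v = "word_prod W ws \<otimes> u" let ?w = "word_prod W (s # ws) \<otimes> u"
  have v: "?v \<in> carrier W" "?w = s \<otimes> ?v" "s \<otimes> ?w = ?v" using Cons assms(2) by (auto simp: m_assoc)
  have "ll ?v \<le> length ws + ll u"
    using len_mult_le[OF word_prod_closed[OF Cons.hyps(2)] assms(2)] len_le[OF Cons.hyps(2) HOL.refl] by linarith
  moreover have "ll ?w \<le> Suc (ll ?v)" using len_gen_mult[OF Cons.hyps(1) v(1)] v(2) by auto
  ultimately have l: "ll ?v = length ws + ll u" "ll ?v < ll ?w" using Cons.prems(2) by auto
  have "?v \<in> I" using descend_in_I[OF Cons.prems(1) Cons.hyps(1)] l(2) unfolding v(3) by blast
  then have "u \<in> I" "wg_le \<Gamma> ?v u" using Cons.IH l(1) by auto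
  moreover have "arrow \<Gamma> ?w ?v" using arrow_gen[OF Cons.prems(1) Cons.hyps(1)] l(2) unfolding v(3) by blast
  ultimately show ?case unfolding wg_le_def by (auto intro: converse_rtranclp_into_rtranclp)
qed

lemma weak_le_graph_le:
  assumes "w \<in> I" "u \<in> carrier W" "left_weak_le W S u w"
  shows "u \<in> I \<and> wg_le \<Gamma> w u"
proof -
  have w: "w \<in> carrier W" using assms I_carrier by auto
  obtain ws where ws: "ws \<in> lists S" "word_prod W ws = w \<otimes> inv u" "length ws = ll (w \<otimes> inv u)"
    using reduced_word w assms(2) by (metis inv_closed m_closed)
  have "word_prod W ws \<otimes> u = w" unfolding ws(2) using w assms(2) by (simp add: m_assoc)
  then show ?thesis using suffix_le[OF ws(1) assms(2)] ws(3) assms(1,3) unfolding left_weak_le_def by auto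
qed

lemma one_in_I: "\<one> \<in> I" and graph_le_one: "w \<in> I \<Longrightarrow> wg_le \<Gamma> w \<one>"
proof -
  have *: "\<one> \<in> I \<and> wg_le \<Gamma> w \<one>" if "w \<in> I" for w
    using weak_le_graph_le[of w \<one>] that I_carrier by (auto simp: left_weak_le_def)
  show "\<one> \<in> I" using * I_ne by blast
  show "wg_le \<Gamma> w \<one>" if "w \<in> I" using * that by blast
qed

lemma \<beta>_one: "\<beta> \<one> = vunit \<one>"
proof -
  have "below \<one> = {}" using belowD(2)[of _ \<one>] by auto
  then show ?thesis using \<beta>_below[OF one_in_I] by simp
qed

text \<open>Half of the condition for lying in the cell of the identity; the other half is
  \<open>graph_le_one\<close>.\<close>

definition I1 where "I1 = {w \<in> I. wg_le \<Gamma> \<one> w}"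

lemma I1_subset: "I1 \<subseteq> I" unfolding I1_def by auto

lemma I1_ideal: "ideal_in_coxeter W S J I1"
proof
  show "I1 \<noteq> {}" using one_in_I unfolding I1_def wg_le_def by auto
  show "weak_ideal W S I1"
    unfolding weak_ideal_def I1_def using weak_le_graph_le I_carrier unfolding wg_le_def
    by (auto intro: rtranclp_trans)
  show "J \<subseteq> Pos W S I1" using J_Pos I1_subset unfolding Pos_def by auto
qed

lemma cell_one: "cell_of \<Gamma> \<one> = I1"
  unfolding cell_of_def I1_def using graph_le_one by auto

lemma maximal_cell: "maximal_cells \<Gamma> = {cell_of \<Gamma> \<one>}"
proof -
  have trans: "wg_le \<Gamma> u v \<Longrightarrow> wg_le \<Gamma> v w \<Longrightarrow> wg_le \<Gamma> u w" for u v w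
    unfolding wg_le_def by (rule rtranclp_trans)
  have self: "wg_le \<Gamma> u u" for u unfolding wg_le_def by simp
  have one: "cell_of \<Gamma> \<one> \<in> cells \<Gamma>" using one_in_I by (auto simp: cells_def)
  have up: "C = cell_of \<Gamma> \<one>" if C: "C \<in> cells \<Gamma>" "cell_le \<Gamma> (cell_of \<Gamma> \<one>) C" for C
  proof -
    obtain w where w: "w \<in> I" "C = cell_of \<Gamma> w" using C(1) by (auto simp: cells_def)
    then have "wg_le \<Gamma> \<one> w" using C(2) trans unfolding cell_le_def cell_of_def by blast
    then show ?thesis using w graph_le_one trans unfolding w(2) cell_of_def by blast
  qed
  have "cell_le \<Gamma> C (cell_of \<Gamma> \<one>)" if C: "C \<in> cells \<Gamma>" for C
  proof -
    obtain w where w: "w \<in> I" "C = cell_of \<Gamma> w" using C by (auto simp: cells_def)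
    then show ?thesis unfolding cell_le_def using graph_le_one one_in_I self
      by (intro bexI[of _ w] bexI[of _ \<one>]) (auto simp: cell_of_def)
  qed
  then show ?thesis unfolding maximal_cells_def using one up by blast
qed

lemma T_kernel:
  assumes "s \<in> S" "Poly_Mapping.keys f \<subseteq> I - I1" shows "Poly_Mapping.keys (T s f) \<subseteq> I - I1"
proof -
  have *: "Poly_Mapping.keys (T s (vunit w)) \<subseteq> I - I1" if w: "w \<in> I - I1" for w
  proof (cases "s \<in> DD w")
    case True
    then show ?thesis using w assms(1) by (auto simp: T_unit in_keys_iff lookup_vunit split: if_splits)
  next
    case False
    let ?U = "{u \<in> I. s \<in> DD u \<and> mu \<Gamma> u w \<noteq> 0}"
    have "?U \<subseteq> I - I1"
    proof
      fix u assume u: "u \<in> ?U"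
      then have "arrow \<Gamma> u w" unfolding arrow_def using w False by auto
      then have "wg_le \<Gamma> u w" unfolding wg_le_def by auto
      \<comment> \<open>1 \<le> u and u \<le> w in the preorder would give 1 \<le> w.\<close>
      then have "u \<notin> I1" using w u unfolding I1_def wg_le_def by (auto intro: rtranclp_trans)
      then show "u \<in> I - I1" using u by auto
    qed
    moreover
    have "Poly_Mapping.lookup (T s (vunit w)) y = 0" if "y \<noteq> w" "y \<notin> ?U" for y
    proof -
      have "(\<Sum>u \<in> ?U. of_int (mu \<Gamma> u w) * Poly_Mapping.lookup (vunit u) y) = 0"
        using that by (intro sum.neutral) (auto simp: lookup_vunit)
      then show ?thesis using T_graph(2)[of w s] w assms(1) False that
        by (auto simp: lookup_add lookup_sum lookup_vunit)
    qed
    then have "Poly_Mapping.keys (T s (vunit w)) \<subseteq> insert w ?U"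
      unfolding in_keys_iff subset_iff by blast
    ultimately show ?thesis using w by blast
  qed
  have "Poly_Mapping.keys (T s f) \<subseteq> (\<Union>x \<in> Poly_Mapping.keys f. Poly_Mapping.keys (vscale (Poly_Mapping.lookup f x) (T s (vunit x))))"
    unfolding T_expansion[OF assms(1) finite_keys order.refl, of f]
  proof
    fix y assume "y \<in> Poly_Mapping.keys (\<Sum>x \<in> Poly_Mapping.keys f. vscale (Poly_Mapping.lookup f x) (T s (vunit x)))"
    then have "(\<Sum>x \<in> Poly_Mapping.keys f. Poly_Mapping.lookup (vscale (Poly_Mapping.lookup f x) (T s (vunit x))) y) \<noteq> 0"
      by (simp add: in_keys_iff lookup_sum)
    then obtain x where "x \<in> Poly_Mapping.keys f" "Poly_Mapping.lookup (vscale (Poly_Mapping.lookup f x) (T s (vunit x))) y \<noteq> 0"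
      using sum.not_neutral_contains_not_neutral by blast
    then show "y \<in> (\<Union>x \<in> Poly_Mapping.keys f. Poly_Mapping.keys (vscale (Poly_Mapping.lookup f x) (T s (vunit x))))"
      by (auto simp: in_keys_iff)
  qed
  also have "\<dots> \<subseteq> (\<Union>x \<in> Poly_Mapping.keys f. Poly_Mapping.keys (T s (vunit x)))"
    by (auto simp: in_keys_iff)
  also have "\<dots> \<subseteq> I - I1" using * assms(2) by blast
  finally show ?thesis .
qed

end

text \<open>No isomorphism of modules is constructed. The two operators are compared through
  \<open>T_unit\<close> on unit vectors whose coefficients are already known to agree, and these
  vectors suffice to compute the next \<open>\<beta>\<close>.\<close>

lemma wgraph_coords_unique:
  assumes "wgraph_coords W S J I p T \<beta>" "wgraph_coords W S J I p' T' \<beta>'"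
  shows "w \<in> I \<Longrightarrow> \<beta> w = \<beta>' w"
    "w \<in> I \<Longrightarrow> y \<in> I \<Longrightarrow> bruhat_less W S y w \<Longrightarrow> p y w = p' y w"
proof -
  interpret A: wgraph_coords W S J I p T \<beta> by (rule assms(1))
  interpret B: wgraph_coords W S J I p' T' \<beta>' by (rule assms(2))
  have p: "p y w = p' y w" if "\<beta> w = \<beta>' w" "w \<in> I" "y \<in> A.below w" for y w
  proof -
    have "y \<noteq> w" "y \<in> B.below w" using that A.belowD(2) by (auto simp: A.below_def B.below_def)
    then have "lq * p y w = lq * p' y w"
      using A.\<beta>_lookup[OF that(2), of y] B.\<beta>_lookup[OF that(2), of y] that
      by auto
    then show ?thesis by (rule A.lq_cancel)
  qed
  have \<beta>: "\<beta> w = \<beta>' w" if "w \<in> I" for w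
    using that
  proof (induction "len W S w" arbitrary: w rule: less_induct)
    case less
    have w: "w \<in> carrier W" using less A.I_carrier by blast
    show ?case
    proof (cases "w = \<one>\<^bsub>W\<^esub>")
      case True
      then show ?thesis using A.\<beta>_one B.\<beta>_one by simp
    next
      case False
      \<comment> \<open>The first letter of a reduced word provides an \<open>s\<close> with
        \<open>sw\<close> shorter.\<close>
      obtain ws where ws: "ws \<in> lists S" "word_prod W ws = w" "length ws = len W S w"
        using A.reduced_word w by blast
      then obtain s us where us: "ws = s # us" using False by (cases ws) auto
      have s: "s \<in> S" "us \<in> lists S" using ws us by auto
      let ?v = "s \<otimes>\<^bsub>W\<^esub> w"
      have "?v = word_prod W us" using ws(2) s(1) us A.word_prod_closed[OF s(2)] by auto
      then have len: "len W S ?v < len W S w" using A.len_le[OF s(2), of ?v] ws us by simp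
      have v: "?v \<in> I" using A.descend_in_I less s len by blast
      have SA: "s \<in> SA W S I ?v" unfolding SA_def
        using s w less A.bruhat_less_gen'[of s w] len by auto
      have "\<beta> w = T s (\<beta> ?v)" "\<beta>' w = T' s (\<beta>' ?v)"
        using A.T_SA[OF v SA] B.T_SA[OF v SA] s w by auto
      moreover have eq: "\<beta> ?v = \<beta>' ?v" using less v len by blast
      moreover have "T s (\<beta> ?v) = T' s (\<beta> ?v)"
      proof -
        have fin: "finite (insert ?v (A.below ?v))" using A.finite_below[OF v] by simp
        \<comment> \<open>The support of \<open>\<beta> ?v\<close> consists of elements shorter than
          \<open>w\<close>, so the induction hypothesis yields equal coefficients and equal ascent
          formulas.\<close>
        have "T s (vunit y) = T' s (vunit y)" if y: "y \<in> insert ?v (A.below ?v)" for y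
        proof -
          have yI: "y \<in> I" and ly: "len W S y < len W S w" using y v A.belowD[of y ?v] len by auto
          have "\<beta> y = \<beta>' y" using less yI ly by blast
          then have "p z y = p' z y" if "z \<in> A.below y" for z using p yI that by blast
          then have "A.ascent_form s y = B.ascent_form s y"
            unfolding A.ascent_form_def B.ascent_form_def A.cmu_def B.cmu_def A.below_def B.below_def
            by (auto intro!: sum.cong)
          then show ?thesis using yI s by (simp add: A.T_unit B.T_unit)
        qed
        then show ?thesis
          unfolding A.T_expansion[OF s(1) fin A.keys_\<beta>[OF v]] B.T_expansion[OF s(1) fin A.keys_\<beta>[OF v]]
          by (intro sum.cong) auto
      qed
      ultimately show ?thesis by simp
    qed
  qed
  show "w \<in> I \<Longrightarrow> \<beta> w = \<beta>' w" by (rule \<beta>)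
  show "p y w = p' y w" if "w \<in> I" "y \<in> I" "bruhat_less W S y w"
    using p \<beta> that unfolding A.below_def by auto
qed

section \<open>Coordinates of a module with a W-graph basis\<close>

locale hecke_module = ideal_in_coxeter W S J I
  for W :: "'w monoid" (structure) and S J I +
  fixes M :: "('w hecke_elt, 'm) module" and c :: "'w \<Rightarrow> 'm"
  assumes left_module: "left_module (hecke W S) M"
    and basis: "is_basis W S M I c"
begin

sublocale mod: left_module "hecke W S" M
  by (rule left_module)

abbreviation "sc \<equiv> scal W S M"
abbreviation "ta \<equiv> T_act W S M"

section \<open>Scalars and sums in a Hecke module\<close>

lemma scal_closed [simp]: "x \<in> carrier M \<Longrightarrow> sc a x \<in> carrier M"
  unfolding scal_def by (rule mod.smult_closed[OF hecke_const_simps(4)])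

lemma T_act_closed [simp]: "s \<in> S \<Longrightarrow> x \<in> carrier M \<Longrightarrow> ta s x \<in> carrier M"
  unfolding T_act_def by (rule mod.smult_closed[OF hecke_T_closed])

lemma scal_l: "x \<in> carrier M \<Longrightarrow> sc (a + b) x = sc a x \<oplus>\<^bsub>M\<^esub> sc b x"
  unfolding scal_def hecke_const_simps(1) by (rule mod.smult_l_distr[OF hecke_const_simps(4) hecke_const_simps(4)])

lemma scal_mult: "x \<in> carrier M \<Longrightarrow> sc (a * b) x = sc a (sc b x)"
  unfolding scal_def hecke_const_simps(2) by (rule mod.smult_assoc[OF hecke_const_simps(4) hecke_const_simps(4)])

lemma scal_one: "x \<in> carrier M \<Longrightarrow> sc 1 x = x"
  unfolding scal_def hecke_const_simps(3) by (rule mod.smult_one)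

lemma scal_zero: "x \<in> carrier M \<Longrightarrow> sc 0 x = \<zero>\<^bsub>M\<^esub>"
  using scal_l[of x 0 0] mod.M.add.r_cancel_one'[of "sc 0 x" "sc 0 x"] by simp

lemma smult_zero: "h \<in> carrier (hecke W S) \<Longrightarrow> h \<odot>\<^bsub>M\<^esub> \<zero>\<^bsub>M\<^esub> = \<zero>\<^bsub>M\<^esub>"
  using mod.smult_r_distr[of h "\<zero>\<^bsub>M\<^esub>" "\<zero>\<^bsub>M\<^esub>"] mod.smult_closed[of h "\<zero>\<^bsub>M\<^esub>"]
    mod.M.add.r_cancel_one'[of "h \<odot>\<^bsub>M\<^esub> \<zero>\<^bsub>M\<^esub>" "h \<odot>\<^bsub>M\<^esub> \<zero>\<^bsub>M\<^esub>"] by simp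

text \<open>Scalars act through the centre of the Hecke algebra.\<close>

lemma smult_scal:
  assumes "h \<in> carrier (hecke W S)" "x \<in> carrier M"
  shows "h \<odot>\<^bsub>M\<^esub> sc a x = sc a (h \<odot>\<^bsub>M\<^esub> x)"
  unfolding scal_def
  using mod.smult_assoc[OF assms(1) hecke_const_simps(4) assms(2), of a]
    mod.smult_assoc[OF hecke_const_simps(4) assms(1,2), of a]
    hecke_const_central[OF assms(1), of a] by simp

lemma smult_finsum:
  assumes "h \<in> carrier (hecke W S)" "finite A" "g \<in> A \<rightarrow> carrier M"
  shows "h \<odot>\<^bsub>M\<^esub> finsum M g A = finsum M (\<lambda>i. h \<odot>\<^bsub>M\<^esub> g i) A"
  using assms(2,3)
proof (induction A rule: finite_induct)
  case empty
  then show ?case using assms(1) by (simp add: smult_zero)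
next
  case (insert i A)
  then have g: "g i \<in> carrier M" "g \<in> A \<rightarrow> carrier M" by auto
  then have hg: "h \<odot>\<^bsub>M\<^esub> g i \<in> carrier M" "(\<lambda>i. h \<odot>\<^bsub>M\<^esub> g i) \<in> A \<rightarrow> carrier M"
    using mod.smult_closed[OF assms(1)] by auto
  have "finsum M g (insert i A) = g i \<oplus>\<^bsub>M\<^esub> finsum M g A"
    using insert g by (intro mod.M.finsum_insert) auto
  moreover have "finsum M (\<lambda>i. h \<odot>\<^bsub>M\<^esub> g i) (insert i A) =
      h \<odot>\<^bsub>M\<^esub> g i \<oplus>\<^bsub>M\<^esub> finsum M (\<lambda>i. h \<odot>\<^bsub>M\<^esub> g i) A"
    using insert hg by (intro mod.M.finsum_insert) auto
  ultimately show ?case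
    using insert.IH g mod.smult_r_distr[OF assms(1) g(1) mod.M.finsum_closed[OF g(2)]] by simp
qed

section \<open>Coordinates with respect to a basis\<close>

lemma basis_closed [simp]: "w \<in> I \<Longrightarrow> c w \<in> carrier M"
  using basis unfolding is_basis_def by blast

text \<open>Coefficients outside \<open>I\<close> are ignored. This makes \<open>lin\<close> linear
  on the whole type, so that the transported action is linear without support conditions, as
  \<open>wgraph_coords\<close> requires.\<close>

definition lin :: "('w \<Rightarrow>\<^sub>0 laurent) \<Rightarrow> 'm" where
  "lin f = finsum M (\<lambda>w. sc (Poly_Mapping.lookup f w) (c w)) (Poly_Mapping.keys f \<inter> I)"

lemma lin_superset:
  assumes "finite A" "Poly_Mapping.keys f \<inter> I \<subseteq> A" "A \<subseteq> I"
  shows "lin f = finsum M (\<lambda>w. sc (Poly_Mapping.lookup f w) (c w)) A"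
  unfolding lin_def
  by (rule mod.M.add.finprod_mono_neutral_cong_left)
    (use assms scal_zero in \<open>auto simp: in_keys_iff\<close>)

lemma lin_closed [simp]: "lin f \<in> carrier M"
  unfolding lin_def by (rule mod.M.finsum_closed) auto

lemma lin_add: "lin (f + g) = lin f \<oplus>\<^bsub>M\<^esub> lin g"
proof -
  let ?A = "(Poly_Mapping.keys f \<union> Poly_Mapping.keys g) \<inter> I"
  have A: "finite ?A" "?A \<subseteq> I" by auto
  have "lin (f + g) = finsum M (\<lambda>w. sc (Poly_Mapping.lookup f w) (c w) \<oplus>\<^bsub>M\<^esub> sc (Poly_Mapping.lookup g w) (c w)) ?A"
    using keys_add[of f g] unfolding lin_superset[OF A(1) _ A(2), of "f + g", OF Int_mono[OF keys_add order.refl]]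
    by (intro mod.M.finsum_cong') (auto simp: lookup_add scal_l)
  also have "\<dots> = finsum M (\<lambda>w. sc (Poly_Mapping.lookup f w) (c w)) ?A \<oplus>\<^bsub>M\<^esub> finsum M (\<lambda>w. sc (Poly_Mapping.lookup g w) (c w)) ?A"
    by (rule mod.M.finsum_addf) auto
  also have "\<dots> = lin f \<oplus>\<^bsub>M\<^esub> lin g"
    using A by (subst (1 2) lin_superset[of ?A]) auto
  finally show ?thesis .
qed

lemma lin_scale: "lin (vscale a f) = sc a (lin f)"
proof -
  let ?A = "Poly_Mapping.keys f \<inter> I"
  have "Poly_Mapping.keys (vscale a f) \<subseteq> Poly_Mapping.keys f" by (auto simp: in_keys_iff)
  then have "lin (vscale a f) = finsum M (\<lambda>w. sc (Poly_Mapping.lookup (vscale a f) w) (c w)) ?A"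
    by (intro lin_superset) auto
  also have "\<dots> = finsum M (\<lambda>w. sc a (sc (Poly_Mapping.lookup f w) (c w))) ?A"
    by (rule mod.M.finsum_cong') (auto simp: scal_mult)
  also have "\<dots> = sc a (lin f)"
    unfolding lin_def scal_def by (rule smult_finsum[symmetric])
      (auto simp: hecke_const_simps(4) scal_def[symmetric])
  finally show ?thesis .
qed

lemma lin_unit: "w \<in> I \<Longrightarrow> lin (vunit w) = c w"
  by (subst lin_superset[of "{w}"]) (auto simp: vunit_def scal_one)

definition coords :: "'m \<Rightarrow> ('w \<Rightarrow>\<^sub>0 laurent)" where
  "coords x = (THE f. Poly_Mapping.keys f \<subseteq> I \<and> x = lin f)"

lemma coords_unique: "x \<in> carrier M \<Longrightarrow> \<exists>!f. Poly_Mapping.keys f \<subseteq> I \<and> x = lin f"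
proof -
  assume "x \<in> carrier M"
  then have ex: "\<exists>!f. Poly_Mapping.keys f \<subseteq> I \<and>
      x = finsum M (\<lambda>w. sc (Poly_Mapping.lookup f w) (c w)) (Poly_Mapping.keys f)"
    using basis unfolding is_basis_def by blast
  have "(Poly_Mapping.keys f \<subseteq> I \<and> x = finsum M (\<lambda>w. sc (Poly_Mapping.lookup f w) (c w)) (Poly_Mapping.keys f))
      = (Poly_Mapping.keys f \<subseteq> I \<and> x = lin f)" for f
    unfolding lin_def by (auto simp: Int_absorb2)
  with ex show ?thesis by simp
qed

lemma lin_coords: "x \<in> carrier M \<Longrightarrow> lin (coords x) = x"
  and keys_coords: "x \<in> carrier M \<Longrightarrow> Poly_Mapping.keys (coords x) \<subseteq> I"
  using theI'[OF coords_unique, of x] unfolding coords_def by auto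

lemma coords_lin: "Poly_Mapping.keys f \<subseteq> I \<Longrightarrow> coords (lin f) = f"
  using coords_unique[OF lin_closed, of f] keys_coords[OF lin_closed, of f] lin_coords[OF lin_closed, of f]
  by metis

lemma coords_eqI: "Poly_Mapping.keys f \<subseteq> I \<Longrightarrow> lin f = x \<Longrightarrow> coords x = f"
  using coords_lin by blast

lemma coords_add:
  assumes "x \<in> carrier M" "y \<in> carrier M" shows "coords (x \<oplus>\<^bsub>M\<^esub> y) = coords x + coords y"
  using assms keys_add[of "coords x" "coords y"] keys_coords
  by (intro coords_eqI) (auto simp: lin_add lin_coords)

lemma coords_scale:
  assumes "x \<in> carrier M" shows "coords (sc a x) = vscale a (coords x)"
  using assms keys_coords[OF assms]
  by (intro coords_eqI) (auto simp: lin_scale lin_coords in_keys_iff)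

lemma coords_unit: "w \<in> I \<Longrightarrow> coords (c w) = vunit w"
  by (intro coords_eqI lin_unit) (auto simp: vunit_def)

lemma lin_zero: "lin 0 = \<zero>\<^bsub>M\<^esub>"
  by (simp add: lin_def)

lemma coords_zero: "coords \<zero>\<^bsub>M\<^esub> = 0"
  by (intro coords_eqI lin_zero) auto

lemma coords_minus:
  assumes "x \<in> carrier M" "y \<in> carrier M" shows "coords (x \<ominus>\<^bsub>M\<^esub> y) = coords x - coords y"
proof -
  have "x = (x \<ominus>\<^bsub>M\<^esub> y) \<oplus>\<^bsub>M\<^esub> y" using assms by (simp add: a_minus_def mod.M.a_assoc mod.M.l_neg)
  then have "coords x = coords (x \<ominus>\<^bsub>M\<^esub> y) + coords y"
    using assms coords_add[of "x \<ominus>\<^bsub>M\<^esub> y" y] by (metis mod.M.minus_closed)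
  then show ?thesis by simp
qed

lemma coords_finsum:
  assumes "finite A" "g \<in> A \<rightarrow> carrier M"
  shows "coords (finsum M g A) = (\<Sum>i \<in> A. coords (g i))"
  using assms
proof (induction A rule: finite_induct)
  case empty
  then show ?case by (simp add: coords_zero)
next
  case (insert i A)
  then have "finsum M g (insert i A) = g i \<oplus>\<^bsub>M\<^esub> finsum M g A"
    by (intro mod.M.finsum_insert) auto
  moreover have "finsum M g A \<in> carrier M" using insert by (intro mod.M.finsum_closed) auto
  ultimately show ?case using insert by (simp add: coords_add)
qed

text \<open>The module structure carried over to coordinates. A vector first loses its part outside
  \<open>I\<close>, hence the support conditions in \<open>act_one\<close> and
  \<open>act_const\<close>.\<close>

definition act :: "'w hecke_elt \<Rightarrow> ('w \<Rightarrow>\<^sub>0 laurent) \<Rightarrow> ('w \<Rightarrow>\<^sub>0 laurent)" where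
  "act h f = coords (h \<odot>\<^bsub>M\<^esub> lin f)"

lemma act_keys: "h \<in> carrier (hecke W S) \<Longrightarrow> Poly_Mapping.keys (act h f) \<subseteq> I"
  unfolding act_def by (intro keys_coords mod.smult_closed) auto

lemma act_add: "h \<in> carrier (hecke W S) \<Longrightarrow> act h (f + g) = act h f + act h g"
  unfolding act_def by (simp add: lin_add mod.smult_r_distr coords_add mod.smult_closed)

lemma act_scale: "h \<in> carrier (hecke W S) \<Longrightarrow> act h (vscale a f) = vscale a (act h f)"
  unfolding act_def by (simp add: lin_scale smult_scal coords_scale mod.smult_closed)

lemma act_minus: "h \<in> carrier (hecke W S) \<Longrightarrow> act h (f - g) = act h f - act h g"
  using act_add[of h "f - g" g] by simp

lemma act_l: "h \<in> carrier (hecke W S) \<Longrightarrow> k \<in> carrier (hecke W S) \<Longrightarrow> act (h \<oplus>\<^bsub>hecke W S\<^esub> k) f = act h f + act k f"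
  unfolding act_def by (simp add: mod.smult_l_distr coords_add mod.smult_closed)

lemma act_mult: "h \<in> carrier (hecke W S) \<Longrightarrow> k \<in> carrier (hecke W S) \<Longrightarrow> act (h \<otimes>\<^bsub>hecke W S\<^esub> k) f = act h (act k f)"
  unfolding act_def by (simp add: mod.smult_assoc lin_coords mod.smult_closed)

lemma act_one: "Poly_Mapping.keys f \<subseteq> I \<Longrightarrow> act \<one>\<^bsub>hecke W S\<^esub> f = f"
  unfolding act_def by (simp add: mod.smult_one coords_lin)

lemma act_const: "Poly_Mapping.keys f \<subseteq> I \<Longrightarrow> act (hecke_const W S a) f = vscale a f"
  unfolding act_def scal_def[symmetric] by (simp add: coords_scale coords_lin)

lemma coords_smult: "x \<in> carrier M \<Longrightarrow> coords (h \<odot>\<^bsub>M\<^esub> x) = act h (coords x)"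
  unfolding act_def by (simp add: lin_coords)

end

text \<open>The element type stays open: instances are the given module, the quotient, and an
  arbitrary module competing with the quotient.\<close>

locale wgraph_module = hecke_module W S J I M c
  for W :: "'w monoid" (structure) and S J I and M :: "('w hecke_elt, 'm) module" and c +
  fixes b :: "'w \<Rightarrow> 'm" and bar :: "'m \<Rightarrow> 'm" and p :: "'w \<Rightarrow> 'w \<Rightarrow> laurent"
  assumes ideal_module: "ideal_module W S J I M b bar"
    and W_graph_basis: "W_graph_basis W S I M b bar c p"
begin

lemma b_closed [simp]: "w \<in> I \<Longrightarrow> b w \<in> carrier M"
  using ideal_module unfolding ideal_module_def is_basis_def by blast

lemma bar_closed [simp]: "x \<in> carrier M \<Longrightarrow> bar x \<in> carrier M"
  and bar_add: "x \<in> carrier M \<Longrightarrow> y \<in> carrier M \<Longrightarrow> bar (x \<oplus>\<^bsub>M\<^esub> y) = bar x \<oplus>\<^bsub>M\<^esub> bar y"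
  and bar_scal: "x \<in> carrier M \<Longrightarrow> bar (sc a x) = sc (laurent_bar a) (bar x)"
  and bar_smult: "h \<in> carrier (hecke W S) \<Longrightarrow> x \<in> carrier M \<Longrightarrow> bar (h \<odot>\<^bsub>M\<^esub> x) = hecke_bar W S h \<odot>\<^bsub>M\<^esub> bar x"
  using ideal_module unfolding ideal_module_def module_involution_def by blast+

lemma bar_basis: "w \<in> I \<Longrightarrow> bar (c w) = c w"
  using W_graph_basis unfolding W_graph_basis_def by blast

lemma bar_lin: "Poly_Mapping.keys f \<subseteq> I \<Longrightarrow> bar (lin f) = lin (vbar f)"
proof (induction f rule: poly_mapping_single_induct)
  case zero
  \<comment> \<open>Semilinearity with the scalar 0 shows that bar fixes zero.\<close>
  have "bar \<zero>\<^bsub>M\<^esub> = sc (laurent_bar 0) (bar \<zero>\<^bsub>M\<^esub>)" using bar_scal[of "\<zero>\<^bsub>M\<^esub>" 0] by (simp add: scal_zero)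
  then show ?case by (simp add: lin_zero scal_zero vbar_simps)
next
  case (single w a)
  have "Poly_Mapping.single w a = vscale a (vunit w)"
    by (rule poly_mapping_eqI) (simp add: lookup_vunit lookup_single when_def)
  then show ?case using single by (simp add: lin_scale lin_unit bar_scal bar_basis vbar_simps)
next
  case (add f g)
  then show ?case by (simp add: lin_add bar_add vbar_simps)
qed

lemma keys_vbar: "Poly_Mapping.keys (vbar f) = Poly_Mapping.keys f"
proof -
  have "laurent_bar a = 0 \<longleftrightarrow> a = 0" for a by (metis laurent_bar_bar laurent_bar_zero)
  then show ?thesis unfolding set_eq_iff in_keys_iff lookup_vbar by blast
qed

lemma coords_bar: "x \<in> carrier M \<Longrightarrow> coords (bar x) = vbar (coords x)"
  using bar_lin[OF keys_coords, of x] keys_coords[of x]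
  by (intro coords_eqI) (auto simp: keys_vbar lin_coords)

lemma vbar_act:
  assumes "h \<in> carrier (hecke W S)" "Poly_Mapping.keys f \<subseteq> I"
  shows "vbar (act h f) = act (hecke_bar W S h) (vbar f)"
  using assms unfolding act_def
  by (simp add: coords_bar[symmetric] mod.smult_closed bar_smult bar_lin)

abbreviation CT where "CT s \<equiv> act (hecke_T W S s)"
definition \<beta> where "\<beta> w = coords (b w)"

lemma CT_coords: "s \<in> S \<Longrightarrow> x \<in> carrier M \<Longrightarrow> CT s (coords x) = coords (ta s x)"
  unfolding T_act_def by (simp add: coords_smult)

lemma \<beta>_expand:
  assumes "w \<in> I"
  shows "\<beta> w = vunit w + vscale lq (\<Sum>y \<in> {y \<in> I. bruhat_less W S y w}. vscale (p y w) (vunit y))"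
proof -
  have fin: "finite {y \<in> I. bruhat_less W S y w}" using finite_less I_carrier[OF assms] by auto
  have "b w = c w \<oplus>\<^bsub>M\<^esub> sc lq (finsum M (\<lambda>y. sc (p y w) (c y)) {y \<in> I. bruhat_less W S y w})"
    using W_graph_basis assms unfolding W_graph_basis_def by blast
  moreover have "finsum M (\<lambda>y. sc (p y w) (c y)) {y \<in> I. bruhat_less W S y w} \<in> carrier M"
    by (rule mod.M.finsum_closed) auto
  ultimately have "\<beta> w = coords (c w) + vscale lq (coords (finsum M (\<lambda>y. sc (p y w) (c y)) {y \<in> I. bruhat_less W S y w}))"
    unfolding \<beta>_def using assms by (simp add: coords_add coords_scale)
  also have "coords (finsum M (\<lambda>y. sc (p y w) (c y)) {y \<in> I. bruhat_less W S y w}) =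
      (\<Sum>y \<in> {y \<in> I. bruhat_less W S y w}. coords (sc (p y w) (c y)))"
    by (rule coords_finsum[OF fin]) auto
  also have "\<dots> = (\<Sum>y \<in> {y \<in> I. bruhat_less W S y w}. vscale (p y w) (vunit y))"
    by (rule sum.cong) (auto simp: coords_scale coords_unit)
  finally show ?thesis using assms by (simp add: coords_unit)
qed

lemma T_action:
  assumes "w \<in> I"
  shows "s \<in> SA W S I w \<Longrightarrow> ta s (b w) = b (s \<otimes> w)"
    "s \<in> SD W S w \<Longrightarrow> ta s (b w) = b (s \<otimes> w) \<oplus>\<^bsub>M\<^esub> sc hecke_zeta (b w)"
    "s \<in> WD W S J w \<Longrightarrow> ta s (b w) = sc (- lq_inv) (b w)"
    "s \<in> WA W S J I w \<Longrightarrow> \<exists>r :: 'w \<Rightarrow> laurent. (\<forall>y. r y \<in> (*) lq ` laurent_pos) \<and>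
        ta s (b w) = sc lq (b w) \<ominus>\<^bsub>M\<^esub> finsum M (\<lambda>y. sc (r y) (b y)) {y \<in> I. bruhat_less W S y (s \<otimes> w)}"
  using ideal_module assms unfolding ideal_module_def hecke_action_def by blast+

sublocale coord: wgraph_coords W S J I p CT \<beta>
proof
  show "CT s (f + g) = CT s f + CT s g" if "s \<in> S" for s f g by (rule act_add[OF hecke_T_closed[OF that]])
  show "CT s (vscale a f) = vscale a (CT s f)" if "s \<in> S" for s a f by (rule act_scale[OF hecke_T_closed[OF that]])
  show "CT s (CT s f) = f + vscale hecke_zeta (CT s f)" if s: "s \<in> S" and f: "Poly_Mapping.keys f \<subseteq> I" for s f
  proof -
    note T = hecke_T_closed[OF s, of W]
    have "CT s (CT s f) = act (hecke_T W S s \<otimes>\<^bsub>hecke W S\<^esub> hecke_T W S s) f"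
      by (rule act_mult[OF T T, symmetric])
    also have "\<dots> = act \<one>\<^bsub>hecke W S\<^esub> f + act (hecke_const W S hecke_zeta \<otimes>\<^bsub>hecke W S\<^esub> hecke_T W S s) f"
      unfolding hecke_T_square[OF s]
      by (rule act_l[OF mod.R.one_closed mod.R.m_closed[OF hecke_const_simps(4) T]])
    also have "act (hecke_const W S hecke_zeta \<otimes>\<^bsub>hecke W S\<^esub> hecke_T W S s) f = vscale hecke_zeta (CT s f)"
      unfolding act_mult[OF hecke_const_simps(4) T] by (rule act_const[OF act_keys[OF T]])
    finally show ?thesis by (simp add: act_one[OF f])
  qed
  show "vbar (CT s f) = CT s (vbar f) - vscale hecke_zeta (vbar f)" if s: "s \<in> S" and f: "Poly_Mapping.keys f \<subseteq> I" for s f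
  proof -
    note T = hecke_T_closed[OF s, of W] and T' = hecke_T'_closed[OF s, of W]
    have k: "Poly_Mapping.keys (vbar f) \<subseteq> I" using f unfolding keys_vbar[of f] .
    have gen: "free_monom [s] - free_const hecke_zeta \<in> carrier (free_algebra S)" using s by (intro free_algebra_closed) auto
    \<comment> \<open>Bar turns T_s into \<open>hecke_T'\<close>; writing the latter as T_s minus a
      scalar gives the subtraction in \<open>T_bar\<close>.\<close>
    have "hecke_T W S s = hecke_T' W S s \<oplus>\<^bsub>hecke W S\<^esub> hecke_const W S hecke_zeta"
      unfolding hecke_T_class hecke_T'_def hecke_const_class
      by (subst hecke_class_simps(1)[OF gen free_algebra_const, symmetric]) simp
    then have "CT s (vbar f) = act (hecke_T' W S s) (vbar f) + vscale hecke_zeta (vbar f)"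
      by (simp only: act_l[OF T' hecke_const_simps(4)] act_const[OF k])
    then show ?thesis by (simp add: vbar_act[OF T f] hecke_bar_T[OF s])
  qed
  show "p y w \<in> laurent_pos" if "w \<in> I" "y \<in> I" "bruhat_less W S y w" for w y
    using W_graph_basis that unfolding W_graph_basis_def by blast
  show "CT s (\<beta> w) = \<beta> (s \<otimes> w)" if "w \<in> I" "s \<in> SA W S I w" for w s
    using that T_action(1)[OF that] unfolding SA_def \<beta>_def by (simp add: CT_coords)
  show "CT s (\<beta> w) = vscale (- lq_inv) (\<beta> w)" if "w \<in> I" "s \<in> WD W S J w" for w s
    using that T_action(3)[OF that] unfolding WD_def \<beta>_def by (simp add: CT_coords coords_scale)
  show "\<exists>r :: 'w \<Rightarrow> laurent. (\<forall>y. r y \<in> (*) lq ` laurent_pos) \<and>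
      CT s (\<beta> w) = vscale lq (\<beta> w) - (\<Sum>y \<in> {y \<in> I. bruhat_less W S y (s \<otimes> w)}. vscale (r y) (\<beta> y))"
    if w: "w \<in> I" "s \<in> WA W S J I w" for w s
  proof -
    let ?B = "{y \<in> I. bruhat_less W S y (s \<otimes> w)}"
    obtain r where r: "\<forall>y. r y \<in> (*) lq ` laurent_pos"
      "ta s (b w) = sc lq (b w) \<ominus>\<^bsub>M\<^esub> finsum M (\<lambda>y. sc (r y) (b y)) ?B"
      using T_action(4)[OF w] by blast
    have s: "s \<in> S" "s \<otimes> w \<in> carrier W" using w I_carrier unfolding WA_def by auto
    \<comment> \<open>Over an infinite set the \<open>finsum\<close> would be zero by convention and
      could not be taken coordinatewise.\<close>
    have fin: "finite ?B" using finite_less s by blast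
    have "CT s (\<beta> w) = coords (ta s (b w))" unfolding \<beta>_def using s w by (simp add: CT_coords)
    also have "\<dots> = vscale lq (\<beta> w) - coords (finsum M (\<lambda>y. sc (r y) (b y)) ?B)"
      unfolding r(2) \<beta>_def using w by (subst coords_minus) (auto intro!: mod.M.finsum_closed simp: coords_scale)
    also have "coords (finsum M (\<lambda>y. sc (r y) (b y)) ?B) = (\<Sum>y \<in> ?B. coords (sc (r y) (b y)))"
      by (rule coords_finsum[OF fin]) auto
    also have "\<dots> = (\<Sum>y \<in> ?B. vscale (r y) (\<beta> y))"
      by (rule sum.cong) (auto simp: coords_scale \<beta>_def)
    finally show ?thesis using r(1) by blast
  qed
qed (rule \<beta>_expand)

end

section \<open>The quotient supported on the maximal cell\<close>

lemma vpos_uminus: "f \<in> vpos \<Longrightarrow> - f \<in> vpos"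
  by (simp add: vpos_def laurent_pos_uminus)

lemma vpos_diff: "f \<in> vpos \<Longrightarrow> g \<in> vpos \<Longrightarrow> f - g \<in> vpos"
  using vpos_add[OF _ vpos_uminus, of f g] by simp

lemma keys_sum_subset:
  assumes "\<And>i. i \<in> A \<Longrightarrow> Poly_Mapping.keys (f i) \<subseteq> B" shows "Poly_Mapping.keys (sum f A) \<subseteq> B"
  using assms
proof (induction A rule: infinite_finite_induct)
  case (insert x F)
  then show ?case using keys_add[of "f x" "sum f F"] by auto
qed auto

lemma keys_vscale: "Poly_Mapping.keys (vscale a f) \<subseteq> Poly_Mapping.keys f"
  by (auto simp: in_keys_iff)

lemma keys_vscale_sum:
  assumes "\<And>i. i \<in> A \<Longrightarrow> Poly_Mapping.keys (f i) \<subseteq> B"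
  shows "Poly_Mapping.keys (\<Sum>i \<in> A. vscale (a i) (f i)) \<subseteq> B"
proof (rule keys_sum_subset)
  fix i assume "i \<in> A"
  then show "Poly_Mapping.keys (vscale (a i) (f i)) \<subseteq> B" by (rule subset_trans[OF keys_vscale assms])
qed

lemma keys_minus_subset: "Poly_Mapping.keys (f - g) \<subseteq> Poly_Mapping.keys f \<union> Poly_Mapping.keys (g :: 'a \<Rightarrow>\<^sub>0 'b :: ab_group_add)"
  by (auto simp: in_keys_iff lookup_minus)

definition lincomb :: "('x \<Rightarrow> ('y \<Rightarrow>\<^sub>0 laurent)) \<Rightarrow> ('x \<Rightarrow>\<^sub>0 laurent) \<Rightarrow> ('y \<Rightarrow>\<^sub>0 laurent)" where
  "lincomb e f = (\<Sum>w \<in> Poly_Mapping.keys f. vscale (Poly_Mapping.lookup f w) (e w))"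

lemma lincomb_superset:
  assumes "finite A" "Poly_Mapping.keys f \<subseteq> A"
  shows "lincomb e f = (\<Sum>w \<in> A. vscale (Poly_Mapping.lookup f w) (e w))"
  unfolding lincomb_def using assms by (intro sum.mono_neutral_left) (auto simp: in_keys_iff)

lemma lincomb_add: "lincomb e (f + g) = lincomb e f + lincomb e g"
proof -
  let ?A = "Poly_Mapping.keys f \<union> Poly_Mapping.keys g"
  have "Poly_Mapping.keys (f + g) \<subseteq> ?A" by (rule keys_add)
  then show ?thesis
    by (simp add: lincomb_superset[of ?A] lookup_add vscale_simps sum.distrib)
qed

lemma lincomb_scale: "lincomb e (vscale a f) = vscale a (lincomb e f)"
  using lincomb_superset[OF finite_keys keys_vscale, of e a f] by (simp add: lincomb_def vscale_sum)

lemma lincomb_zero: "lincomb e 0 = 0"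
  by (simp add: lincomb_def)

lemma lincomb_minus: "lincomb e (f - g) = lincomb e f - lincomb e g"
  using lincomb_add[of e "f - g" g] by simp

lemma lincomb_sum: "lincomb e (\<Sum>i \<in> A. f i) = (\<Sum>i \<in> A. lincomb e (f i))"
  by (induction A rule: infinite_finite_induct) (auto simp: lincomb_zero lincomb_add)

lemma lincomb_unit: "lincomb e (vunit w) = e w"
  by (simp add: lincomb_def vunit_def)

lemma lincomb_vunit: "lincomb vunit f = f"
  unfolding lincomb_def by (rule vunit_expansion[symmetric]) auto

context wgraph_module
begin

abbreviation X where "X \<equiv> coord.I1"

text \<open>The projection along the span of the c_w with \<open>w\<close> outside \<open>X\<close>.
  Each coset of that span contains exactly one vector supported on \<open>X\<close>, so these
  vectors model the quotient.\<close>

definition restr :: "('w \<Rightarrow>\<^sub>0 laurent) \<Rightarrow> ('w \<Rightarrow>\<^sub>0 laurent)" where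
  "restr f = Poly_Mapping.mapp (\<lambda>w a. a when w \<in> X) f"

lemma lookup_restr: "Poly_Mapping.lookup (restr f) w = (if w \<in> X then Poly_Mapping.lookup f w else 0)"
  unfolding restr_def lookup_mapp by (simp add: when_def in_keys_iff)

lemma keys_restr: "Poly_Mapping.keys (restr f) = Poly_Mapping.keys f \<inter> X"
  unfolding set_eq_iff Int_iff in_keys_iff lookup_restr by simp

lemma restr_id: "Poly_Mapping.keys f \<subseteq> X \<Longrightarrow> restr f = f"
  by (rule poly_mapping_eqI) (auto simp: lookup_restr in_keys_iff)

lemma restr_simps:
  "restr (f + g) = restr f + restr g" "restr (f - g) = restr f - restr g"
  "restr (vscale a f) = vscale a (restr f)" "restr (vbar f) = vbar (restr f)" "restr 0 = 0"
  by (rule poly_mapping_eqI, simp add: lookup_restr lookup_add lookup_minus)+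

lemma restr_sum: "restr (\<Sum>i \<in> A. f i) = (\<Sum>i \<in> A. restr (f i))"
  by (induction A rule: infinite_finite_induct) (auto simp: restr_simps)

lemma restr_unit: "restr (vunit w) = (if w \<in> X then vunit w else 0)"
  by (rule poly_mapping_eqI) (auto simp: lookup_restr lookup_vunit)

lemma restr_pos: "f \<in> vpos \<Longrightarrow> restr f \<in> vpos"
  by (simp add: vpos_def lookup_restr laurent_pos_zero)

lemma X_subset: "X \<subseteq> I"
  by (rule coord.I1_subset)

text \<open>The span of the \<open>c\<^sub>w\<close> with \<open>w\<close> outside the cell of the identity is a submodule, because
  \<open>I - X\<close> is closed under the cell preorder.\<close>

lemma act_kernel:
  assumes "h \<in> carrier (hecke W S)" "Poly_Mapping.keys f \<subseteq> I - X"
  shows "Poly_Mapping.keys (act h f) \<subseteq> I - X"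
  using assms
proof (induction h arbitrary: f rule: hecke_induct)
  case (const a)
  then have "Poly_Mapping.keys f \<subseteq> I" by blast
  then show ?case using const keys_vscale[of a f] by (simp add: act_const)
next
  case (gen s)
  then show ?case by (rule coord.T_kernel)
next
  case (add x y)
  then show ?case using keys_add[of "act x f" "act y f"] by (simp add: act_l) blast
next
  case (mult x y)
  then show ?case by (simp add: act_mult)
qed

text \<open>Well-definedness of the quotient action: replacing a vector by its projection changes it
  by an element of the submodule.\<close>

lemma restr_act:
  assumes "h \<in> carrier (hecke W S)" "Poly_Mapping.keys f \<subseteq> I"
  shows "restr (act h (restr f)) = restr (act h f)"
proof -
  have "Poly_Mapping.keys (f - restr f) \<subseteq> I - X"
    using assms(2) by (auto simp: in_keys_iff lookup_minus lookup_restr split: if_splits)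
  then have "Poly_Mapping.keys (act h (f - restr f)) \<subseteq> I - X" by (rule act_kernel[OF assms(1)])
  then have "Poly_Mapping.keys (restr (act h (f - restr f))) = {}" unfolding keys_restr by blast
  then have "restr (act h (f - restr f)) = 0"
    by (intro poly_mapping_eqI) (metis empty_iff in_keys_iff lookup_zero)
  then show ?thesis by (simp add: act_minus[OF assms(1)] restr_simps)
qed

text \<open>The record type of modules extends that of rings, hence the dummy product and unit.
  Scalars act on the representative, and the result is projected back. The element type is the one
  fixed in \<open>W_graph_ideal\<close> and \<open>corresponding_W_graph\<close>.\<close>

definition quot :: "('w hecke_elt, 'w \<Rightarrow>\<^sub>0 laurent) module" where
  "quot = \<lparr>carrier = {f. Poly_Mapping.keys f \<subseteq> X}, monoid.mult = (\<lambda>_ _. 0), one = 0, ring.zero = 0,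
     add = (+), smult = (\<lambda>h f. restr (act h f))\<rparr>"

lemma quot_simps [simp]:
  "f \<in> carrier quot \<longleftrightarrow> Poly_Mapping.keys f \<subseteq> X" "f \<oplus>\<^bsub>quot\<^esub> g = f + g" "\<zero>\<^bsub>quot\<^esub> = 0"
  "h \<odot>\<^bsub>quot\<^esub> f = restr (act h f)"
  by (simp_all add: quot_def)

lemma abelian_group_quot: "abelian_group quot"
proof (rule abelian_groupI)
  fix f g assume "f \<in> carrier quot" "g \<in> carrier quot"
  then show "f \<oplus>\<^bsub>quot\<^esub> g \<in> carrier quot" using keys_add[of f g] by auto
next
  fix f assume "f \<in> carrier quot"
  then show "\<exists>g \<in> carrier quot. g \<oplus>\<^bsub>quot\<^esub> f = \<zero>\<^bsub>quot\<^esub>"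
    by (intro bexI[of _ "- f"]) (auto simp: keys_uminus)
qed (auto simp: add_ac)

lemma left_module_quot: "left_module (hecke W S) quot"
proof (intro left_module.intro left_module_axioms.intro ring_hecke abelian_group_quot)
  fix a b f g assume a: "a \<in> carrier (hecke W S)" and b: "b \<in> carrier (hecke W S)"
    and f: "f \<in> carrier quot" and g: "g \<in> carrier quot"
  show "(a \<oplus>\<^bsub>hecke W S\<^esub> b) \<odot>\<^bsub>quot\<^esub> f = a \<odot>\<^bsub>quot\<^esub> f \<oplus>\<^bsub>quot\<^esub> b \<odot>\<^bsub>quot\<^esub> f"
    using a b by (simp add: act_l restr_simps)
  show "a \<odot>\<^bsub>quot\<^esub> (f \<oplus>\<^bsub>quot\<^esub> g) = a \<odot>\<^bsub>quot\<^esub> f \<oplus>\<^bsub>quot\<^esub> a \<odot>\<^bsub>quot\<^esub> g"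
    using a by (simp add: act_add restr_simps)
  show "(a \<otimes>\<^bsub>hecke W S\<^esub> b) \<odot>\<^bsub>quot\<^esub> f = a \<odot>\<^bsub>quot\<^esub> (b \<odot>\<^bsub>quot\<^esub> f)"
    using a b by (simp add: act_mult restr_act act_keys)
next
  fix f assume "f \<in> carrier quot"
  then show "\<one>\<^bsub>hecke W S\<^esub> \<odot>\<^bsub>quot\<^esub> f = f"
    using X_subset by (simp add: act_one restr_id)
qed (simp add: keys_restr)

lemma scal_quot: "Poly_Mapping.keys f \<subseteq> X \<Longrightarrow> scal W S quot a f = vscale a f"
  using X_subset unfolding scal_def by (simp add: act_const restr_simps restr_id)

lemma T_act_quot: "T_act W S quot s f = restr (CT s f)"
  by (simp add: T_act_def)

lemma finsum_quot:
  assumes "finite A" "g \<in> A \<rightarrow> carrier quot"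
  shows "finsum quot g A = sum g A"
  using assms
proof (induction A rule: finite_induct)
  interpret abelian_group quot by (rule abelian_group_quot)
  case empty
  show ?case by simp
next
  interpret abelian_group quot by (rule abelian_group_quot)
  case (insert x A)
  then have "finsum quot g (insert x A) = g x \<oplus>\<^bsub>quot\<^esub> finsum quot g A"
    by (intro finsum_insert) auto
  then show ?case using insert by simp
qed

lemma minus_quot:
  assumes "f \<in> carrier quot" "g \<in> carrier quot" shows "f \<ominus>\<^bsub>quot\<^esub> g = f - g"
proof -
  interpret abelian_group quot by (rule abelian_group_quot)
  have "- g \<in> carrier quot" using assms(2) by (simp add: keys_uminus)
  then have "\<ominus>\<^bsub>quot\<^esub> g = - g" using assms(2) by (intro minus_equality) auto
  then show ?thesis by (simp add: a_minus_def)
qed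

section \<open>Bases of the quotient\<close>

lemma finsum_scal_quot:
  assumes "finite A" "\<And>w. w \<in> A \<Longrightarrow> Poly_Mapping.keys (e w) \<subseteq> X"
  shows "finsum quot (\<lambda>w. scal W S quot (a w) (e w)) A = (\<Sum>w \<in> A. vscale (a w) (e w))"
proof -
  have *: "scal W S quot (a w) (e w) = vscale (a w) (e w)" if "w \<in> A" for w
    using assms(2)[OF that] by (rule scal_quot)
  have "(\<lambda>w. scal W S quot (a w) (e w)) \<in> A \<rightarrow> carrier quot"
    using assms(2) keys_vscale * by fastforce
  then show ?thesis using * by (simp add: finsum_quot[OF assms(1)])
qed

lemma is_basis_quotI:
  assumes "\<And>w. w \<in> X \<Longrightarrow> Poly_Mapping.keys (e w) \<subseteq> X"
    and "\<And>x. Poly_Mapping.keys x \<subseteq> X \<Longrightarrow> \<exists>!f. Poly_Mapping.keys f \<subseteq> X \<and> lincomb e f = x"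
  shows "is_basis W S quot X e"
proof -
  have "finsum quot (\<lambda>w. scal W S quot (Poly_Mapping.lookup f w) (e w)) (Poly_Mapping.keys f) = lincomb e f"
    if "Poly_Mapping.keys f \<subseteq> X" for f
    unfolding lincomb_def by (rule finsum_scal_quot) (use that assms(1) in auto)
  then have *: "(Poly_Mapping.keys f \<subseteq> X \<and>
        x = finsum quot (\<lambda>w. scal W S quot (Poly_Mapping.lookup f w) (e w)) (Poly_Mapping.keys f)) =
      (Poly_Mapping.keys f \<subseteq> X \<and> lincomb e f = x)" for f x
    by auto
  show ?thesis unfolding is_basis_def * using assms by simp
qed

lemma is_basis_vunit: "is_basis W S quot X vunit"
  by (rule is_basis_quotI) (auto simp: lincomb_vunit, simp add: vunit_def)

text \<open>Also used for \<open>w\<close> in I - X: the unit vector at \<open>w\<close> is then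
  projected away, and only multiples of q are left.\<close>

definition b1 where "b1 w = restr (\<beta> w)"

lemma keys_b1: "Poly_Mapping.keys (b1 w) \<subseteq> X"
  unfolding b1_def keys_restr by blast

definition belowX where "belowX w = {y \<in> X. bruhat_less W S y w}"

lemma finite_belowX: "w \<in> carrier W \<Longrightarrow> finite (belowX w)"
  unfolding belowX_def by (rule finite_subset[OF _ finite_less[of w]]) (use X_subset in auto)

lemma belowX_inter: "belowX w = coord.below w \<inter> X"
  using X_subset unfolding belowX_def coord.below_def by blast

lemma b1_expand:
  assumes "w \<in> I" shows "b1 w = restr (vunit w) + (\<Sum>y \<in> belowX w. vscale (lq * p y w) (vunit y))"
proof -
  have "b1 w = restr (vunit w) + (\<Sum>y \<in> coord.below w. vscale (lq * p y w) (restr (vunit y)))"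
    unfolding b1_def coord.\<beta>_below[OF assms] by (simp add: restr_simps restr_sum)
  also have "(\<Sum>y \<in> coord.below w. vscale (lq * p y w) (restr (vunit y))) =
      (\<Sum>y \<in> belowX w. vscale (lq * p y w) (vunit y))"
    using coord.finite_below[OF assms] unfolding belowX_inter
    by (intro sum.mono_neutral_cong_right) (auto simp: restr_unit)
  finally show ?thesis .
qed

lemma b1_lookup:
  assumes "w \<in> X"
  shows "Poly_Mapping.lookup (b1 w) y = (if y = w then 1 else if y \<in> belowX w then lq * p y w else 0)"
  using assms X_subset coord.\<beta>_lookup[of w y] unfolding b1_def lookup_restr belowX_inter by auto

text \<open>Inverts the unitriangular change of basis. Entries of the inverse are kept in A^+, since
  this is what transports divisibility by q to the coefficients of weak ascents.\<close>

lemma b1_inverse: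
  assumes "w \<in> X"
  shows "\<exists>g \<in> vpos. Poly_Mapping.keys g \<subseteq> insert w (belowX w) \<and> lincomb b1 g = vunit w"
  using assms
proof (induction "ll w" arbitrary: w rule: less_induct)
  case less
  have "\<forall>y \<in> belowX w. \<exists>g. g \<in> vpos \<and> Poly_Mapping.keys g \<subseteq> insert y (belowX y) \<and> lincomb b1 g = vunit y"
    using less bruhat_less_len unfolding belowX_def by blast
  from bchoice[OF this] obtain G where G: "\<And>y. y \<in> belowX w \<Longrightarrow> G y \<in> vpos"
      "\<And>y. y \<in> belowX w \<Longrightarrow> Poly_Mapping.keys (G y) \<subseteq> insert y (belowX y)"
      "\<And>y. y \<in> belowX w \<Longrightarrow> lincomb b1 (G y) = vunit y"
    by blast
  \<comment> \<open>By \<open>b1_expand\<close>, c_w is \<open>b1 w\<close> minus the terms q p c_y,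
    and \<open>G y\<close> already expresses each c_y.\<close>
  let ?s = "\<Sum>y \<in> belowX w. vscale (lq * p y w) (G y)"
  have wI: "w \<in> I" using less X_subset by blast
  have sub: "insert y (belowX y) \<subseteq> belowX w" if "y \<in> belowX w" for y
    using that bruhat_less_trans unfolding belowX_def by blast
  have "?s \<in> vpos"
    using G(1) wI X_subset unfolding belowX_def
    by (intro vpos_sum vpos_scale laurent_pos_mult laurent_pos_lq coord.p_pos) auto
  then have "vunit w - ?s \<in> vpos" by (intro vpos_diff vpos_unit)
  moreover have "Poly_Mapping.keys ?s \<subseteq> belowX w"
  proof (rule keys_vscale_sum)
    fix y assume y: "y \<in> belowX w"
    show "Poly_Mapping.keys (G y) \<subseteq> belowX w" by (rule subset_trans[OF G(2)[OF y] sub[OF y]])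
  qed
  then have "Poly_Mapping.keys (vunit w - ?s) \<subseteq> insert w (belowX w)"
    using keys_minus_subset[of "vunit w" ?s] by (auto simp: vunit_def)
  moreover have "lincomb b1 (vunit w - ?s) = vunit w"
    using b1_expand[OF wI] less(2)
    by (simp add: lincomb_minus lincomb_unit lincomb_sum lincomb_scale G(3) restr_unit)
  ultimately show ?case by blast
qed

text \<open>Since inverse entries lie below their column index, a lower set \<open>D\<close> of
  \<open>X\<close> is preserved. D = X yields spanning; the elements of \<open>X\<close> below
  \<open>sw\<close> yield the coefficients of a weak ascent.\<close>

lemma b1_solve:
  assumes D: "D \<subseteq> X" "\<And>y. y \<in> D \<Longrightarrow> belowX y \<subseteq> D" and x: "Poly_Mapping.keys x \<subseteq> D"
  shows "\<exists>R. Poly_Mapping.keys R \<subseteq> D \<and> lincomb b1 R = x \<and> (x \<in> vqpos \<longrightarrow> R \<in> vqpos)"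
proof -
  have "\<forall>y \<in> X. \<exists>g. g \<in> vpos \<and> Poly_Mapping.keys g \<subseteq> insert y (belowX y) \<and> lincomb b1 g = vunit y"
    using b1_inverse by blast
  from bchoice[OF this] obtain G where G: "\<And>y. y \<in> X \<Longrightarrow> G y \<in> vpos"
      "\<And>y. y \<in> X \<Longrightarrow> Poly_Mapping.keys (G y) \<subseteq> insert y (belowX y)"
      "\<And>y. y \<in> X \<Longrightarrow> lincomb b1 (G y) = vunit y"
    by blast
  define R where "R = (\<Sum>y \<in> Poly_Mapping.keys x. vscale (Poly_Mapping.lookup x y) (G y))"
  have "Poly_Mapping.keys R \<subseteq> D"
    unfolding R_def
  proof (rule keys_vscale_sum)
    fix y assume "y \<in> Poly_Mapping.keys x"
    then have "y \<in> D" "y \<in> X" using x D by auto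
    then show "Poly_Mapping.keys (G y) \<subseteq> D" using G(2)[of y] D(2)[of y] by blast
  qed
  moreover have "lincomb b1 R = (\<Sum>y \<in> Poly_Mapping.keys x. vscale (Poly_Mapping.lookup x y) (vunit y))"
    unfolding R_def lincomb_sum lincomb_scale using G(3) x D(1) by (intro sum.cong) auto
  then have "lincomb b1 R = x" using vunit_expansion[OF finite_keys order.refl, of x] by simp
  moreover have "R \<in> vqpos" if "x \<in> vqpos"
    unfolding R_def using that G(1) x D(1) by (intro vqpos_sum vqpos_scale) (auto simp: vqpos_def)
  ultimately show ?thesis by blast
qed

text \<open>At an index \<open>w\<close> of maximal length in the support, no other
  \<open>b1 y\<close> of the combination has a nonzero coordinate, and \<open>b1 w\<close> has
  coordinate one.\<close>

lemma b1_independent: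
  assumes "Poly_Mapping.keys d \<subseteq> X" "lincomb b1 d = 0" shows "d = 0"
proof (rule ccontr)
  assume "d \<noteq> 0"
  then have ne: "Poly_Mapping.keys d \<noteq> {}" by (metis all_not_in_conv in_keys_iff lookup_zero poly_mapping_eqI)
  have "Max (ll ` Poly_Mapping.keys d) \<in> ll ` Poly_Mapping.keys d"
    using ne by (intro Max_in) auto
  then obtain w where w: "w \<in> Poly_Mapping.keys d" "ll w = Max (ll ` Poly_Mapping.keys d)" by auto
  have max: "\<not> ll w < ll y" if "y \<in> Poly_Mapping.keys d" for y
    unfolding w(2) not_less using that by (intro Max_ge) auto
  have "Poly_Mapping.lookup (lincomb b1 d) w =
      (\<Sum>y \<in> Poly_Mapping.keys d. if y = w then Poly_Mapping.lookup d y else 0)"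
    unfolding lincomb_def lookup_sum
  proof (rule sum.cong)
    fix y assume y: "y \<in> Poly_Mapping.keys d"
    then have "w \<notin> belowX y" using max[OF y] bruhat_less_len[of w y] unfolding belowX_def by blast
    then show "Poly_Mapping.lookup (vscale (Poly_Mapping.lookup d y) (b1 y)) w =
        (if y = w then Poly_Mapping.lookup d y else 0)"
      using y assms(1) b1_lookup[of y w] by auto
  qed simp
  also have "\<dots> = Poly_Mapping.lookup d w" using w by (simp add: sum.delta)
  finally show False using w assms(2) by (simp add: in_keys_iff)
qed

lemma is_basis_b1: "is_basis W S quot X b1"
proof (rule is_basis_quotI[OF keys_b1])
  fix x :: "'w \<Rightarrow>\<^sub>0 laurent" assume x: "Poly_Mapping.keys x \<subseteq> X"
  have "\<exists>R. Poly_Mapping.keys R \<subseteq> X \<and> lincomb b1 R = x"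
    using b1_solve[OF order.refl _ x] unfolding belowX_def by blast
  moreover have "f = g" if "Poly_Mapping.keys f \<subseteq> X \<and> lincomb b1 f = x" "Poly_Mapping.keys g \<subseteq> X \<and> lincomb b1 g = x" for f g
  proof -
    have "Poly_Mapping.keys (f - g) \<subseteq> X" using keys_minus_subset[of f g] that by blast
    moreover have "lincomb b1 (f - g) = 0" using that by (simp add: lincomb_minus)
    ultimately show ?thesis using b1_independent by force
  qed
  ultimately show "\<exists>!f. Poly_Mapping.keys f \<subseteq> X \<and> lincomb b1 f = x" by blast
qed

section \<open>The ideal module structure on the quotient\<close>

lemma restr_CT_b1: "s \<in> S \<Longrightarrow> w \<in> I \<Longrightarrow> restr (CT s (b1 w)) = restr (CT s (\<beta> w))"
  unfolding b1_def by (rule restr_act[OF hecke_T_closed coord.keys_\<beta>_I])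

text \<open>A weak ascent for \<open>X\<close> comes from a strong ascent leading into I - X or from
  a weak ascent for \<open>I\<close>. In both cases the deviation from q b_w is divisible by q and
  supported below \<open>sw\<close>, and \<open>b1_solve\<close> preserves both properties.\<close>

lemma hecke_action_quot_WA:
  assumes w: "w \<in> X" "s \<in> WA W S J X w"
  shows "\<exists>r :: 'w \<Rightarrow> laurent. (\<forall>y. r y \<in> (*) lq ` laurent_pos) \<and>
     restr (CT s (b1 w)) = vscale lq (b1 w) - (\<Sum>y \<in> belowX (s \<otimes> w). vscale (r y) (b1 y))"
proof -
  have wI: "w \<in> I" and wc: "w \<in> carrier W" using w X_subset I_carrier by auto
  have s: "s \<in> S" "bruhat_less W S w (s \<otimes> w)" "s \<otimes> w \<in> D_set W S J" "s \<otimes> w \<notin> X"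
    using w(2) unfolding WA_def by auto
  let ?D = "belowX (s \<otimes> w)"
  have lq: "lq \<in> (*) lq ` laurent_pos" using laurent_pos_one by force
  have down: "insert y (belowX y) \<subseteq> ?D" if "y \<in> ?D" for y
    using that bruhat_less_trans unfolding belowX_def by blast
  have down': "belowX y \<subseteq> ?D" if "bruhat_less W S y (s \<otimes> w)" for y
    using that bruhat_less_trans unfolding belowX_def by blast
  have wD: "w \<in> ?D" using w(1) s(2) unfolding belowX_def by blast
  have b1_keys: "Poly_Mapping.keys (b1 y) \<subseteq> ?D" if "y \<in> I" "bruhat_less W S y (s \<otimes> w)" for y
  proof -
    have "Poly_Mapping.keys (b1 y) \<subseteq> insert y (coord.below y) \<inter> X"
      unfolding b1_def keys_restr using coord.keys_\<beta>[OF that(1)] by blast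
    also have "\<dots> \<subseteq> ?D" using down'[OF that(2)] that(2) unfolding belowX_inter[symmetric] Int_insert_left
      by (auto simp: belowX_def)
    finally show ?thesis .
  qed
  \<comment> \<open>The vector that must be expanded in the \<open>b1 y\<close>, with coefficients
    in q A^+ and support below \<open>sw\<close>.\<close>
  define x where "x = vscale lq (b1 w) - restr (CT s (b1 w))"
  have "x \<in> vqpos \<and> Poly_Mapping.keys x \<subseteq> ?D"
  proof (cases "s \<otimes> w \<in> I")
    case True
    then have "s \<in> SA W S I w" using s unfolding SA_def by auto
    then have "restr (CT s (b1 w)) = b1 (s \<otimes> w)"
      unfolding restr_CT_b1[OF s(1) wI] unfolding b1_def using coord.T_SA[OF wI] by simp
    \<comment> \<open>As \<open>sw\<close> lies outside \<open>X\<close>, its unit vector is gone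
      and every remaining coefficient has the factor q.\<close>
    also have "\<dots> = (\<Sum>y \<in> ?D. vscale (lq * p y (s \<otimes> w)) (vunit y))"
      using b1_expand[OF True] s(4) by (simp add: restr_unit)
    finally have eq: "x = vscale lq (b1 w) - (\<Sum>y \<in> ?D. vscale (lq * p y (s \<otimes> w)) (vunit y))"
      unfolding x_def by simp
    have "x \<in> vqpos" unfolding eq b1_def
      using coord.\<beta>_pos[OF wI] lq True X_subset
      by (intro vqpos_diff vqpos_scale vqpos_sum restr_pos vpos_unit imageI coord.p_pos)
        (auto simp: belowX_def)
    moreover have "Poly_Mapping.keys x \<subseteq> ?D"
    proof -
      have "Poly_Mapping.keys (\<Sum>y \<in> ?D. vscale (lq * p y (s \<otimes> w)) (vunit y)) \<subseteq> ?D"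
        by (rule keys_vscale_sum) (simp add: vunit_def)
      then show ?thesis
        using keys_minus_subset[of "vscale lq (b1 w)" "\<Sum>y \<in> ?D. vscale (lq * p y (s \<otimes> w)) (vunit y)"]
          keys_vscale[of lq "b1 w"] b1_keys[OF wI s(2)] unfolding eq by blast
    qed
    ultimately show ?thesis by blast
  next
    case False
    then have "s \<in> WA W S J I w" using s unfolding WA_def by auto
    then obtain r where r: "\<forall>y. r y \<in> (*) lq ` laurent_pos"
      "CT s (\<beta> w) = vscale lq (\<beta> w) - (\<Sum>y \<in> {y \<in> I. bruhat_less W S y (s \<otimes> w)}. vscale (r y) (\<beta> y))"
      using coord.T_WA[OF wI] by blast
    \<comment> \<open>The sum still runs over \<open>I\<close>; for \<open>y\<close> outside
      \<open>X\<close> the vector \<open>b1 y\<close> is not a basis vector, which is why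
      \<open>b1_solve\<close> is applied afterwards.\<close>
    have eq: "x = (\<Sum>y \<in> {y \<in> I. bruhat_less W S y (s \<otimes> w)}. vscale (r y) (b1 y))"
      unfolding x_def restr_CT_b1[OF s(1) wI] r(2) unfolding b1_def by (simp add: restr_simps restr_sum)
    have "x \<in> vqpos" unfolding eq b1_def
      using r(1) coord.\<beta>_pos by (intro vqpos_sum vqpos_scale restr_pos) auto
    moreover have "Poly_Mapping.keys x \<subseteq> ?D"
      unfolding eq
      by (rule keys_vscale_sum, rule b1_keys) auto
    ultimately show ?thesis by blast
  qed
  moreover have "?D \<subseteq> X" unfolding belowX_def by blast
  ultimately obtain R where R: "Poly_Mapping.keys R \<subseteq> ?D" "lincomb b1 R = x" "R \<in> vqpos"
    using b1_solve[of ?D x] down by blast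
  have "x = (\<Sum>y \<in> ?D. vscale (Poly_Mapping.lookup R y) (b1 y))"
    using lincomb_superset[OF finite_belowX R(1), of b1] R(2) wc s(1) by simp
  then show ?thesis
    using R(3) unfolding x_def vqpos_def
    by (intro exI[of _ "Poly_Mapping.lookup R"]) (simp add: algebra_simps)
qed

lemma hecke_action_quot: "hecke_action W S J X quot b1"
  unfolding hecke_action_def
proof (intro ballI conjI)
  fix w s assume w: "w \<in> X"
  then have wI: "w \<in> I" and wc: "w \<in> carrier W" using X_subset I_carrier by auto
  {
    assume "s \<in> SA W S X w"
    then have s: "s \<in> SA W S I w" "s \<in> S" using X_subset unfolding SA_def by auto
    then show "T_act W S quot s (b1 w) = b1 (s \<otimes> w)"
      unfolding T_act_quot restr_CT_b1[OF s(2) wI] unfolding b1_def using coord.T_SA[OF wI] by simp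
  }
  {
    assume "s \<in> SD W S w"
    then have s: "s \<in> S" "ll (s \<otimes> w) < ll w" using SD_iff[OF wI] unfolding SD_def by auto
    have sw: "s \<otimes> w \<in> I" using descend_in_I wI s by blast
    have "s \<in> SA W S I (s \<otimes> w)" unfolding SA_def using s wI wc bruhat_less_gen'[of s w] by auto
    then have "CT s (\<beta> (s \<otimes> w)) = \<beta> w" using coord.T_SA[OF sw] s wc by simp
    \<comment> \<open>The rule for a strong descent is recovered from the strong ascent of
      \<open>sw\<close> by applying T_s again and using the quadratic relation.\<close>
    then have "CT s (\<beta> w) = \<beta> (s \<otimes> w) + vscale hecke_zeta (\<beta> w)"
      using coord.T_square[OF s(1) coord.keys_\<beta>_I[OF sw]] by simp
    then show "T_act W S quot s (b1 w) = b1 (s \<otimes> w) \<oplus>\<^bsub>quot\<^esub> scal W S quot hecke_zeta (b1 w)"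
      unfolding T_act_quot restr_CT_b1[OF s(1) wI] scal_quot[OF keys_b1] unfolding b1_def by (simp add: restr_simps)
  }
  {
    assume s: "s \<in> WD W S J w"
    then have "s \<in> S" unfolding WD_def by auto
    then show "T_act W S quot s (b1 w) = scal W S quot (- lq_inv) (b1 w)"
      unfolding T_act_quot scal_quot[OF keys_b1]
      using coord.T_WD[OF wI s] unfolding restr_CT_b1[OF \<open>s \<in> S\<close> wI] unfolding b1_def by (simp add: restr_simps)
  }
  {
    assume s: "s \<in> WA W S J X w"
    obtain r where r: "\<forall>y. r y \<in> (*) lq ` laurent_pos"
      "restr (CT s (b1 w)) = vscale lq (b1 w) - (\<Sum>y \<in> belowX (s \<otimes> w). vscale (r y) (b1 y))"
      using hecke_action_quot_WA[OF w s] by blast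
    have sw: "s \<otimes> w \<in> carrier W" using s wc unfolding WA_def by auto
    have fs: "finsum quot (\<lambda>y. scal W S quot (r y) (b1 y)) (belowX (s \<otimes> w)) = (\<Sum>y \<in> belowX (s \<otimes> w). vscale (r y) (b1 y))"
      by (rule finsum_scal_quot[OF finite_belowX[OF sw] keys_b1])
    have "Poly_Mapping.keys (vscale lq (b1 w)) \<subseteq> X" by (rule subset_trans[OF keys_vscale keys_b1])
    moreover have "Poly_Mapping.keys (\<Sum>y \<in> belowX (s \<otimes> w). vscale (r y) (b1 y)) \<subseteq> X"
      by (rule keys_vscale_sum[OF keys_b1])
    ultimately have "T_act W S quot s (b1 w) = scal W S quot lq (b1 w) \<ominus>\<^bsub>quot\<^esub>
          finsum quot (\<lambda>y. scal W S quot (r y) (b1 y)) (belowX (s \<otimes> w))"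
      unfolding fs unfolding scal_quot[OF keys_b1] T_act_quot r(2) by (subst minus_quot) auto
    then show "\<exists>r :: 'w \<Rightarrow> laurent. (\<forall>y. r y \<in> (*) lq ` laurent_pos) \<and>
        T_act W S quot s (b1 w) = scal W S quot lq (b1 w) \<ominus>\<^bsub>quot\<^esub>
          finsum quot (\<lambda>y. scal W S quot (r y) (b1 y)) {y \<in> X. bruhat_less W S y (s \<otimes> w)}"
      using r(1) unfolding belowX_def by blast
  }
qed

text \<open>Bar acts on coefficients and hence commutes with the projection
  \<open>restr\<close>.\<close>

lemma module_involution_quot: "module_involution W S quot vbar"
  unfolding module_involution_def
proof (intro conjI ballI allI)
  fix h f assume h: "h \<in> carrier (hecke W S)" and f: "f \<in> carrier quot"
  have "Poly_Mapping.keys f \<subseteq> I" using f X_subset by auto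
  then show "vbar (h \<odot>\<^bsub>quot\<^esub> f) = hecke_bar W S h \<odot>\<^bsub>quot\<^esub> vbar f"
    by (simp add: restr_simps(4)[symmetric] vbar_act[OF h])
next
  fix a f assume "f \<in> carrier quot"
  then show "vbar (scal W S quot a f) = scal W S quot (laurent_bar a) (vbar f)"
    using keys_vbar[of f] by (simp add: scal_quot vbar_simps)
next
  fix f assume "f \<in> carrier quot"
  then show "vbar f \<in> carrier quot" using keys_vbar[of f] by simp
qed (simp_all add: vbar_simps)

lemma one_in_X: "\<one> \<in> X"
  using coord.one_in_I unfolding coord.I1_def wg_le_def by simp

lemma ideal_module_quot: "ideal_module W S J X quot b1 vbar"
  unfolding ideal_module_def
  using left_module_quot is_basis_b1 hecke_action_quot module_involution_quot one_in_X
  by (simp add: b1_def coord.\<beta>_one restr_unit vbar_simps)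

lemma W_graph_basis_quot: "W_graph_basis W S X quot b1 vbar vunit p"
  unfolding W_graph_basis_def
proof (intro conjI ballI impI)
  show "is_basis W S quot X vunit" by (rule is_basis_vunit)
next
  fix w assume "w \<in> X"
  show "vbar (vunit w) = vunit w" by (rule vbar_simps)
next
  fix w y assume "w \<in> X" "y \<in> X" "bruhat_less W S y w"
  then show "p y w \<in> laurent_pos" using coord.p_pos X_subset by blast
next
  fix w assume w: "w \<in> X"
  then have wI: "w \<in> I" and wc: "w \<in> carrier W" using X_subset I_carrier by auto
  have ku: "Poly_Mapping.keys (vunit y :: 'w \<Rightarrow>\<^sub>0 laurent) \<subseteq> X" if "y \<in> X" for y using that by (simp add: vunit_def)
  let ?s = "\<Sum>y \<in> belowX w. vscale (p y w) (vunit y)"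
  have fs: "finsum quot (\<lambda>y. scal W S quot (p y w) (vunit y)) (belowX w) = ?s"
    by (rule finsum_scal_quot[OF finite_belowX[OF wc]]) (use ku in \<open>auto simp: belowX_def\<close>)
  have k: "Poly_Mapping.keys ?s \<subseteq> X"
    by (rule keys_vscale_sum, rule ku) (auto simp: belowX_def)
  have "b1 w = vunit w + vscale lq ?s"
    using b1_expand[OF wI] w by (simp add: restr_unit vscale_sum)
  then show "b1 w = vunit w \<oplus>\<^bsub>quot\<^esub> scal W S quot lq
      (finsum quot (\<lambda>y. scal W S quot (p y w) (vunit y)) {y \<in> X. bruhat_less W S y w})"
    using fs k unfolding belowX_def[symmetric] by (simp add: scal_quot)
qed

section \<open>The graph of the quotient\<close>

lemma W_graph_ideal_X: "W_graph_ideal W S J X"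
proof -
  interpret Q: ideal_in_coxeter W S J X by (rule coord.I1_ideal)
  show ?thesis unfolding W_graph_ideal_def
    using Q.I_ne Q.I_ideal Q.J_Pos ideal_module_quot by blast
qed

lemma graph_X: "basis_graph W S J X p = full_subgraph coord.\<Gamma> X"
  using X_subset by (simp add: basis_graph_def full_subgraph_def fun_eq_iff subset_iff)

lemma W_graph_X: "W_graph W S (full_subgraph coord.\<Gamma> X)"
  unfolding W_graph_def
proof (intro conjI ballI)
  fix v assume "v \<in> verts (full_subgraph coord.\<Gamma> X)"
  then show "tau (full_subgraph coord.\<Gamma> X) v \<subseteq> S"
    using X_subset by (auto simp: full_subgraph_def descents_def SD_def WD_def)
next
  let ?\<Delta> = "full_subgraph coord.\<Gamma> X"
  have V: "verts ?\<Delta> = X" by (simp add: full_subgraph_def)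
  show "\<exists>(M :: ('w hecke_elt, 'w \<Rightarrow>\<^sub>0 laurent) module) e.
        left_module (hecke W S) M \<and> is_basis W S M (verts ?\<Delta>) e \<and>
        (\<forall>v \<in> verts ?\<Delta>. \<forall>s \<in> S.
           (s \<in> tau ?\<Delta> v \<longrightarrow> T_act W S M s (e v) = scal W S M (- lq_inv) (e v)) \<and>
           (s \<notin> tau ?\<Delta> v \<longrightarrow>
              finite {u \<in> verts ?\<Delta>. s \<in> tau ?\<Delta> u \<and> mu ?\<Delta> u v \<noteq> 0} \<and>
              T_act W S M s (e v) = scal W S M lq (e v) \<oplus>\<^bsub>M\<^esub>
                finsum M (\<lambda>u. scal W S M (of_int (mu ?\<Delta> u v)) (e u))
                  {u \<in> verts ?\<Delta>. s \<in> tau ?\<Delta> u \<and> mu ?\<Delta> u v \<noteq> 0}))"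
    unfolding V
  proof (intro exI[of _ quot] exI[of _ vunit] conjI ballI impI left_module_quot is_basis_vunit)
    fix v s assume v: "v \<in> X" and s: "s \<in> S"
    have vI: "v \<in> I" using v X_subset by blast
    have tau: "tau ?\<Delta> u = DD u" if "u \<in> X" for u
      using that X_subset by (auto simp: full_subgraph_def)
    have mu: "mu ?\<Delta> u v = mu coord.\<Gamma> u v" if "u \<in> X" for u
      using that v by (simp add: full_subgraph_def)
    have ku: "Poly_Mapping.keys (vunit y :: 'w \<Rightarrow>\<^sub>0 laurent) \<subseteq> X" if "y \<in> X" for y
      using that by (simp add: vunit_def)
    {
      assume "s \<in> tau ?\<Delta> v"
      then show "T_act W S quot s (vunit v) = scal W S quot (- lq_inv) (vunit v)"
        using tau[OF v] coord.T_unit[OF vI s] v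
        by (simp add: T_act_quot scal_quot[OF ku] restr_simps restr_unit)
    }
    assume "s \<notin> tau ?\<Delta> v"
    then have nd: "s \<notin> DD v" using tau[OF v] by simp
    let ?U = "{u \<in> I. s \<in> DD u \<and> mu coord.\<Gamma> u v \<noteq> 0}"
    let ?U1 = "{u \<in> X. s \<in> tau ?\<Delta> u \<and> mu ?\<Delta> u v \<noteq> 0}"
    have U1: "?U1 = ?U \<inter> X" using tau mu X_subset by auto
    show fin: "finite ?U1" unfolding U1 using coord.T_graph(1)[OF vI s nd] by blast
    have "finsum quot (\<lambda>u. scal W S quot (of_int (mu ?\<Delta> u v)) (vunit u)) ?U1 =
        (\<Sum>u \<in> ?U1. vscale (of_int (mu ?\<Delta> u v)) (vunit u))"
      by (rule finsum_scal_quot[OF fin]) (use ku in auto)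
    \<comment> \<open>The sum over the part in \<open>X\<close> may be extended to all of
      \<open>?U\<close>, because \<open>restr\<close> kills the unit vectors outside
      \<open>X\<close>.\<close>
    also have "\<dots> = (\<Sum>u \<in> ?U. restr (vscale (of_int (mu coord.\<Gamma> u v)) (vunit u)))"
      unfolding U1 using coord.T_graph(1)[OF vI s nd] mu
      by (intro sum.mono_neutral_cong_left) (auto simp: restr_simps restr_unit)
    finally have fs: "finsum quot (\<lambda>u. scal W S quot (of_int (mu ?\<Delta> u v)) (vunit u)) ?U1 =
        (\<Sum>u \<in> ?U. restr (vscale (of_int (mu coord.\<Gamma> u v)) (vunit u)))" .
    show "T_act W S quot s (vunit v) = scal W S quot lq (vunit v) \<oplus>\<^bsub>quot\<^esub>
        finsum quot (\<lambda>u. scal W S quot (of_int (mu ?\<Delta> u v)) (vunit u)) ?U1"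
      unfolding fs unfolding T_act_quot coord.T_graph(2)[OF vI s nd] scal_quot[OF ku[OF v]]
      using v by (simp add: restr_simps(1,3) restr_sum restr_unit)
  qed
qed

end

lemma wgraph_moduleI:
  assumes "coxeter_system W S" "I \<noteq> {}" "weak_ideal W S I" "J \<subseteq> Pos W S I"
    "ideal_module W S J I M b bar" "W_graph_basis W S I M b bar c p"
  shows "wgraph_module W S J I M c b bar p"
  using assms unfolding wgraph_module_def wgraph_module_axioms_def hecke_module_def
    hecke_module_axioms_def ideal_in_coxeter_def ideal_in_coxeter_axioms_def
  by (auto simp: ideal_module_def W_graph_basis_def)

context wgraph_module
begin

text \<open>\<open>corresponding_W_graph\<close> is existential in the module. The quotient is a
  witness for one direction; for the other, an arbitrary module over the same ideal is compared with
  the quotient by \<open>wgraph_coords_unique\<close>.\<close>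

lemma corresponding_W_graph_X:
  "corresponding_W_graph W S J X \<Gamma>' \<longleftrightarrow> \<Gamma>' = full_subgraph coord.\<Gamma> X"
proof
  assume "corresponding_W_graph W S J X \<Gamma>'"
  then obtain M' :: "('w hecke_elt, 'w \<Rightarrow>\<^sub>0 laurent) module" and b' bar' c' p' where
    M': "ideal_module W S J X M' b' bar'" "W_graph_basis W S X M' b' bar' c' p'"
      "\<Gamma>' = basis_graph W S J X p'"
    unfolding corresponding_W_graph_def by blast
  interpret X: ideal_in_coxeter W S J X by (rule coord.I1_ideal)
  interpret A: wgraph_module W S J X M' c' b' bar' p'
    by (rule wgraph_moduleI[OF coxeter_system_axioms X.I_ne X.I_ideal X.J_Pos M'(1,2)])
  interpret B: wgraph_module W S J X quot vunit b1 vbar p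
    by (rule wgraph_moduleI[OF coxeter_system_axioms X.I_ne X.I_ideal X.J_Pos ideal_module_quot W_graph_basis_quot])
  have "p' y w = p y w" if "w \<in> X" "y \<in> X" "bruhat_less W S y w" for y w
    using wgraph_coords_unique(2)[OF A.coord.wgraph_coords_axioms B.coord.wgraph_coords_axioms] that by blast
  \<comment> \<open>\<open>basis_graph\<close> reads its coefficients only at pairs y < w in
    \<open>X\<close>, where they agree.\<close>
  then have "basis_graph W S J X p' = basis_graph W S J X p"
    by (simp add: basis_graph_def fun_eq_iff)
  then show "\<Gamma>' = full_subgraph coord.\<Gamma> X" using M'(3) graph_X by simp
next
  assume "\<Gamma>' = full_subgraph coord.\<Gamma> X"
  then show "corresponding_W_graph W S J X \<Gamma>'"
    unfolding corresponding_W_graph_def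
    using ideal_module_quot W_graph_basis_quot graph_X W_graph_X by metis
qed

end

theorem lemma4p9:
  fixes W :: "'w monoid" and S J I :: "'w set"
    and M :: "('w hecke_elt, 'm) module"
    and b c :: "'w \<Rightarrow> 'm" and bar :: "'m \<Rightarrow> 'm"
    and p :: "'w \<Rightarrow> 'w \<Rightarrow> laurent"
  assumes "coxeter_system W S"
    and "W_graph_ideal W S J I"
    and "ideal_module W S J I M b bar"
    and "W_graph_basis W S I M b bar c p"
  defines "\<Gamma> \<equiv> basis_graph W S J I p"
  defines "C1 \<equiv> cell_of \<Gamma> \<one>\<^bsub>W\<^esub>"
  defines "I1 \<equiv> {w \<in> I. w \<in> C1}"
  shows "maximal_cells \<Gamma> = {C1} \<and>
    W_graph_ideal W S J I1 \<and>
    (\<forall>\<Gamma>'. corresponding_W_graph W S J I1 \<Gamma>' \<longleftrightarrow> \<Gamma>' = full_subgraph \<Gamma> C1)"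
proof -
  interpret wgraph_module W S J I M c b bar p
    using assms(2) unfolding W_graph_ideal_def
    by (intro wgraph_moduleI assms(1,3,4)) auto
  have C1: "C1 = X" unfolding C1_def \<Gamma>_def by (rule coord.cell_one)
  then have I1: "I1 = X" unfolding I1_def using X_subset by auto
  show ?thesis
    using coord.maximal_cell W_graph_ideal_X corresponding_W_graph_X coord.cell_one
    unfolding I1 C1 unfolding \<Gamma>_def by simp
qed

end
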